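(* For any positive integer $r$ and any even positive integer $t$, $$\sum_{\lambda\in\mathcal{SC}}q^{|\lambda|}x^{|\mathcal{H}_t(\lambda)|}b^{\mathrm{BG}(\lambda)}\prod_{h\in\mathcal{H}_t(\lambda)}\frac{1}{h}\sum_{h\in\mathcal{H}_t(\lambda)}\prod_{i=1}^r \left(h^2-i^2\right)$$ $$=t\left(q^{2t};q^{2t}\right)_{\infty}^{t/2}\left(-bq;q^4\right)_{\infty}\left(-q^3/b;q^4\right)_{\infty}\exp \left(\frac{x^2q^{2t}}{2t}\right)\sum_{k=\lceil (r-t+1)/t\rceil}^r B_{r,k}(t)\,C(k)\left(\frac{x^2q^{2t}}{t^2}\right)^{k+1}.$$
   Context: A partition is a finite nonincreasing sequence $\lambda=(\lambda_1,\dots,\lambda_\ell)$ of positive integers (the empty partition is allowed), and $|\lambda|$ is the sum of its parts. A partition is identified with its Ferrers diagram, the set of boxes $(i,j)$ (row $i$, column $j$) with $1\le j\le\lambda_i$. The conjugate $\lambda'$ is given by $\lambda'_j=\#\{i:\lambda_i\ge j\}$; $\mathcal{SC}$ is the set of self-conjugate partitions ($\lambda=\lambda'$). The hook-length of a box $(i,j)$ is $\lambda_i-j+\lambda'_j-i+1$; $\mathcal{H}_t(\lambda)$ is the multiset of hook-lengths of $\lambda$ divisible by $t$ (cardinality, products and sums are taken with multiplicity; empty products are $1$, empty sums are $0$). The BG-rank is $\mathrm{BG}(\lambda)=\sum_{(i,j)\in\lambda}(-1)^{i+j}$. Also $(a;q)_\infty=\prod_{j\ge0}(1-aq^j)$.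 For $k\ge0$, $C(k):=\frac{1}{2(k+1)^2}\binom{2k}{k}\binom{2k+2}{k+1}$. The polynomials $B_{r,k}(\alpha)$, $0\le k\le r$, are defined by $B_{r,0}(\alpha)=\prod_{j=1}^r(\alpha^2-j^2)$, $B_{r,k}(\alpha)=\left[\alpha^2(k+1)^2-r^2\right]B_{r-1,k}(\alpha)+\alpha^2B_{r-1,k-1}(\alpha)$ for $k\in\{1,\dots,r-1\}$, and $B_{r,r}(\alpha)=\alpha^{2r}$. The identity is one of formal power series in $q$ whose coefficients are polynomials in $x,b,b^{-1}$. *)

theory Defs
  imports "HOL-Analysis.Analysis"
begin

definition partitions :: "nat list set" where
  "partitions = {l. sorted_wrt (\<ge>) l \<and> (\<forall>p\<in>set l. 0 < p)}"

text \<open>Parts are numbered from 1, and \<open>part l i = 0\<close> beyond the last part.\<close>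

definition part :: "nat list \<Rightarrow> nat \<Rightarrow> nat" where
  "part l i = (if 1 \<le> i \<and> i \<le> length l then l ! (i - 1) else 0)"

definition diagram :: "nat list \<Rightarrow> (nat \<times> nat) set" where
  "diagram l = {(i, j). 1 \<le> i \<and> i \<le> length l \<and> 1 \<le> j \<and> j \<le> part l i}"

text \<open>The conjugate of a partition has exactly \<open>part l 1\<close> (positive) parts.\<close>

definition conjugate :: "nat list \<Rightarrow> nat list" where
  "conjugate l = map (\<lambda>j. card {i. 1 \<le> i \<and> i \<le> length l \<and> j \<le> part l i}) [1..<Suc (part l 1)]"

definition self_conjugate :: "nat list set" where
  "self_conjugate = {l \<in> partitions. conjugate l = l}"

text \<open>On the boxes of the diagram neither subtraction truncates.\<close>

definition hook_length :: "nat list \<Rightarrow> nat \<times> nat \<Rightarrow> nat" where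
  "hook_length l = (\<lambda>(i, j). (part l i - j) + (part (conjugate l) j - i) + 1)"

definition hooks :: "nat \<Rightarrow> nat list \<Rightarrow> nat multiset" where
  "hooks t l = filter_mset (\<lambda>h. t dvd h) (image_mset (hook_length l) (mset_set (diagram l)))"

definition BG_rank :: "nat list \<Rightarrow> int" where
  "BG_rank l = (\<Sum>(i, j)\<in>diagram l. (- 1) ^ (i + j))"

text \<open>The infinite product is taken in the metric (\<open>X\<close>-adic) topology of formal power series.\<close>

definition qpochhammer_inf :: "'a::comm_ring_1 fps \<Rightarrow> 'a fps \<Rightarrow> 'a fps" where
  "qpochhammer_inf a q = (\<Prod>j. 1 - a * q ^ j)"

definition C :: "nat \<Rightarrow> 'a::field_char_0" where
  "C k = 1 / (2 * (of_nat k + 1) ^ 2) * of_nat ((2 * k) choose k) * of_nat ((2 * k + 2) choose (k + 1))"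

text \<open>\<open>B r k\<close> is a polynomial in the indeterminate \<open>\<alpha> = [:0, 1:]\<close>. Only \<open>k \<le> r\<close> is
  meaningful; the value \<open>0\<close> for \<open>k > r\<close> is a dummy which the recursion never reaches
  from arguments with \<open>k \<le> r\<close>.\<close>

function B :: "nat \<Rightarrow> nat \<Rightarrow> 'a::comm_ring_1 poly" where
  "B r k =
    (if k = 0 then (\<Prod>j=1..r. [:0, 1:] ^ 2 - of_nat j ^ 2)
     else if k < r then
       ([:0, 1:] ^ 2 * (of_nat k + 1) ^ 2 - of_nat r ^ 2) * B (r - 1) k
         + [:0, 1:] ^ 2 * B (r - 1) (k - 1)
     else if k = r then [:0, 1:] ^ (2 * r)
     else 0)"
  by auto
termination
  by (relation "Wellfounded.measure fst") auto

declare B.simps [simp del]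

text \<open>In the theorem the coefficients live in an arbitrary field of characteristic 0, with arbitrary \<open>x\<close> and
  nonzero \<open>b\<close>. The identity with indeterminates \<open>x\<close>, \<open>b\<close> is the instance
  \<open>'a = rat fls fls\<close>, \<open>x = fls_const fls_X\<close>, \<open>b = fls_X\<close>, since this field contains the ring
  of polynomials in \<open>x\<close>, \<open>b\<close>, \<open>1/b\<close>. The left-hand series is an unconditional sum in the
  \<open>X\<close>-adic topology.\<close>

end

theory Submission
  imports Defs "HOL-Library.Function_Algebras"
begin

text \<open>
  A partition is encoded by its set of beta numbers \<open>\<lambda>\<^sub>i - i\<close>, a set of integers that differs from the
  negative integers by finitely many elements. Boxes become pairs of an element \<open>s\<close> and a smaller
  non-element \<open>s'\<close>, with hook length \<open>s - s'\<close>, and conjugation becomes \<open>s \<mapsto> - 1 - s\<close> followed by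
  complementation. Splitting by residues modulo \<open>t\<close> (the Littlewood decomposition) turns a
  self-conjugate partition, for even \<open>t\<close>, into \<open>t / 2\<close> arbitrary such sets of arbitrary charge, that
  is, \<open>t / 2\<close> integers and \<open>t / 2\<close> partitions; each hook of these partitions gives two hooks of
  length divisible by \<open>t\<close>. The charges contribute theta functions, whose product is read off from the
  same decomposition without hook weights and Euler's product.

  The partitions contribute powers of \<open>exp\<close> and one factor given by Okada's formula for the
  Plancherel average of \<open>\<Prod>\<^sub>i (h\<^sup>2 - i\<^sup>2)\<close> summed over the hooks. For the latter, with \<open>p(z)\<close> the sum of \<open>z\<^sup>c\<close> over the
  contents \<open>c\<close> and \<open>w = z - 2 + 1/z\<close>, one has \<open>\<Sum>\<^sub>h (z\<^sup>h + z\<^sup>-\<^sup>h) = p(z) + p(1/z) + w p(z) p(1/z)\<close>.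
  The right-hand side is averaged with the operators \<open>U\<close> and \<open>D\<close> that add and remove a box and the
  diagonal operators of \<open>p(z)\<close> and \<open>p(1/z)\<close>: their commutation relations alone determine the
  vacuum expectations. Comparing coefficients of powers of \<open>w\<close> yields Okada's formula.
\<close>

section \<open>Vacuum expectations\<close>

text \<open>Plancherel averages are vacuum expectations: n! times the inverse hook product counts
  the ways to build a partition of n box by box, so \<open>L\<close> applied to D^n T U^n sums a
  diagonal operator T with the square of this weight. Moving T to the right through U^n leaves only
  its iterated commutators with U. For one content operator these are immediate. The obstacle is the
  product p(z) p(1/z): its left factor is separated from the vacuum by the right one, so the
  boundary values of the recursion are not evident and are found from the commutator of the two
  factors. The recursion itself is Pascal's rule, which is the origin of the central binomials in
  \<open>C\<close>.

  The other constants: since a component hook h accounts for two hooks t h, every box of a component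
  carries x^2 / t^2; the t / 2 exponentials multiply to exp(x^2 q^(2 t) / (2 t)), and a factor 2 on
  each of t / 2 components gives the prefactor t. The polynomials \<open>B\<close> re-expand the
  product over i at t h in such products at h, and their zeros at \<alpha> = t give the lower limit
  of the sum.\<close>

primrec ad_pow :: "'r::ring_1 \<Rightarrow> nat \<Rightarrow> 'r \<Rightarrow> 'r" where
  "ad_pow U 0 T = T"
| "ad_pow U (Suc k) T = ad_pow U k T * U - U * ad_pow U k T"

lemma ad_pow_Suc2: "ad_pow U (Suc k) T = ad_pow U k (T * U - U * T)"
  by (induction k) simp_all

lemma ad_pow_diff: "ad_pow U k (S - T) = ad_pow U k S - ad_pow U k T"
proof (induction k)
  case (Suc k)
  show ?case unfolding ad_pow.simps Suc.IH by (simp add: algebra_simps)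
qed simp

lemma ad_pow_minus: "ad_pow U k (- T) = - ad_pow U k T"
proof (induction k)
  case (Suc k)
  show ?case unfolding ad_pow.simps Suc.IH by (simp add: algebra_simps)
qed simp

lemma ad_pow_self [simp]: "ad_pow U (Suc k) U = 0"
  by (induction k) simp_all

text \<open>Leibniz's rule, as commuting with U is a derivation of the ring. The derivation is
  applied once on the inside, and the two binomial sums merge by Pascal's rule.\<close>

lemma ad_pow_mult:
  "ad_pow U k (S * T) = (\<Sum>i\<le>k. of_nat (k choose i) * (ad_pow U i S * ad_pow U (k - i) T))"
proof (induction k arbitrary: S T)
  case 0
  show ?case by simp
next
  case (Suc k)
  define s where "s i = ad_pow U i S" for i
  define t where "t i = ad_pow U i T" for i
  have "ad_pow U (Suc k) (S * T) =
      ad_pow U k (S * (T * U - U * T) - - ((S * U - U * S) * T))"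
    by (simp only: ad_pow_Suc2) (simp add: algebra_simps)
  also have "\<dots> = ad_pow U k (S * (T * U - U * T)) - - ad_pow U k ((S * U - U * S) * T)"
    by (simp only: ad_pow_diff ad_pow_minus)
  also have "ad_pow U k (S * (T * U - U * T)) = (\<Sum>i\<le>k. of_nat (k choose i) * (s i * t (Suc (k - i))))"
    unfolding Suc.IH s_def t_def ad_pow_Suc2 ..
  also have "ad_pow U k ((S * U - U * S) * T) = (\<Sum>i\<le>k. of_nat (k choose i) * (s (Suc i) * t (k - i)))"
    unfolding Suc.IH s_def t_def ad_pow_Suc2 ..
  also have "(\<Sum>i\<le>k. of_nat (k choose i) * (s i * t (Suc (k - i)))) =
             (\<Sum>i\<le>k. of_nat (k choose i) * (s i * t (Suc k - i)))"
    by (intro sum.cong) (auto simp: Suc_diff_le)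
  also have "\<dots> = (\<Sum>i\<le>Suc k. of_nat (k choose i) * (s i * t (Suc k - i)))"
    by (simp add: binomial_eq_0)
  also have "\<dots> = s 0 * t (Suc k) + (\<Sum>i\<le>k. of_nat (k choose Suc i) * (s (Suc i) * t (k - i)))"
    by (subst sum.atMost_Suc_shift) simp
  also have "s 0 * t (Suc k) + (\<Sum>i\<le>k. of_nat (k choose Suc i) * (s (Suc i) * t (k - i)))
      - - (\<Sum>i\<le>k. of_nat (k choose i) * (s (Suc i) * t (k - i))) =
      s 0 * t (Suc k) + (\<Sum>i\<le>k. of_nat (Suc k choose Suc i) * (s (Suc i) * t (Suc k - Suc i)))"
    by (simp add: sum.distrib algebra_simps)
  also have "\<dots> = (\<Sum>i\<le>Suc k. of_nat (Suc k choose i) * (s i * t (Suc k - i)))"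
    unfolding sum.atMost_Suc_shift[of _ k] by simp
  finally show ?case by (simp only: s_def t_def)
qed

text \<open>Right multiplication by U is left multiplication by U plus the commutator with U. These
  two maps commute, so the n-th power expands binomially, and every U is collected to the left of
  T.\<close>

lemma mult_power_ad:
  "T * U ^ n = (\<Sum>k\<le>n. of_nat (n choose k) * (U ^ (n - k) * ad_pow U k T))"
proof (induction n arbitrary: T)
  case 0
  show ?case by simp
next
  case (Suc n)
  define x where "x i = ad_pow U i T" for i
  have "T * U ^ Suc n = U * (T * U ^ n) + (T * U - U * T) * U ^ n"
    by (simp add: algebra_simps)
  also have "(T * U - U * T) * U ^ n = (\<Sum>k\<le>n. of_nat (n choose k) * (U ^ (n - k) * x (Suc k)))"
    unfolding Suc.IH x_def ad_pow_Suc2 ..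
  also have "T * U ^ n = (\<Sum>k\<le>n. of_nat (n choose k) * (U ^ (n - k) * x k))"
    unfolding Suc.IH x_def ..
  also have "U * (\<Sum>k\<le>n. of_nat (n choose k) * (U ^ (n - k) * x k)) =
             (\<Sum>k\<le>n. of_nat (n choose k) * (U ^ (Suc n - k) * x k))"
    unfolding sum_distrib_left
  proof (intro sum.cong refl)
    fix k assume "k \<in> {..n}"
    then have "U ^ (Suc n - k) = U * U ^ (n - k)" by (simp add: Suc_diff_le)
    moreover have "U * (of_nat (n choose k) * y) = of_nat (n choose k) * (U * y)" for y
      using mult_of_nat_commute[of "n choose k" U] by (metis mult.assoc)
    ultimately show "U * (of_nat (n choose k) * (U ^ (n - k) * x k)) =
        of_nat (n choose k) * (U ^ (Suc n - k) * x k)"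
      by (simp add: mult.assoc)
  qed
  also have "\<dots> = (\<Sum>k\<le>Suc n. of_nat (n choose k) * (U ^ (Suc n - k) * x k))"
    by (simp add: binomial_eq_0)
  also have "\<dots> = U ^ Suc n * x 0 + (\<Sum>k\<le>n. of_nat (n choose Suc k) * (U ^ (n - k) * x (Suc k)))"
    by (subst sum.atMost_Suc_shift) simp
  also have "U ^ Suc n * x 0 + (\<Sum>k\<le>n. of_nat (n choose Suc k) * (U ^ (n - k) * x (Suc k))) +
        (\<Sum>k\<le>n. of_nat (n choose k) * (U ^ (n - k) * x (Suc k))) =
      U ^ Suc n * x 0 + (\<Sum>k\<le>n. of_nat (Suc n choose Suc k) * (U ^ (Suc n - Suc k) * x (Suc k)))"
    by (simp add: sum.distrib algebra_simps)
  also have "\<dots> = (\<Sum>k\<le>Suc n. of_nat (Suc n choose k) * (U ^ (Suc n - k) * x k))"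
    unfolding sum.atMost_Suc_shift[of _ n] by simp
  finally show ?case by (simp only: x_def)
qed

text \<open>\<open>D\<close> and \<open>U\<close> remove and add a box, \<open>A\<close> and \<open>A'\<close> are the diagonal operators of a content
  generating function at \<open>z\<close> and at \<open>1 / z\<close>, and \<open>L\<close> is the vacuum expectation.\<close>

locale vacuum_algebra =
  fixes D U A A' W :: "'r::ring_1" and L :: "'r \<Rightarrow> 'a::field_char_0" and w :: 'a
  assumes L_add: "L (S + T) = L S + L T"
    and L_one: "L 1 = 1"
    and L_W: "L (T * W) = w * L T"
    and L_U: "L (U * T) = 0"
    and L_D: "L (T * D) = 0"
    and L_A: "L (T * A) = 0"
    and L_A': "L (T * A') = 0"
    and WU: "W * U = U * W" and WD: "W * D = D * W"
    and WA: "W * A = A * W" and WA': "W * A' = A' * W"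
    and DU: "D * U = U * D + 1"
    and DX: "D * (A * U - U * A) = (A * U - U * A) * D + 1 + W * A"
    and DX': "D * (A' * U - U * A') = (A' * U - U * A') * D + 1 + W * A'"
    and AA': "A * A' = A' * A"
    and AX': "A * (A' * U - U * A') - (A' * U - U * A') * A = U"
begin

abbreviation X :: "nat \<Rightarrow> 'r" where "X k \<equiv> ad_pow U k A"
abbreviation X' :: "nat \<Rightarrow> 'r" where "X' k \<equiv> ad_pow U k A'"

lemma L_zero: "L 0 = 0"
  using L_add[of 0 0] by simp

lemma L_minus: "L (- T) = - L T"
  using L_add[of T "- T"] L_zero by (simp add: eq_neg_iff_add_eq_0 add.commute)

lemma L_diff: "L (S - T) = L S - L T"
  using L_add[of S "- T"] L_minus by simp

lemma L_sum: "L (\<Sum>i\<in>I. f i) = (\<Sum>i\<in>I. L (f i))"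
  by (induction I rule: infinite_finite_induct) (simp_all add: L_zero L_add)

lemma L_of_nat: "L (of_nat n * T) = of_nat n * L T"
  by (induction n) (simp_all add: L_zero L_add algebra_simps)

text \<open>The Jacobi identity for commuting A and A'. It makes the relations of the locale
  symmetric under the exchange of A and A'.\<close>

lemma A'X: "A' * (A * U - U * A) - (A * U - U * A) * A' = U"
proof -
  have "A' * (A * U - U * A) - (A * U - U * A) * A' =
        A * (A' * U - U * A') - (A' * U - U * A') * A + (A' * A - A * A') * U + U * (A * A' - A' * A)"
    by (simp add: algebra_simps)
  then show ?thesis using AX' AA' by simp
qed

text \<open>W represents the scalar w inside the ring, which need not be an algebra over the field.
  It has to travel to the right end, where \<open>L_W\<close> turns it into w.\<close>

lemma W_X: "W * X k = X k * W"
proof (induction k)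
  case (Suc k)
  then have "W * (X k * U) = X k * U * W" "W * (U * X k) = U * X k * W"
    by (metis WU mult.assoc)+
  then show ?case by (simp add: algebra_simps)
qed (simp add: WA)

text \<open>D U - U D = 1 is central, so bracketing with D commutes with bracketing with U, and
  \<open>DX\<close> carries over to all iterated commutators. The constant 1 in \<open>DX\<close>
  commutes with U and therefore contributes for k = 0 only.\<close>

lemma D_X: "D * X (Suc k) = X (Suc k) * D + W * X k + (if k = 0 then 1 else 0)"
proof (induction k)
  case 0
  then show ?case using DX by (simp add: algebra_simps)
next
  case (Suc k)
  let ?e = "(if k = 0 then 1 else 0) :: 'r"
  have "D * X (Suc (Suc k)) = (D * X (Suc k)) * U - (D * U) * X (Suc k)"
    by (simp add: algebra_simps)
  also have "\<dots> = (X (Suc k) * D + W * X k + ?e) * U - (U * D + 1) * X (Suc k)"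
    by (simp only: Suc.IH DU)
  also have "\<dots> = X (Suc k) * (D * U) + W * X k * U + ?e * U - U * (D * X (Suc k)) - X (Suc k)"
    by (simp add: algebra_simps)
  also have "\<dots> = X (Suc k) * (U * D + 1) + W * X k * U + ?e * U
      - U * (X (Suc k) * D + W * X k + ?e) - X (Suc k)"
    by (simp only: Suc.IH DU)
  also have "\<dots> = X (Suc (Suc k)) * D + W * X (Suc k) + (W * U - U * W) * X k"
    by (simp add: algebra_simps)
  finally show ?case using WU by simp
qed

section \<open>Absorption of the letters U by the letters D\<close>

lemma D_power_U: "D ^ n * U = U * D ^ n + of_nat n * D ^ (n - 1)"
proof (induction n)
  case (Suc n)
  have "D ^ Suc n * U = D * (D ^ n * U)" by (simp add: mult.assoc)
  also have "\<dots> = D * U * D ^ n + D * (of_nat n * D ^ (n - 1))"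
    by (simp add: Suc.IH algebra_simps)
  also have "D * (of_nat n * D ^ (n - 1)) = of_nat n * (D * D ^ (n - 1))"
    by (metis mult.assoc mult_of_nat_commute)
  also have "\<dots> = of_nat n * D ^ n"
    by (cases n) simp_all
  also have "D * U * D ^ n + of_nat n * D ^ n = U * D ^ Suc n + of_nat (Suc n) * D ^ n"
    by (simp add: DU algebra_simps)
  finally show ?case by simp
qed simp

lemma L_D_power_U: "L (D ^ Suc n * (U * T)) = of_nat (Suc n) * L (D ^ n * T)"
proof -
  have "D ^ Suc n * (U * T) = U * (D ^ Suc n * T) + of_nat (Suc n) * (D ^ n * T)"
    using D_power_U[of "Suc n"] by (metis diff_Suc_1 distrib_right mult.assoc)
  then show ?thesis by (simp only: L_add L_U L_of_nat) simp
qed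

text \<open>\<open>L\<close> vanishes on everything that begins with U, so each U must be absorbed
  by one of the letters D; the number of choices gives the quotient of factorials.\<close>

lemma L_D_power_U_power:
  "fact n * L (D ^ (n + m) * (U ^ m * T)) = fact (n + m) * L (D ^ n * T)"
proof (induction m)
  case (Suc m)
  have "L (D ^ (n + Suc m) * (U ^ Suc m * T)) = of_nat (Suc (n + m)) * L (D ^ (n + m) * (U ^ m * T))"
    using L_D_power_U[of "n + m" "U ^ m * T"] by (simp add: mult.assoc)
  then have "fact n * L (D ^ (n + Suc m) * (U ^ Suc m * T)) =
      of_nat (Suc (n + m)) * (fact n * L (D ^ (n + m) * (U ^ m * T)))"
    by simp
  then show ?case unfolding Suc.IH by simp
qed simp

text \<open>Moving T past U^n puts U^(n-k) directly behind D^n. These n - k letters are absorbed,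
  and k letters D remain in front of the k-fold commutator.\<close>

lemma L_sandwich:
  "L (D ^ n * T * U ^ n) =
     (\<Sum>k\<le>n. of_nat (n choose k) * (fact n / fact k) * L (D ^ k * ad_pow U k T))"
proof -
  have "D ^ n * T * U ^ n = (\<Sum>k\<le>n. D ^ n * (of_nat (n choose k) * (U ^ (n - k) * ad_pow U k T)))"
    unfolding mult.assoc[of _ T] mult_power_ad[of T] sum_distrib_left ..
  also have "\<dots> = (\<Sum>k\<le>n. of_nat (n choose k) * (D ^ n * (U ^ (n - k) * ad_pow U k T)))"
    by (intro sum.cong refl) (metis mult.assoc mult_of_nat_commute)
  finally have "L (D ^ n * T * U ^ n) =
      (\<Sum>k\<le>n. of_nat (n choose k) * L (D ^ n * (U ^ (n - k) * ad_pow U k T)))"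
    by (simp only: L_sum L_of_nat)
  also have "\<dots> = (\<Sum>k\<le>n. of_nat (n choose k) * (fact n / fact k) * L (D ^ k * ad_pow U k T))"
  proof (intro sum.cong refl)
    fix k assume "k \<in> {..n}"
    then have "fact k * L (D ^ n * (U ^ (n - k) * ad_pow U k T)) = fact n * L (D ^ k * ad_pow U k T)"
      using L_D_power_U_power[of k "n - k" "ad_pow U k T"] by simp
    then have "L (D ^ n * (U ^ (n - k) * ad_pow U k T)) = fact n / fact k * L (D ^ k * ad_pow U k T)"
      by (simp add: field_simps)
    then show "of_nat (n choose k) * L (D ^ n * (U ^ (n - k) * ad_pow U k T)) =
        of_nat (n choose k) * (fact n / fact k) * L (D ^ k * ad_pow U k T)"
      by simp
  qed
  finally show ?thesis .
qed

text \<open>One D is pushed to the right. Where it reaches the end the term vanishes; otherwise it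
  lowers k and leaves W, that is, a factor w. The constant in \<open>DX\<close> supplies the initial
  value at k = 1.\<close>

lemma L_X: "L (D ^ k * X k) = (if k = 0 then 0 else w ^ (k - 1))"
proof (induction k)
  case 0
  show ?case using L_A[of 1] by simp
next
  case (Suc k)
  have "D ^ Suc k * X (Suc k) = D ^ k * (D * X (Suc k))"
    by (simp only: power_Suc2 mult.assoc)
  also have "\<dots> = D ^ k * X (Suc k) * D + D ^ k * X k * W + (if k = 0 then D ^ k else 0)"
    unfolding D_X W_X by (simp add: algebra_simps)
  finally have "L (D ^ Suc k * X (Suc k)) = w * L (D ^ k * X k) + (if k = 0 then 1 else 0)"
    by (cases "k = 0") (simp_all add: L_add L_D L_W L_one L_zero del: power_Suc)
  then show ?case using Suc.IH by (cases k) simp_all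
qed

section \<open>Expectations of products of two iterated commutators\<close>

definition sigma :: "nat \<Rightarrow> nat \<Rightarrow> 'a" where "sigma i j = L (D ^ (i + j) * (X i * X' j))"
definition sigma' :: "nat \<Rightarrow> nat \<Rightarrow> 'a" where "sigma' j i = L (D ^ (i + j) * (X' j * X i))"

text \<open>Exchanging A and A' yields another instance of the locale, so that every fact about
  \<open>sigma\<close> has a counterpart for the opposite order \<open>sigma'\<close>.\<close>

lemma flip: "vacuum_algebra D U A' A W L w"
  by unfold_locales
     (use L_add L_one L_W L_U L_D L_A L_A' WU WD WA WA' DU DX DX' AA' A'X in auto)

lemma L_X': "L (D ^ k * X' k) = (if k = 0 then 0 else w ^ (k - 1))"
  by (rule vacuum_algebra.L_X[OF flip])

lemma sigma_0_right: "sigma i 0 = 0"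
  unfolding sigma_def using L_A'[of "D ^ i * X i"] by (simp add: mult.assoc)

text \<open>One D is pushed through both factors: it lowers i, lowers j, or reaches the right end
  and vanishes. The additional terms stem from the constants in \<open>DX\<close> and
  \<open>DX'\<close>, which remove one factor altogether and leave an instance of
  \<open>L_X'\<close> or \<open>L_X\<close>.\<close>

lemma sigma_Suc_Suc:
  "sigma (Suc i) (Suc j) = w * (sigma i (Suc j) + sigma (Suc i) j)
     + (if i = 0 then w ^ j else 0) + (if j = 0 then w ^ i else 0)"
proof -
  let ?P = "D ^ (i + Suc j)"
  let ?ei = "(if i = 0 then 1 else 0) :: 'r" and ?ej = "(if j = 0 then 1 else 0) :: 'r"
  have D_X': "D * X' (Suc j) = X' (Suc j) * D + W * X' j + ?ej"
    by (rule vacuum_algebra.D_X[OF flip])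
  have W_X': "W * X' j = X' j * W" for j
    by (rule vacuum_algebra.W_X[OF flip])
  have "D ^ (Suc i + Suc j) * (X (Suc i) * X' (Suc j)) = ?P * (D * X (Suc i) * X' (Suc j))"
    by (simp only: add_Suc power_Suc2 mult.assoc)
  also have "D * X (Suc i) * X' (Suc j) =
      X (Suc i) * (D * X' (Suc j)) + X i * (W * X' (Suc j)) + ?ei * X' (Suc j)"
    unfolding D_X W_X by (simp only: distrib_right mult.assoc)
  also have "\<dots> = X (Suc i) * X' (Suc j) * D + X (Suc i) * X' j * W + X (Suc i) * ?ej
      + X i * X' (Suc j) * W + ?ei * X' (Suc j)"
    unfolding D_X' W_X' by (simp only: distrib_left mult.assoc)
  finally have "D ^ (Suc i + Suc j) * (X (Suc i) * X' (Suc j)) =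
      ?P * (X (Suc i) * X' (Suc j)) * D + ?P * (X (Suc i) * X' j) * W
      + ?P * (X i * X' (Suc j)) * W + ?P * (X (Suc i) * ?ej) + ?P * (?ei * X' (Suc j))"
    by (simp only: distrib_left mult.assoc add_ac)
  then have "sigma (Suc i) (Suc j) = w * sigma (Suc i) j + w * sigma i (Suc j)
      + L (?P * (X (Suc i) * ?ej)) + L (?P * (?ei * X' (Suc j)))"
    unfolding sigma_def by (simp only: L_add L_D L_W add_Suc add_Suc_right) simp
  moreover have "L (?P * (X (Suc i) * ?ej)) = (if j = 0 then w ^ i else 0)"
    using L_X[of "Suc i"] by (cases "j = 0") (simp_all add: L_zero)
  moreover have "L (?P * (?ei * X' (Suc j))) = (if i = 0 then w ^ j else 0)"
    using L_X'[of "Suc j"] by (cases "i = 0") (simp_all add: L_zero)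
  ultimately show ?thesis by (simp add: algebra_simps)
qed

text \<open>The commutator expectations \<open>\<tau> i j = sigma i j - sigma' j i\<close> satisfy the homogeneous
  recursion in the interior; the two missing boundary values come from
  applying \<open>ad U\<close> to \<open>[A, [A', U]] = U\<close> repeatedly.\<close>

lemma sum_commutator:
  assumes "n > 0"
  shows "(\<Sum>i\<le>n. of_nat (n choose i) * (sigma i (Suc n - i) - sigma' (Suc n - i) i)) = 0"
proof -
  have shift: "ad_pow U m (X' 1) = X' (Suc m)" for m
    by (simp add: ad_pow_Suc2 del: ad_pow.simps(2))
  have "0 = ad_pow U n (A * X' 1 - X' 1 * A)"
  proof -
    have "A * X' 1 - X' 1 * A = U" using AX' by simp
    moreover obtain m where "n = Suc m" using assms by (cases n) auto
    ultimately show ?thesis by (simp only: ad_pow_self)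
  qed
  also have "\<dots> = (\<Sum>i\<le>n. of_nat (n choose i) * (X i * ad_pow U (n - i) (X' 1)))
      - (\<Sum>i\<le>n. of_nat (n choose i) * (ad_pow U i (X' 1) * X (n - i)))"
    unfolding ad_pow_diff ad_pow_mult ..
  also have "(\<Sum>i\<le>n. of_nat (n choose i) * (ad_pow U i (X' 1) * X (n - i))) =
      (\<Sum>i\<le>n. of_nat (n choose (n - i)) * (ad_pow U (n - i) (X' 1) * X (n - (n - i))))"
    by (rule sum.reindex_bij_witness[of _ "\<lambda>i. n - i" "\<lambda>i. n - i"]) auto
  also have "\<dots> = (\<Sum>i\<le>n. of_nat (n choose i) * (ad_pow U (n - i) (X' 1) * X i))"
    by (intro sum.cong refl) (simp add: binomial_symmetric[symmetric])
  also have "(\<Sum>i\<le>n. of_nat (n choose i) * (X i * ad_pow U (n - i) (X' 1))) - \<dots> =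
      (\<Sum>i\<le>n. of_nat (n choose i) * (X i * X' (Suc n - i) - X' (Suc n - i) * X i))"
    unfolding sum_subtractf[symmetric]
    by (intro sum.cong refl) (auto simp: shift[unfolded One_nat_def] Suc_diff_le right_diff_distrib simp del: ad_pow.simps(2))
  finally have "0 = L (D ^ Suc n * \<dots>)" by (simp add: L_zero)
  also have "\<dots> = (\<Sum>i\<le>n. of_nat (n choose i) *
      L (D ^ Suc n * (X i * X' (Suc n - i) - X' (Suc n - i) * X i)))"
    unfolding sum_distrib_left L_sum
    by (intro sum.cong refl) (metis L_of_nat mult.assoc mult_of_nat_commute)
  also have "\<dots> = (\<Sum>i\<le>n. of_nat (n choose i) * (sigma i (Suc n - i) - sigma' (Suc n - i) i))"
    by (intro sum.cong refl) (simp add: sigma_def sigma'_def right_diff_distrib L_diff del: power_Suc)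
  finally show ?thesis by simp
qed

lemma sigma'_eq: "sigma' j i = vacuum_algebra.sigma D U A' A L j i"
  unfolding sigma'_def vacuum_algebra.sigma_def[OF flip] by (simp add: add.commute)

lemma sigma_eq: "sigma i j = vacuum_algebra.sigma' D U A' A L i j"
  unfolding sigma_def vacuum_algebra.sigma'_def[OF flip] by (simp add: add.commute)

text \<open>In \<open>sigma 0 j\<close> the operator A stands away from the vacuum and does not
  annihilate it, whereas in \<open>sigma' j 0\<close> it stands at the right end and gives 0. The
  difference of the two orders is therefore the missing boundary value.\<close>

lemma commutator_expectation:
  "sigma i j - sigma' j i = (if i = 0 \<and> j = 1 then 1 else if i = 1 \<and> j = 0 then - 1 else 0)"
proof (induction "i + j" arbitrary: i j rule: less_induct)
  case less
  define \<tau> where "\<tau> i j = sigma i j - sigma' j i" for i j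
  have IH: "\<tau> k l = (if k = 0 \<and> l = 1 then 1 else if k = 1 \<and> l = 0 then - 1 else 0)"
    if "k + l < i + j" for k l
    using less[OF that] unfolding \<tau>_def .
  have step: "\<tau> (Suc k) (Suc l) = w * (\<tau> k (Suc l) + \<tau> (Suc k) l)" for k l
    using sigma_Suc_Suc[of k l] vacuum_algebra.sigma_Suc_Suc[OF flip, of l k]
    unfolding \<tau>_def sigma'_eq by (simp add: algebra_simps)
  have inner: "\<tau> k l = 0" if "k + l = i + j" "k > 0" "l > 0" for k l
  proof -
    from that obtain k' l' where kl: "k = Suc k'" "l = Suc l'" by (metis Suc_pred')
    \<comment> \<open>For k' = l' = 0 the two values are 1 and - 1 and cancel; otherwise both are 0
      by induction.\<close>
    have "\<tau> k' (Suc l') + \<tau> (Suc k') l' = 0"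
      using IH[of k' "Suc l'"] IH[of "Suc k'" l'] that kl by auto
    then show ?thesis by (simp add: kl step)
  qed
  consider "i + j = 0" | "i + j = 1" | n where "i + j = Suc n" "n > 0"
    by (metis One_nat_def gr0_conv_Suc neq0_conv)
  then show ?case
  proof cases
    case 1
    then show ?thesis using sigma_0_right vacuum_algebra.sigma_0_right[OF flip]
      by (simp add: sigma'_eq)
  next
    case 2
    have "sigma 0 1 - sigma' 1 0 = L (D * (A * X' 1 - X' 1 * A))"
      by (simp add: sigma_def sigma'_def right_diff_distrib L_diff)
    also have "A * X' 1 - X' 1 * A = U" using AX' by simp
    also have "L (D * U) = 1" by (simp add: DU L_add L_U L_one)
    finally have 01: "sigma 0 1 - sigma' 1 0 = 1" .
    have "sigma 1 0 - sigma' 0 1 = - L (D * (A' * X 1 - X 1 * A'))"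
      by (simp add: sigma_def sigma'_def right_diff_distrib L_diff)
    also have "A' * X 1 - X 1 * A' = U" using A'X by simp
    also have "L (D * U) = 1" by (simp add: DU L_add L_U L_one)
    finally have "sigma 1 0 - sigma' 0 1 = - 1" .
    with 01 2 show ?thesis by (cases i) auto
  next
    case 3
    \<comment> \<open>As all interior values vanish, this relation reduces to its term i = 0, the
      boundary value; the exchanged instance settles the other end.\<close>
    have "0 = (\<Sum>i\<le>n. of_nat (n choose i) * \<tau> i (Suc n - i))"
      using sum_commutator[OF 3(2)] unfolding \<tau>_def by simp
    also have "\<dots> = (\<Sum>i\<in>{0}. of_nat (n choose i) * \<tau> i (Suc n - i))"
      using inner 3 by (intro sum.mono_neutral_right) auto
    finally have left: "\<tau> 0 (Suc n) = 0" by simp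
    have "0 = - (\<Sum>i\<le>n. of_nat (n choose i) * \<tau> (Suc n - i) i)"
      using vacuum_algebra.sum_commutator[OF flip 3(2)]
      unfolding \<tau>_def sigma_eq sigma'_eq by (simp add: sum_negf[symmetric] right_diff_distrib)
    also have "\<dots> = - (\<Sum>i\<in>{0}. of_nat (n choose i) * \<tau> (Suc n - i) i)"
      using inner 3 by (intro arg_cong[of _ _ uminus] sum.mono_neutral_right) auto
    finally have right: "\<tau> (Suc n) 0 = 0" by simp
    have "\<tau> i j = 0"
      using inner[of i j] left right 3 by (cases i; cases j) auto
    then show ?thesis using 3 unfolding \<tau>_def by auto
  qed
qed

lemma sigma_0_left: "sigma 0 j = (if j = 1 then 1 else 0)"
  using commutator_expectation[of 0 j] vacuum_algebra.sigma_0_right[OF flip, of j]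
  by (simp add: sigma'_eq)

text \<open>Both binomial coefficients obey Pascal's rule, which is what
  \<open>sigma_Suc_Suc\<close> amounts to; the two powers of w keep the families apart.\<close>

lemma sigma_closed:
  "sigma (Suc i) (Suc j) =
     w ^ (i + j + 1) * of_nat ((i + j) choose i) + w ^ (i + j) * of_nat ((i + j + 2) choose (i + 1))"
proof (induction "i + j" arbitrary: i j rule: less_induct)
  case less
  show ?case
  proof (cases i; cases j)
    assume ij: "i = 0" "j = 0"
    then show ?thesis by (simp add: sigma_Suc_Suc sigma_0_left sigma_0_right numeral_2_eq_2)
  next
    fix l assume ij: "i = 0" "j = Suc l"
    then show ?thesis using less[of 0 l]
      by (subst sigma_Suc_Suc) (simp add: sigma_0_left algebra_simps)
  next
    fix k assume ij: "i = Suc k" "j = 0"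
    then show ?thesis using less[of k 0]
      by (subst sigma_Suc_Suc) (simp add: sigma_0_right algebra_simps)
  next
    fix k l assume ij: "i = Suc k" "j = Suc l"
    then show ?thesis using less[of k "Suc l"] less[of "Suc k" l]
      by (subst sigma_Suc_Suc) (simp add: algebra_simps)
  qed
qed

text \<open>After Leibniz's rule the first family of binomials is summed by Vandermonde's
  convolution and the second as a sum of squares. The two end terms absent from that sum of squares
  are the - 2.\<close>

lemma L_AA':
  assumes "k > 0"
  shows "w * L (D ^ k * ad_pow U k (A * A')) =
    w ^ k * of_nat ((2 * k - 2) choose (k - 1)) + w ^ (k - 1) * (of_nat ((2 * k) choose k) - 2)"
proof -
  have expand: "L (D ^ k * ad_pow U k (A * A')) = (\<Sum>i\<le>k. of_nat (k choose i) * sigma i (k - i))"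
    unfolding ad_pow_mult sum_distrib_left L_sum
    by (intro sum.cong refl) (simp add: sigma_def, metis L_of_nat mult.assoc mult_of_nat_commute)
  consider "k = 1" | p where "k = Suc (Suc p)"
    using assms by (metis One_nat_def not0_implies_Suc not_gr_zero)
  then show ?thesis
  proof cases
    case 1
    then show ?thesis unfolding expand by (simp add: sigma_0_left sigma_0_right)
  next
    case (2 p)
    have "(\<Sum>i\<le>k. of_nat (k choose i) * sigma i (k - i)) =
        (\<Sum>i\<le>p. of_nat ((p + 2) choose Suc i) * sigma (Suc i) (Suc (p - i)))"
      unfolding 2 sum.atMost_Suc_shift[of _ "Suc p"]
      by (simp add: sigma_0_left sigma_0_right Suc_diff_le)
    also have "\<dots> = (\<Sum>i\<le>p. w ^ (p + 1) * of_nat ((p choose i) * ((p + 2) choose (p + 1 - i)))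
        + w ^ p * of_nat (((p + 2) choose Suc i)\<^sup>2))"
    proof (intro sum.cong refl)
      fix i assume "i \<in> {..p}"
      moreover have "(p + 2) choose Suc i = (p + 2) choose (p + 1 - i)"
        using binomial_symmetric[of "Suc i" "p + 2"] \<open>i \<in> {..p}\<close> by simp
      ultimately show "of_nat ((p + 2) choose Suc i) * sigma (Suc i) (Suc (p - i)) =
          w ^ (p + 1) * of_nat ((p choose i) * ((p + 2) choose (p + 1 - i)))
          + w ^ p * of_nat (((p + 2) choose Suc i)\<^sup>2)"
        unfolding sigma_closed by (simp add: algebra_simps power2_eq_square)
    qed
    also have "\<dots> = w ^ (p + 1) * of_nat (\<Sum>i\<le>p. (p choose i) * ((p + 2) choose (p + 1 - i)))
        + w ^ p * of_nat (\<Sum>i\<le>p. ((p + 2) choose Suc i)\<^sup>2)"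
      by (simp only: sum.distrib sum_distrib_left of_nat_sum)
    also have "(\<Sum>i\<le>p. (p choose i) * ((p + 2) choose (p + 1 - i))) = (2 * p + 2) choose (p + 1)"
      using vandermonde[of p "p + 2" "p + 1"] by (simp add: mult_2 binomial_eq_0)
    also have "of_nat (\<Sum>i\<le>p. ((p + 2) choose Suc i)\<^sup>2) =
        (of_nat ((2 * p + 4) choose (p + 2)) - 2 :: 'a)"
    proof -
      have "(\<Sum>i\<le>p + 2. ((p + 2) choose i)\<^sup>2) = 2 + (\<Sum>i\<le>p. ((p + 2) choose Suc i)\<^sup>2)"
        unfolding add_2_eq_Suc' sum.atMost_Suc_shift[of _ "Suc p"] by simp
      moreover have "(2 * p + 4) choose (p + 2) = (\<Sum>i\<le>p + 2. ((p + 2) choose i)\<^sup>2)"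
      proof -
        have "2 * (p + 2) = 2 * p + 4" by simp
        then show ?thesis using choose_square_sum[of "p + 2"] by (simp only:)
      qed
      ultimately show ?thesis by simp
    qed
    finally have rho: "L (D ^ k * ad_pow U k (A * A')) = w ^ (p + 1) * of_nat ((2 * p + 2) choose (p + 1))
        + w ^ p * (of_nat ((2 * p + 4) choose (p + 2)) - 2)"
      unfolding expand .
    have idx: "2 * k - 2 = 2 * p + 2" "k - 1 = p + 1" "2 * k = 2 * p + 4" "k = p + 2"
      "2 * p + 4 - 2 = 2 * p + 2"
      using 2 by simp_all
    have "w ^ k = w * w ^ (p + 1)" "w ^ (k - 1) = w * w ^ p" using 2 by simp_all
    then show ?thesis
      by (simp only: rho idx(1-3,5) distrib_left mult.assoc) (simp only: idx(4))
  qed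
qed

text \<open>The terms w^(k-1) contributed by A alone and by A' alone cancel the - 2 of
  \<open>L_AA'\<close>.\<close>

lemma L_hook_sum:
  "w * L (D ^ n * (A * A') * U ^ n) + L (D ^ n * A * U ^ n) + L (D ^ n * A' * U ^ n) =
    (\<Sum>k=1..n. of_nat (n choose k) * (fact n / fact k) *
      (w ^ k * of_nat ((2 * k - 2) choose (k - 1)) + w ^ (k - 1) * of_nat ((2 * k) choose k)))"
proof -
  let ?c = "\<lambda>k. of_nat (n choose k) * (fact n / fact k) :: 'a"
  have "w * L (D ^ n * (A * A') * U ^ n) + L (D ^ n * A * U ^ n) + L (D ^ n * A' * U ^ n) =
    (\<Sum>k\<le>n. ?c k * (w * L (D ^ k * ad_pow U k (A * A')) + L (D ^ k * X k) + L (D ^ k * X' k)))"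
    unfolding L_sandwich sum_distrib_left sum.distrib[symmetric]
    by (intro sum.cong refl) (simp add: algebra_simps)
  also have "\<dots> = (\<Sum>k=1..n. ?c k * (w * L (D ^ k * ad_pow U k (A * A')) + L (D ^ k * X k) + L (D ^ k * X' k)))"
  proof (rule sum.mono_neutral_right)
    show "\<forall>k\<in>{..n} - {1..n}. ?c k *
      (w * L (D ^ k * ad_pow U k (A * A')) + L (D ^ k * X k) + L (D ^ k * X' k)) = 0"
      using L_A[of 1] L_A'[of 1] L_A'[of A] by (auto simp: not_less_eq_eq)
  qed auto
  also have "\<dots> = (\<Sum>k=1..n. ?c k *
      (w ^ k * of_nat ((2 * k - 2) choose (k - 1)) + w ^ (k - 1) * of_nat ((2 * k) choose k)))"
    by (intro sum.cong refl) (simp add: L_AA' L_X L_X' algebra_simps)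
  finally show ?thesis .
qed

end

section \<open>Maya diagrams and box operators\<close>

typedef (overloaded) ('s, 'a) linop =
  "{f :: ('s \<Rightarrow> 'a::comm_ring_1) \<Rightarrow> 's \<Rightarrow> 'a.
      (\<forall>x y. f (x + y) = f x + f y) \<and> (\<forall>c x. f (\<lambda>s. c * x s) = (\<lambda>s. c * f x s))}"
  morphisms app Linop
  by (rule exI[of _ id]) simp

setup_lifting type_definition_linop

lemma app_add: "app T (x + y) = app T x + app T y"
  using app[of T] by simp

lemma app_scale: "app T (\<lambda>s. c * x s) = (\<lambda>s. c * app T x s)"
  using app[of T] by simp

instantiation linop :: (type, comm_ring_1) ring_1
begin

lift_definition zero_linop :: "('a, 'b) linop" is "\<lambda>_ _. 0"
  by (simp add: fun_eq_iff)
lift_definition one_linop :: "('a, 'b) linop" is "\<lambda>x. x"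
  by simp
lift_definition plus_linop :: "('a, 'b) linop \<Rightarrow> ('a, 'b) linop \<Rightarrow> ('a, 'b) linop" is "\<lambda>S T x. S x + T x"
  by (simp add: fun_eq_iff algebra_simps)
lift_definition minus_linop :: "('a, 'b) linop \<Rightarrow> ('a, 'b) linop \<Rightarrow> ('a, 'b) linop" is "\<lambda>S T x. S x - T x"
  by (simp add: fun_eq_iff algebra_simps)
lift_definition uminus_linop :: "('a, 'b) linop \<Rightarrow> ('a, 'b) linop" is "\<lambda>S x. - S x"
  by (simp add: fun_eq_iff algebra_simps)
lift_definition times_linop :: "('a, 'b) linop \<Rightarrow> ('a, 'b) linop \<Rightarrow> ('a, 'b) linop" is "\<lambda>S T x. S (T x)"
  by simp

instance
proof
  show "(0 :: ('a, 'b) linop) \<noteq> 1"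
  proof
    assume "(0 :: ('a, 'b) linop) = 1"
    then have "app (0 :: ('a, 'b) linop) (\<lambda>_. 1) = app 1 (\<lambda>_. 1)" by simp
    then have "(\<lambda>_. 0) = (\<lambda>_ :: 'a. 1 :: 'b)" unfolding zero_linop.rep_eq one_linop.rep_eq .
    then show False by (simp add: fun_eq_iff)
  qed
qed (simp_all add: app_inject[symmetric] zero_linop.rep_eq one_linop.rep_eq plus_linop.rep_eq
    minus_linop.rep_eq uminus_linop.rep_eq times_linop.rep_eq app_add fun_eq_iff add_ac)

end

lemma app_simps [simp]:
  "app 0 x s = 0" "app 1 x s = x s" "app (S + T) x s = app S x s + app T x s"
  "app (S - T) x s = app S x s - app T x s" "app (- T) x s = - app T x s"
  "app (S * T) x s = app S (app T x) s"
  by (simp_all add: zero_linop.rep_eq one_linop.rep_eq plus_linop.rep_eq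
    minus_linop.rep_eq uminus_linop.rep_eq times_linop.rep_eq)

lemma linop_eqI: "(\<And>x s. app S x s = app T x s) \<Longrightarrow> S = T"
  by (metis app_inject ext)

lift_definition diag :: "('s \<Rightarrow> 'a::comm_ring_1) \<Rightarrow> ('s, 'a) linop" is "\<lambda>p x s. p s * x s"
  by (simp add: fun_eq_iff algebra_simps)

declare diag.rep_eq [simp]

section \<open>Maya diagrams and regularised sums\<close>

typedef maya = "{S :: int set. finite (S \<inter> {0..}) \<and> finite ({..<0} - S)}"
  morphisms ptcls Maya
proof (rule exI[of _ "{..<0}"])
  have "{..<0} \<inter> {0..} = ({} :: int set)" by auto
  then show "{..<0} \<in> {S :: int set. finite (S \<inter> {0..}) \<and> finite ({..<0} - S)}" by simp
qed

lemma maya_eqI: "ptcls S = ptcls T \<Longrightarrow> S = T"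
  by (simp add: ptcls_inject)

lemma finite_ptcls: "finite (ptcls S \<inter> {0..})" and finite_holes: "finite ({..<0} - ptcls S)"
  using ptcls[of S] by auto

text \<open>The formal sum of g over S minus the formal sum over the vacuum \<open>{..<0}\<close>,
  after cancelling common terms. Charge, energy, contents and BG-rank are all obtained in this
  way.\<close>

definition reg_sum :: "(int \<Rightarrow> 'a::ab_group_add) \<Rightarrow> maya \<Rightarrow> 'a" where
  "reg_sum g S = sum g (ptcls S \<inter> {0..}) - sum g ({..<0} - ptcls S)"

lemma window_exists:
  obtains N :: nat where "{..<- int N} \<subseteq> ptcls S" "ptcls S \<subseteq> {..<int N}"
proof -
  let ?F = "(ptcls S \<inter> {0..}) \<union> ({..<0} - ptcls S)"
  have fin: "finite ?F" using finite_ptcls finite_holes by simp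
  define N where "N = Suc (nat (Max (insert 0 (abs ` ?F))))"
  have bound: "\<bar>x\<bar> < int N" if "x \<in> ?F" for x
  proof -
    have "\<bar>x\<bar> \<le> Max (insert 0 (abs ` ?F))" using that fin by (intro Max_ge) auto
    then show ?thesis unfolding N_def by linarith
  qed
  have "{..<- int N} \<subseteq> ptcls S"
  proof
    fix x assume x: "x \<in> {..<- int N}"
    show "x \<in> ptcls S"
    proof (rule ccontr)
      assume "x \<notin> ptcls S"
      with x have "x \<in> ?F" by auto
      with bound x show False by fastforce
    qed
  qed
  moreover have "ptcls S \<subseteq> {..<int N}"
  proof
    fix x assume "x \<in> ptcls S"
    then show "x \<in> {..<int N}" using bound[of x] by (cases "x \<ge> 0") auto
  qed
  ultimately show ?thesis using that by blast
qed

lemma finite_window: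
  fixes N :: nat
  shows "finite (ptcls S \<inter> {- int N..})"
proof -
  have "ptcls S \<inter> {- int N..} \<subseteq> (ptcls S \<inter> {0..}) \<union> {- int N..<0}" by auto
  then show ?thesis using finite_ptcls by (meson finite_UnI finite_atLeastLessThan_int finite_subset)
qed

text \<open>Below - N the diagram and the vacuum coincide, so both formal sums may be cut off
  there.\<close>

lemma reg_sum_window:
  fixes N :: nat
  assumes "{..<- int N} \<subseteq> ptcls S"
  shows "reg_sum g S = sum g (ptcls S \<inter> {- int N..}) - sum g {- int N..<0}"
proof -
  have split: "ptcls S \<inter> {- int N..} = (ptcls S \<inter> {0..}) \<union> (ptcls S \<inter> {- int N..<0})" by auto
  have 1: "sum g (ptcls S \<inter> {- int N..}) = sum g (ptcls S \<inter> {0..}) + sum g (ptcls S \<inter> {- int N..<0})"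
    unfolding split by (rule sum.union_disjoint) (auto simp: finite_ptcls)
  have disj: "({..<0} - ptcls S) \<inter> (ptcls S \<inter> {- int N..<0}) = {}" by auto
  have "{- int N..<0} = ({..<0} - ptcls S) \<union> (ptcls S \<inter> {- int N..<0})"
    using assms by (auto simp: not_le)
  then have "sum g {- int N..<0} = sum g ({..<0} - ptcls S) + sum g (ptcls S \<inter> {- int N..<0})"
    by (metis (no_types) finite_holes sum.union_disjoint disj finite_Int finite_atLeastLessThan_int)
  with 1 show ?thesis by (simp add: reg_sum_def)
qed


section \<open>Addition and removal of a box\<close>

definition addable :: "maya \<Rightarrow> int set" where
  "addable S = {s. s \<in> ptcls S \<and> s + 1 \<notin> ptcls S}"

definition removable :: "maya \<Rightarrow> int set" where
  "removable S = {s. s \<notin> ptcls S \<and> s + 1 \<in> ptcls S}"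

text \<open>A box added to row i raises its beta number from s to s + 1, and the content of the new
  box is s + 1. Removal is indexed by the lower position as well, so that both moves at s are
  inverse to each other.\<close>

definition add_box :: "int \<Rightarrow> maya \<Rightarrow> maya" where
  "add_box s S = Maya (insert (s + 1) (ptcls S - {s}))"

definition remove_box :: "int \<Rightarrow> maya \<Rightarrow> maya" where
  "remove_box s S = Maya (insert s (ptcls S - {s + 1}))"

lemma maya_update: "insert a (ptcls S - {b}) \<in> {S :: int set. finite (S \<inter> {0..}) \<and> finite ({..<0} - S)}"
proof -
  have "finite (insert a (ptcls S - {b}) \<inter> {0..})"
    by (rule finite_subset[of _ "insert a (ptcls S \<inter> {0..})"]) (auto simp: finite_ptcls)
  moreover have "finite ({..<0} - insert a (ptcls S - {b}))"
    by (rule finite_subset[of _ "insert b ({..<0} - ptcls S)"]) (auto simp: finite_holes)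
  ultimately show ?thesis by blast
qed

lemma ptcls_add_box [simp]: "ptcls (add_box s S) = insert (s + 1) (ptcls S - {s})"
  unfolding add_box_def by (rule Maya_inverse[OF maya_update])

lemma ptcls_remove_box [simp]: "ptcls (remove_box s S) = insert s (ptcls S - {s + 1})"
  unfolding remove_box_def by (rule Maya_inverse[OF maya_update])

lemma finite_addable: "finite (addable S)" and finite_removable: "finite (removable S)"
proof -
  obtain N where N: "{..<- int N} \<subseteq> ptcls S" "ptcls S \<subseteq> {..<int N}" by (rule window_exists)
  have low: "- int N \<le> s" if "s \<notin> ptcls S" for s using N(1) that by (force simp: not_less[symmetric])
  have high: "s < int N" if "s \<in> ptcls S" for s using N(2) that by blast
  have "addable S \<subseteq> {- int N - 1..int N}" "removable S \<subseteq> {- int N - 1..int N}"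
    using low high by (fastforce simp: addable_def removable_def)+
  then show "finite (addable S)" "finite (removable S)"
    using finite_atLeastAtMost_int finite_subset by blast+
qed

lemma add_remove [simp]: "s \<in> removable S \<Longrightarrow> add_box s (remove_box s S) = S"
  and remove_add [simp]: "s \<in> addable S \<Longrightarrow> remove_box s (add_box s S) = S"
  by (rule maya_eqI; auto simp: addable_def removable_def)+

lemma removable_add: "s \<in> addable S \<Longrightarrow> s \<in> removable (add_box s S)"
  and addable_remove: "s \<in> removable S \<Longrightarrow> s \<in> addable (remove_box s S)"
  by (auto simp: addable_def removable_def)

lemma reg_sum_add_box:
  assumes "s \<in> addable S"
  shows "reg_sum g (add_box s S) = reg_sum g S + g (s + 1) - g s"
proof -
  obtain N where N: "{..<- int N} \<subseteq> ptcls S" "ptcls S \<subseteq> {..<int N}" by (rule window_exists)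
  have s: "s \<in> ptcls S" "s + 1 \<notin> ptcls S"
    using assms by (auto simp: addable_def)
  then have "\<not> s + 1 < - int N" using N by blast
  then have s_ge: "- int (Suc N) \<le> s" by simp
  have 1: "{..<- int (Suc N)} \<subseteq> ptcls S" "{..<- int (Suc N)} \<subseteq> ptcls (add_box s S)"
    using N s s_ge by auto
  let ?W = "ptcls S \<inter> {- int (Suc N)..}"
  have fin: "finite ?W" by (rule finite_window)
  have "ptcls (add_box s S) \<inter> {- int (Suc N)..} = insert (s + 1) (?W - {s})"
    using s s_ge by auto
  then have "sum g (ptcls (add_box s S) \<inter> {- int (Suc N)..}) = g (s + 1) + sum g (?W - {s})"
    using s fin by (simp add: sum.insert_if)
  also have "sum g (?W - {s}) = sum g ?W - g s"
    using s s_ge fin by (simp add: sum_diff1)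
  finally show ?thesis
    unfolding reg_sum_window[OF 1(1)] reg_sum_window[OF 1(2)] by (simp add: algebra_simps)
qed

lemma reg_sum_remove_box:
  assumes "s \<in> removable S"
  shows "reg_sum g (remove_box s S) = reg_sum g S - g (s + 1) + g s"
  using reg_sum_add_box[OF addable_remove[OF assms], of g] assms by (simp add: algebra_simps)

text \<open>With \<epsilon> the indicator function of S, the indicators of addable and removable
  positions differ by \<epsilon> s - \<epsilon> (s + 1), so everything telescopes. The term g (- 1)
  is the contribution of the vacuum, whose only addable position is - 1.\<close>

lemma sum_addable_removable:
  "sum g (addable S) - sum g (removable S) = g (- 1) + reg_sum g S - reg_sum (\<lambda>s. g (s - 1)) S"
  for g :: "int \<Rightarrow> 'a::comm_ring_1"
proof -
  obtain N where N: "{..<- int N} \<subseteq> ptcls S" "ptcls S \<subseteq> {..<int N}" by (rule window_exists)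
  \<comment> \<open>One position more than the window, because one of the two sums gets shifted by
    one.\<close>
  let ?M = "Suc N"
  have N': "{..<- int ?M} \<subseteq> ptcls S"
    by (rule subset_trans[OF _ N(1)]) simp
  define I where "I = {- int ?M..int ?M}"
  define \<epsilon> where "\<epsilon> s = (of_bool (s \<in> ptcls S) :: 'a)" for s
  have low: "- int N \<le> s" if "s \<notin> ptcls S" for s using N(1) that by (force simp: not_less[symmetric])
  have high: "s < int N" if "s \<in> ptcls S" for s using N(2) that by blast
  have sub: "addable S \<subseteq> I" "removable S \<subseteq> I"
    using low high unfolding I_def by (fastforce simp: addable_def removable_def)+
  have W: "ptcls S \<inter> {- int ?M..} \<subseteq> I" "ptcls S \<inter> {- int N..} \<subseteq> {- int N..int ?M + 1}"
    using high unfolding I_def by fastforce+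
  have fin: "finite I" by (simp add: I_def)
  have "sum g (addable S) = (\<Sum>s\<in>I. g s * (\<epsilon> s * (1 - \<epsilon> (s + 1))))"
    by (rule sum.mono_neutral_cong_left[OF fin sub(1)]) (auto simp: addable_def \<epsilon>_def)
  moreover have "sum g (removable S) = (\<Sum>s\<in>I. g s * ((1 - \<epsilon> s) * \<epsilon> (s + 1)))"
    by (rule sum.mono_neutral_cong_left[OF fin sub(2)]) (auto simp: removable_def \<epsilon>_def)
  ultimately have "sum g (addable S) - sum g (removable S) = (\<Sum>s\<in>I. g s * \<epsilon> s) - (\<Sum>s\<in>I. g s * \<epsilon> (s + 1))"
    by (simp only: sum_subtractf[symmetric]) (simp add: algebra_simps)
  also have "(\<Sum>s\<in>I. g s * \<epsilon> (s + 1)) = (\<Sum>s\<in>{- int N..int ?M + 1}. g (s - 1) * \<epsilon> s)"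
    unfolding I_def by (rule sum.reindex_bij_witness[of _ "\<lambda>s. s - 1" "\<lambda>s. s + 1"]) auto
  also have "\<dots> = sum (\<lambda>s. g (s - 1)) (ptcls S \<inter> {- int N..})"
    by (rule sum.mono_neutral_cong_right[OF _ W(2)]) (auto simp: \<epsilon>_def)
  also have "\<dots> = reg_sum (\<lambda>s. g (s - 1)) S + sum (\<lambda>s. g (s - 1)) {- int N..<0}"
    using reg_sum_window[OF N(1), of "\<lambda>s. g (s - 1)"] by simp
  also have "sum (\<lambda>s. g (s - 1)) {- int N..<0} = sum g {- int ?M..<-1}"
    by (rule sum.reindex_bij_witness[of _ "\<lambda>s. s + 1" "\<lambda>s. s - 1"]) auto
  also have "(\<Sum>s\<in>I. g s * \<epsilon> s) = sum g (ptcls S \<inter> {- int ?M..})"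
    by (rule sum.mono_neutral_cong_right[OF fin W(1)]) (auto simp: \<epsilon>_def I_def)
  also have "\<dots> = reg_sum g S + sum g {- int ?M..<0}"
    using reg_sum_window[of ?M S g, OF N'] by (simp only: diff_add_cancel)
  also have "sum g {- int ?M..<0} = g (- 1) + sum g {- int ?M..<-1}"
  proof -
    have "{- int ?M..<0} = insert (- 1) {- int ?M..<-1}" by auto
    then show ?thesis by simp
  qed
  finally show ?thesis by simp
qed

section \<open>The box operators and their commutators\<close>

lift_definition up :: "(int \<Rightarrow> 'a) \<Rightarrow> (maya, 'a::comm_ring_1) linop" is
  "\<lambda>g f S. \<Sum>s\<in>removable S. g (s + 1) * f (remove_box s S)"
  by (auto simp: fun_eq_iff algebra_simps sum.distrib sum_distrib_left)

text \<open>Functions are read as formal linear combinations of diagrams. The coefficient at S is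
  collected from the diagrams that turn into S: from those with one box more here, and from those
  with one box less in \<open>up\<close>, where g weights the content of the added box.\<close>

lift_definition down :: "(maya, 'a::comm_ring_1) linop" is
  "\<lambda>f S. \<Sum>s\<in>addable S. f (add_box s S)"
  by (auto simp: fun_eq_iff algebra_simps sum.distrib sum_distrib_left)

declare up.rep_eq [simp] down.rep_eq [simp]

lemma diag_up_commutator:
  "diag (reg_sum h) * up g - up g * diag (reg_sum h) = up (\<lambda>s. (h s - h (s - 1)) * g s)"
  by (rule linop_eqI)
     (simp add: reg_sum_remove_box sum_distrib_left sum_subtractf[symmetric] algebra_simps)

lemma off_diagonal_commute:
  assumes "s \<noteq> t"
  shows "s \<in> addable S \<and> t \<in> removable (add_box s S) \<longleftrightarrow> t \<in> removable S \<and> s \<in> addable (remove_box t S)"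
    and "s \<in> addable S \<Longrightarrow> t \<in> removable (add_box s S) \<Longrightarrow>
      remove_box t (add_box s S) = add_box s (remove_box t S)"
proof -
  show "s \<in> addable S \<and> t \<in> removable (add_box s S) \<longleftrightarrow> t \<in> removable S \<and> s \<in> addable (remove_box t S)"
    using assms by (auto simp: addable_def removable_def)
  assume "s \<in> addable S" "t \<in> removable (add_box s S)"
  then show "remove_box t (add_box s S) = add_box s (remove_box t S)"
    using assms by (intro maya_eqI) (auto simp: addable_def removable_def)
qed

text \<open>For s \<noteq> t, adding at s and removing at t may be done in either order with the
  same result. Only the diagonal terms s = t differ: they return to S and are counted over addable
  or over removable positions, depending on the order.\<close>

lemma down_up_commutator:
  "down * up g = up g * down +
     diag (\<lambda>S. (\<Sum>s\<in>addable S. g (s + 1)) - (\<Sum>s\<in>removable S. g (s + 1)))"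
proof (rule linop_eqI)
  fix f :: "maya \<Rightarrow> 'a" and S
  define P where "P = (SIGMA s:addable S. removable (add_box s S))"
  define Q where "Q = (SIGMA t:removable S. addable (remove_box t S))"
  define F where "F = (\<lambda>(s, t). g (t + 1) * f (remove_box t (add_box s S)))"
  define G where "G = (\<lambda>(t, s). g (t + 1) * f (add_box s (remove_box t S)))"
  have fin: "finite P" "finite Q"
    unfolding P_def Q_def by (simp_all add: finite_addable finite_removable)
  have P0: "(\<lambda>s. (s, s)) ` addable S \<subseteq> P" and Q0: "(\<lambda>s. (s, s)) ` removable S \<subseteq> Q"
    using removable_add addable_remove by (auto simp: P_def Q_def)
  have "app (down * up g) f S = sum F P"
    unfolding P_def F_def
    by (simp add: sum.Sigma[symmetric] finite_addable finite_removable)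
  also have "\<dots> = sum F (P - (\<lambda>s. (s, s)) ` addable S) + sum F ((\<lambda>s. (s, s)) ` addable S)"
    by (rule sum.subset_diff[OF P0 fin(1)])
  also have "sum F ((\<lambda>s. (s, s)) ` addable S) = (\<Sum>s\<in>addable S. g (s + 1) * f S)"
    by (subst sum.reindex) (auto simp: inj_on_def F_def intro!: sum.cong)
  finally have 1: "app (down * up g) f S = sum F (P - (\<lambda>s. (s, s)) ` addable S) + (\<Sum>s\<in>addable S. g (s + 1)) * f S"
    by (simp only: sum_distrib_right)
  have "app (up g * down) f S = sum G Q"
    unfolding Q_def G_def
    by (simp add: sum.Sigma[symmetric] finite_addable finite_removable sum_distrib_left)
  also have "\<dots> = sum G (Q - (\<lambda>s. (s, s)) ` removable S) + sum G ((\<lambda>s. (s, s)) ` removable S)"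
    by (rule sum.subset_diff[OF Q0 fin(2)])
  also have "sum G ((\<lambda>s. (s, s)) ` removable S) = (\<Sum>s\<in>removable S. g (s + 1) * f S)"
    by (subst sum.reindex) (auto simp: inj_on_def G_def intro!: sum.cong)
  finally have 2: "app (up g * down) f S = sum G (Q - (\<lambda>s. (s, s)) ` removable S) + (\<Sum>s\<in>removable S. g (s + 1)) * f S"
    by (simp only: sum_distrib_right)
  have "sum F (P - (\<lambda>s. (s, s)) ` addable S) = sum G (Q - (\<lambda>s. (s, s)) ` removable S)"
  proof (rule sum.reindex_bij_witness[of _ prod.swap prod.swap])
    fix a assume a: "a \<in> P - (\<lambda>s. (s, s)) ` addable S"
    obtain s t where st: "a = (s, t)" by force
    with a have *: "s \<in> addable S" "t \<in> removable (add_box s S)" "s \<noteq> t" by (auto simp: P_def)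
    show "prod.swap a \<in> Q - (\<lambda>s. (s, s)) ` removable S"
      using off_diagonal_commute(1)[OF *(3)] * by (auto simp: Q_def st)
    show "G (prod.swap a) = F a"
      using off_diagonal_commute(2)[OF *(3,1,2)] by (simp add: F_def G_def st)
  next
    fix a assume a: "a \<in> Q - (\<lambda>s. (s, s)) ` removable S"
    obtain s t where st: "a = (t, s)" by force
    with a have *: "t \<in> removable S" "s \<in> addable (remove_box t S)" "s \<noteq> t" by (auto simp: Q_def)
    show "prod.swap a \<in> P - (\<lambda>s. (s, s)) ` addable S"
      using off_diagonal_commute(1)[OF *(3)] * by (auto simp: P_def st)
  qed auto
  then have "app (down * up g) f S = app (up g * down) f S +
      ((\<Sum>s\<in>addable S. g (s + 1)) - (\<Sum>s\<in>removable S. g (s + 1))) * f S"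
    unfolding 1 2 left_diff_distrib by simp
  then show "app (down * up g) f S = app (up g * down + diag (\<lambda>S. (\<Sum>s\<in>addable S. g (s + 1)) -
      (\<Sum>s\<in>removable S. g (s + 1)))) f S"
    by (simp only: app_simps diag.rep_eq)
qed

section \<open>The hook length formula\<close>

text \<open>The left side is the coefficient of degree \<open>card E - 1\<close> of the Lagrange
  interpolation polynomial of p on E, and by the degree bound this polynomial is p itself.\<close>

lemma lagrange_coeff_sum:
  fixes p :: "'a::field poly"
  assumes fin: "finite E" and deg: "degree p < card E"
  shows "(\<Sum>b\<in>E. poly p b / (\<Prod>c\<in>E - {b}. b - c)) = coeff p (card E - 1)"
proof -
  define l where "l b = (\<Prod>c\<in>E - {b}. [:- c, 1:])" for b
  have degl: "degree (l b) = card E - 1" if "b \<in> E" for b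
    unfolding l_def using that fin by (subst degree_prod_eq_sum_degree) auto
  have lead: "coeff (l b) (card E - 1) = 1" if "b \<in> E" for b
  proof -
    have "lead_coeff (l b) = 1" unfolding l_def by (simp add: lead_coeff_prod)
    then show ?thesis using degl[OF that] by simp
  qed
  have polyl: "poly (l b) b' = (if b' = b then (\<Prod>c\<in>E - {b}. b - c) else 0)" if "b \<in> E" "b' \<in> E" for b b'
    unfolding l_def poly_prod using that fin by (auto intro!: prod_zero prod.cong)
  define q where "q = (\<Sum>b\<in>E. smult (poly p b / (\<Prod>c\<in>E - {b}. b - c)) (l b))"
  have "p = q"
  proof (rule poly_eqI_degree[of E])
    fix x assume x: "x \<in> E"
    have nz: "(\<Prod>c\<in>E - {x}. x - c) \<noteq> 0" using fin by auto
    have "poly q x = (\<Sum>b\<in>E. if x = b then poly p b else 0)"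
      unfolding q_def poly_sum
      by (intro sum.cong refl) (use x nz in \<open>auto simp: polyl\<close>)
    then show "poly p x = poly q x" using x fin by simp
  next
    show "degree p < card E" by (rule deg)
    show "degree q < card E"
      unfolding q_def using deg degl
      by (intro degree_sum_less) (auto intro: le_less_trans[OF degree_smult_le])
  qed
  moreover have "coeff q (card E - 1) = (\<Sum>b\<in>E. poly p b / (\<Prod>c\<in>E - {b}. b - c))"
    unfolding q_def coeff_sum coeff_smult using lead by simp
  ultimately show ?thesis by simp
qed

text \<open>The factor \<open>[:0, 0, 1:]\<close> raises all degrees by two, so that the three
  leading coefficients have natural indices even when E has fewer than two elements.\<close>

lemma coeff_prod_linear:
  fixes f :: "'b \<Rightarrow> 'a::field_char_0"
  assumes "finite E"
  defines "P \<equiv> [:0, 0, 1:] * (\<Prod>c\<in>E. [:- f c, 1:])"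
  shows "coeff P (card E + 2) = 1" "coeff P (card E + 1) = - sum f E"
    "coeff P (card E) = ((sum f E)\<^sup>2 - (\<Sum>c\<in>E. (f c)\<^sup>2)) / 2"
    "degree P = card E + 2"
proof -
  have "coeff P (card E + 2) = 1 \<and> coeff P (card E + 1) = - sum f E \<and>
    coeff P (card E) = ((sum f E)\<^sup>2 - (\<Sum>c\<in>E. (f c)\<^sup>2)) / 2 \<and> degree P = card E + 2"
    using assms(1) unfolding P_def
  proof induction
    case (insert a E)
    define Q where "Q = [:0, 0, 1:] * (\<Prod>c\<in>E. [:- f c, 1:])"
    note IH = insert.IH[folded Q_def]
    have eq: "[:0, 0, 1:] * (\<Prod>c\<in>insert a E. [:- f c, 1:]) = [:- f a, 1:] * Q"
      unfolding Q_def using insert by (simp add: mult_ac)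
    have c: "coeff ([:- f a, 1:] * Q) (Suc n) = coeff Q n - f a * coeff Q (Suc n)" for n
      by simp
    have "Q \<noteq> 0" using IH by auto
    then have "degree ([:- f a, 1:] * Q) = card E + 3"
      using IH by (subst degree_mult_eq) auto
    moreover have "coeff Q (card E + 3) = 0" using IH by (intro coeff_eq_0) simp
    ultimately show ?case
      unfolding eq using IH insert.hyps c[of "card E + 2"] c[of "card E + 1"] c[of "card E"]
      by (simp add: field_simps power2_eq_square numeral_3_eq_3)
  qed (simp add: numeral_2_eq_2)
  then show "coeff P (card E + 2) = 1" "coeff P (card E + 1) = - sum f E"
    "coeff P (card E) = ((sum f E)\<^sup>2 - (\<Sum>c\<in>E. (f c)\<^sup>2)) / 2"
    "degree P = card E + 2" by auto
qed

text \<open>When E consists of the beta numbers of a partition, shifted by their number, a summand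
  is the factor by which the inverse hook product changes if a box is removed, and the right side is
  the number of boxes.\<close>

lemma sum_shifted_ratio:
  fixes E :: "'a::field_char_0 set"
  assumes fin: "finite E"
  shows "(\<Sum>b\<in>E. b * (\<Prod>c\<in>E - {b}. (b - c - 1) / (b - c))) =
    \<Sum>E - of_nat (card E) * (of_nat (card E) - 1) / 2"
proof (cases "E = {}")
  case False
  define N where "N = card E"
  have N: "N > 0" using False fin by (simp add: N_def card_gt_0_iff)
  define F where "F = (\<Prod>c\<in>E. [:- (c + 1), 1:])"
  define G where "G = (\<Prod>c\<in>E. [:- c, 1:])"
  \<comment> \<open>On E the polynomial R takes the values of x F(x), as G vanishes there. The
    subtracted product is chosen to cancel the coefficients of degree N + 1 and N; the shift by N
    accounts for the latter, F having roots larger by one.\<close>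
  define R where "R = [:0, 1:] * F - [:- of_nat N, 1:] * G"
  have xR: "coeff R n = coeff ([:0, 0, 1:] * F) (Suc n) - coeff ([:0, 0, 1:] * G) (Suc n)
      + of_nat N * coeff ([:0, 0, 1:] * G) (Suc (Suc n))" for n
    unfolding R_def by (cases n) (simp_all add: algebra_simps)
  note cF = coeff_prod_linear[OF fin, of "\<lambda>c. c + 1", folded F_def N_def]
  note cG = coeff_prod_linear[OF fin, of "\<lambda>c. c", folded G_def N_def]
  have high: "coeff R n = 0" if ge: "n \<ge> N" for n
  proof -
    consider "n = N" | "n = N + 1" | "n \<ge> N + 2" using ge by linarith
    then show ?thesis
    proof cases
      case 1
      then show ?thesis using xR[of n] cF cG by (simp add: sum.distrib N_def)
    next
      case 2
      have "coeff ([:0, 0, 1:] * G) (N + 3) = 0" using cG by (intro coeff_eq_0) simp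
      then show ?thesis using 2 xR[of n] cF cG by (simp add: numeral_3_eq_3)
    next
      case 3
      then have "coeff ([:0, 0, 1:] * F) (Suc n) = 0" "coeff ([:0, 0, 1:] * G) (Suc n) = 0"
        "coeff ([:0, 0, 1:] * G) (Suc (Suc n)) = 0"
        using cF cG by (intro coeff_eq_0; simp)+
      then show ?thesis using xR[of n] by simp
    qed
  qed
  then have deg: "degree R < card E"
    using N unfolding N_def[symmetric] by (metis leading_coeff_0_iff not_less degree_0)
  have "coeff R (N - 1) = ((\<Sum>c\<in>E. c + 1)\<^sup>2 - (\<Sum>c\<in>E. (c + 1)\<^sup>2)) / 2
      - ((\<Sum>c\<in>E. c)\<^sup>2 - (\<Sum>c\<in>E. c\<^sup>2)) / 2 - of_nat N * (\<Sum>c\<in>E. c)"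
  proof -
    have i: "Suc (N - 1) = N" "Suc N = N + 1" using N by simp_all
    show ?thesis unfolding xR i cF(3) cG(3) cG(2) by simp
  qed
  also have "\<dots> = - (\<Sum>E - of_nat N * (of_nat N - 1) / 2)"
    by (simp add: sum.distrib power2_eq_square algebra_simps N_def sum_distrib_left[symmetric] sum_distrib_right[symmetric] add_divide_distrib diff_divide_distrib)
  also have "coeff R (N - 1) = (\<Sum>b\<in>E. poly R b / (\<Prod>c\<in>E - {b}. b - c))"
    unfolding N_def by (rule lagrange_coeff_sum[OF fin deg, symmetric])
  also have "\<dots> = (\<Sum>b\<in>E. - (b * (\<Prod>c\<in>E - {b}. (b - c - 1) / (b - c))))"
  proof (intro sum.cong refl)
    fix b assume b: "b \<in> E"
    have "poly G b = 0" unfolding G_def poly_prod using b fin by (auto intro!: prod_zero)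
    moreover have "poly F b = - (\<Prod>c\<in>E - {b}. b - c - 1)"
      unfolding F_def poly_prod using b fin by (subst prod.remove[OF fin b]) (simp add: algebra_simps)
    ultimately show "poly R b / (\<Prod>c\<in>E - {b}. b - c) = - (b * (\<Prod>c\<in>E - {b}. (b - c - 1) / (b - c)))"
      unfolding R_def by (simp add: prod_dividef)
  qed
  finally show ?thesis by (simp only: sum_negf N_def neg_equal_iff_equal)
qed simp


section \<open>Products of hook lengths\<close>

definition hook_pairs :: "maya \<Rightarrow> (int \<times> int) set" where
  "hook_pairs S = {(s, s'). s \<in> ptcls S \<and> s' \<notin> ptcls S \<and> s' < s}"

definition inv_hook_prod :: "maya \<Rightarrow> 'a::field_char_0" where
  "inv_hook_prod S = (\<Prod>(s, s')\<in>hook_pairs S. 1 / of_int (s - s'))"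

definition vandermonde_abs :: "int set \<Rightarrow> 'a::field_char_0" where
  "vandermonde_abs E = (\<Prod>b\<in>E. \<Prod>c\<in>{c\<in>E. c < b}. of_int (b - c))"

lemma vandermonde_abs_insert:
  assumes "finite E" "a \<notin> E"
  shows "vandermonde_abs (insert a E) = vandermonde_abs E * (\<Prod>c\<in>E. of_int \<bar>a - c\<bar> :: 'a::field_char_0)"
proof -
  have below: "{c \<in> insert a E. c < a} = {c\<in>E. c < a}" by auto
  have "(\<Prod>c\<in>{c\<in>insert a E. c < b}. of_int (b - c)) =
      (\<Prod>c\<in>{c\<in>E. c < b}. of_int (b - c)) * (if a < b then of_int (b - a) else 1 :: 'a)" if "b \<in> E" for b
  proof (cases "a < b")
    case True
    then have "{c\<in>insert a E. c < b} = insert a {c\<in>E. c < b}" by auto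
    then show ?thesis using True assms by simp
  next
    case False
    then have "{c\<in>insert a E. c < b} = {c\<in>E. c < b}" by auto
    then show ?thesis using False by simp
  qed
  then have "vandermonde_abs (insert a E) = (\<Prod>c\<in>{c\<in>E. c < a}. of_int (a - c)) *
      (vandermonde_abs E * (\<Prod>b\<in>E. if a < b then of_int (b - a) else 1 :: 'a))"
    unfolding vandermonde_abs_def using assms below by (simp add: prod.distrib)
  also have "(\<Prod>c\<in>{c\<in>E. c < a}. of_int (a - c)) = (\<Prod>c\<in>E. if c < a then of_int (a - c) else 1 :: 'a)"
    using assms(1) by (rule prod.inter_filter)
  also have "\<dots> * (vandermonde_abs E * (\<Prod>b\<in>E. if a < b then of_int (b - a) else 1)) =
      vandermonde_abs E * (\<Prod>c\<in>E. (if c < a then of_int (a - c) else 1) * (if a < c then of_int (c - a) else 1))"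
    by (simp add: prod.distrib mult_ac)
  also have "(\<Prod>c\<in>E. (if c < a then of_int (a - c) else 1) * (if a < c then of_int (c - a) else 1)) =
      (\<Prod>c\<in>E. of_int \<bar>a - c\<bar> :: 'a)"
    using assms(2) by (intro prod.cong refl) (auto simp: not_less order.antisym)
  finally show ?thesis .
qed

lemma hole_ge_window: "{..<- int N} \<subseteq> ptcls S \<Longrightarrow> s \<notin> ptcls S \<Longrightarrow> - int N \<le> s"
  by (meson lessThan_iff not_less subsetD)

lemma hook_pairs_window:
  fixes N :: nat
  assumes "{..<- int N} \<subseteq> ptcls S"
  shows "hook_pairs S = (SIGMA b:ptcls S \<inter> {- int N..}. {- int N..<b} - ptcls S)"
  using hole_ge_window[OF assms] by (fastforce simp: hook_pairs_def)

lemma finite_hook_pairs: "finite (hook_pairs S)"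
proof -
  obtain N where N: "{..<- int N} \<subseteq> ptcls S" by (rule window_exists)
  show ?thesis unfolding hook_pairs_window[OF N] using finite_window by auto
qed

lemma prod_below: "(\<Prod>c\<in>{- int N..<b}. of_int (b - c) :: 'a::field_char_0) = fact (nat (b + int N))"
proof -
  have "(\<Prod>c\<in>{- int N..<b}. of_int (b - c) :: 'a) = (\<Prod>i\<in>{1..nat (b + int N)}. of_nat i)"
    by (rule prod.reindex_bij_witness[of _ "\<lambda>i. b - int i" "\<lambda>c. nat (b - c)"]) auto
  then show ?thesis by (simp add: fact_prod)
qed

text \<open>The differences of b to the holes below it together with those to the particles below it
  run through 1, ..., b + N. This is the classical expression of the hook product by factorials and
  a Vandermonde product.\<close>

lemma inv_hook_prod_window:
  fixes N :: nat
  assumes "{..<- int N} \<subseteq> ptcls S"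
  defines "E \<equiv> ptcls S \<inter> {- int N..}"
  shows "inv_hook_prod S = (vandermonde_abs E / (\<Prod>b\<in>E. fact (nat (b + int N))) :: 'a::field_char_0)"
proof -
  have fin: "finite E" unfolding E_def by (rule finite_window)
  have "inv_hook_prod S = (\<Prod>b\<in>E. \<Prod>c\<in>{- int N..<b} - ptcls S. 1 / of_int (b - c) :: 'a)"
    unfolding inv_hook_prod_def hook_pairs_window[OF assms(1)] E_def[symmetric]
    using fin by (subst prod.Sigma) auto
  also have "\<dots> = (\<Prod>b\<in>E. (\<Prod>c\<in>{c\<in>E. c < b}. of_int (b - c)) / fact (nat (b + int N)))"
  proof (intro prod.cong refl)
    fix b
    have split: "{- int N..<b} = ({- int N..<b} - ptcls S) \<union> {c\<in>E. c < b}" by (auto simp: E_def)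
    have "(\<Prod>c\<in>{- int N..<b}. of_int (b - c) :: 'a) =
      (\<Prod>c\<in>{- int N..<b} - ptcls S. of_int (b - c)) * (\<Prod>c\<in>{c\<in>E. c < b}. of_int (b - c))"
      by (subst split, rule prod.union_disjoint) (use fin in \<open>auto simp: E_def\<close>)
    moreover have "(\<Prod>c\<in>{- int N..<b} - ptcls S. of_int (b - c) :: 'a) \<noteq> 0"
      by auto
    moreover have "(\<Prod>c\<in>{c\<in>E. c < b}. of_int (b - c) :: 'a) \<noteq> 0"
      using fin by auto
    ultimately show "(\<Prod>c\<in>{- int N..<b} - ptcls S. 1 / of_int (b - c) :: 'a) =
        (\<Prod>c\<in>{c\<in>E. c < b}. of_int (b - c)) / fact (nat (b + int N))"
      unfolding prod_below prod_dividef by (simp add: field_simps)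
  qed
  finally show ?thesis by (simp add: vandermonde_abs_def prod_dividef)
qed

text \<open>Only the factors involving the moved particle change: its factorial loses the factor s +
  1 + N, and its difference to every other particle changes by one.\<close>

lemma inv_hook_prod_remove_box:
  fixes N :: nat
  assumes N: "{..<- int N} \<subseteq> ptcls S" and s: "s \<in> removable S"
  defines "E \<equiv> ptcls S \<inter> {- int N..}"
  shows "inv_hook_prod (remove_box s S) = (inv_hook_prod S *
    (of_int (s + 1 + int N) * (\<Prod>c\<in>E - {s + 1}. of_int (s - c) / of_int (s + 1 - c))) :: 'a::field_char_0)"
proof -
  have ge: "- int N \<le> s" and mem: "s \<notin> ptcls S" "s + 1 \<in> ptcls S"
    using hole_ge_window[OF N] s by (auto simp: removable_def)
  define F where "F = E - {s + 1}"
  have fin: "finite F" unfolding F_def E_def using finite_window by auto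
  have nin: "s \<notin> F" "s + 1 \<notin> F" using mem by (auto simp: F_def E_def)
  have E: "E = insert (s + 1) F" using mem ge by (auto simp: F_def E_def)
  have E': "ptcls (remove_box s S) \<inter> {- int N..} = insert s F"
    using ge by (auto simp: F_def E_def)
  have N': "{..<- int N} \<subseteq> ptcls (remove_box s S)" using N ge by auto
  have fact_Suc: "fact (nat (s + 1 + int N)) = (of_int (s + 1 + int N) * fact (nat (s + int N)) :: 'a)"
  proof -
    have "nat (s + 1 + int N) = Suc (nat (s + int N))" using ge by simp
    moreover have "int (Suc (nat (s + int N))) = s + 1 + int N" using ge by simp
    then have "of_nat (Suc (nat (s + int N))) = (of_int (s + 1 + int N) :: 'a)"
      by (metis of_int_of_nat_eq)
    ultimately show ?thesis by simp
  qed
  have "s + 1 + int N \<noteq> 0" using ge by simp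
  then have nz: "of_int (s + 1 + int N) \<noteq> (0 :: 'a)" by (simp only: of_int_eq_0_iff not_False_eq_True)
  have cancel: "a * (p * q) / (f * g) = a * p / (k * f * g) * (k * q)" if "k \<noteq> 0" for a p q f g k :: 'a
    using that by simp
  \<comment> \<open>No other particle sits at s or s + 1, so s - c and s + 1 - c have the same sign
    and the absolute values drop out of the quotient.\<close>
  have ratio: "of_int \<bar>s - c\<bar> = of_int \<bar>s + 1 - c\<bar> * (of_int (s - c) / of_int (s + 1 - c) :: 'a)"
    if "c \<in> F" for c
  proof -
    have "c \<noteq> s" "c \<noteq> s + 1" using that nin by auto
    then have *: "of_int (s + 1 - c) \<noteq> (0 :: 'a)"
      and "\<bar>s - c\<bar> = s - c \<and> \<bar>s + 1 - c\<bar> = s + 1 - c \<or> \<bar>s - c\<bar> = - (s - c) \<and> \<bar>s + 1 - c\<bar> = - (s + 1 - c)"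
      by (simp only: of_int_eq_0_iff, linarith)+
    then show ?thesis
      by (elim disjE conjE) (simp_all only: of_int_minus nonzero_mult_div_cancel_left simp_thms
          times_divide_eq_right mult_minus_left minus_divide_left[symmetric])
  qed
  have "inv_hook_prod (remove_box s S) = (vandermonde_abs F * (\<Prod>c\<in>F. of_int \<bar>s - c\<bar>) /
      (fact (nat (s + int N)) * (\<Prod>b\<in>F. fact (nat (b + int N)))) :: 'a)"
    unfolding inv_hook_prod_window[OF N'] E' vandermonde_abs_insert[OF fin nin(1)]
    using fin nin by simp
  also have "(\<Prod>c\<in>F. of_int \<bar>s - c\<bar> :: 'a) =
      (\<Prod>c\<in>F. of_int \<bar>s + 1 - c\<bar>) * (\<Prod>c\<in>F. of_int (s - c) / of_int (s + 1 - c))"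
    unfolding prod.distrib[symmetric] using ratio by (rule prod.cong[OF refl])
  also have "vandermonde_abs F * ((\<Prod>c\<in>F. of_int \<bar>s + 1 - c\<bar>) * (\<Prod>c\<in>F. of_int (s - c) / of_int (s + 1 - c))) /
      (fact (nat (s + int N)) * (\<Prod>b\<in>F. fact (nat (b + int N)))) =
      vandermonde_abs F * (\<Prod>c\<in>F. of_int \<bar>s + 1 - c\<bar>) /
      (fact (nat (s + 1 + int N)) * (\<Prod>b\<in>F. fact (nat (b + int N)))) *
      (of_int (s + 1 + int N) * (\<Prod>c\<in>F. of_int (s - c) / of_int (s + 1 - c)) :: 'a)"
    unfolding fact_Suc by (rule cancel[OF nz])
  also have "vandermonde_abs F * (\<Prod>c\<in>F. of_int \<bar>s + 1 - c\<bar>) /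
      (fact (nat (s + 1 + int N)) * (\<Prod>b\<in>F. fact (nat (b + int N)))) = (inv_hook_prod S :: 'a)"
    unfolding inv_hook_prod_window[OF N] E_def[symmetric] unfolding E vandermonde_abs_insert[OF fin nin(2)]
    using fin nin by simp
  finally show ?thesis unfolding F_def .
qed

section \<open>Charge, energy, and the diagrams of the partitions of n\<close>

definition charge :: "maya \<Rightarrow> int" where "charge = reg_sum (\<lambda>_. 1)"
text \<open>At charge 0 this is the size of the partition. Weighting positions by s itself gives the
  lowest state of charge c the energy c (c - 1) / 2.\<close>

definition energy :: "maya \<Rightarrow> int" where "energy = reg_sum (\<lambda>s. s)"

lemma sum_below_zero: "2 * (\<Sum>s\<in>{- int N..<0}. s) = - (int N * (int N + 1))"
proof (induction N)
  case (Suc N)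
  have "{- int (Suc N)..<0} = insert (- int (Suc N)) {- int N..<0}" by auto
  then have "(\<Sum>s\<in>{- int (Suc N)..<0}. s) = - int (Suc N) + (\<Sum>s\<in>{- int N..<0}. s)" by simp
  with Suc show ?case by (simp add: algebra_simps)
qed simp

text \<open>The hook length formula, in the form of the recursion of the number of standard tableaux.\<close>

lemma hook_length_recursion:
  assumes "charge S = 0"
  shows "(\<Sum>s\<in>removable S. inv_hook_prod (remove_box s S)) = (of_int (energy S) * inv_hook_prod S :: 'a::field_char_0)"
proof -
  obtain N where N: "{..<- int N} \<subseteq> ptcls S" by (rule window_exists)
  define E where "E = ptcls S \<inter> {- int N..}"
  have fin: "finite E" unfolding E_def by (rule finite_window)
  have cardE: "card E = N"
    using assms unfolding charge_def reg_sum_window[OF N] E_def by simp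
  define l where "l b = (of_int (b + int N) :: 'a)" for b
  define t where "t b = l b * (\<Prod>c\<in>E - {b}. (l b - l c - 1) / (l b - l c))" for b
  have inj: "inj_on l E" by (auto simp: inj_on_def l_def)
  have "(\<Sum>s\<in>removable S. inv_hook_prod (remove_box s S)) =
      (\<Sum>s\<in>removable S. inv_hook_prod S * t (s + 1) :: 'a)"
    by (intro sum.cong refl)
       (auto simp: inv_hook_prod_remove_box[OF N] E_def[symmetric] t_def l_def algebra_simps intro!: prod.cong)
  also have "\<dots> = inv_hook_prod S * (\<Sum>b\<in>(\<lambda>s. s + 1) ` removable S. t b)"
    by (simp add: sum_distrib_left sum.reindex inj_on_def)
  \<comment> \<open>The sum extends to all particles of the window, because t b = 0 for a particle
    that cannot move down: the particle at b - 1 makes a numerator vanish.\<close>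
  also have "(\<Sum>b\<in>(\<lambda>s. s + 1) ` removable S. t b) = (\<Sum>b\<in>E. t b)"
  proof (rule sum.mono_neutral_left[OF fin])
    show "(\<lambda>s. s + 1) ` removable S \<subseteq> E"
      using hole_ge_window[OF N] by (fastforce simp: E_def removable_def)
    show "\<forall>b\<in>E - (\<lambda>s. s + 1) ` removable S. t b = 0"
    proof
      fix b assume b: "b \<in> E - (\<lambda>s. s + 1) ` removable S"
      then have mem: "b - 1 \<in> ptcls S"
        by (auto simp: E_def removable_def image_iff) (metis diff_add_cancel)
      show "t b = 0"
      proof (cases "b = - int N")
        \<comment> \<open>At the lower end b - 1 lies outside E; here the factor l b is 0
          instead.\<close>
        case True
        then show ?thesis by (simp add: t_def l_def)
      next
        case False
        with b mem have "b - 1 \<in> E - {b}" by (auto simp: E_def)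
        moreover have "(l b - l (b - 1) - 1) / (l b - l (b - 1)) = 0" by (simp add: l_def)
        ultimately have "(\<Prod>c\<in>E - {b}. (l b - l c - 1) / (l b - l c)) = 0"
          using fin by (metis finite_Diff prod_zero)
        then show ?thesis by (simp add: t_def)
      qed
    qed
  qed
  also have "(\<Sum>b\<in>E. t b) = (\<Sum>x\<in>l ` E. x * (\<Prod>y\<in>l ` E - {x}. (x - y - 1) / (x - y)))"
    unfolding sum.reindex[OF inj] t_def
  proof (intro sum.cong refl, simp)
    fix b assume b: "b \<in> E"
    have "l ` E - {l b} = l ` (E - {b})" using inj b by (auto simp: inj_on_def)
    moreover have "inj_on l (E - {b})" using inj by (rule inj_on_subset) auto
    ultimately have "(\<Prod>y\<in>l ` E - {l b}. (l b - y - 1) / (l b - y)) = (\<Prod>c\<in>E - {b}. (l b - l c - 1) / (l b - l c))"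
      by (simp add: prod.reindex)
    then show "l b = 0 \<or> (\<Prod>c\<in>E - {b}. (l b - l c - 1) / (l b - l c)) =
      (\<Prod>y\<in>l ` E - {l b}. (l b - y - 1) / (l b - y))" by simp
  qed
  also have "\<dots> = (\<Sum>b\<in>E. l b) - of_nat N * (of_nat N - 1) / 2"
    using sum_shifted_ratio[of "l ` E"] fin inj by (simp add: card_image cardE sum.reindex)
  also have "\<dots> = of_int (energy S)"
  proof -
    have "of_int (2 * (\<Sum>s\<in>{- int N..<0}. s)) = (of_int (- (int N * (int N + 1))) :: 'a)"
      unfolding sum_below_zero ..
    then have "of_int (\<Sum>s\<in>{- int N..<0}. s) = (- (of_nat N * (of_nat N + 1)) / 2 :: 'a)"
      by (simp add: field_simps)
    moreover have "(\<Sum>b\<in>E. l b) = of_int (\<Sum>b\<in>E. b) + of_nat N * of_nat N"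
      unfolding l_def by (simp add: sum.distrib cardE)
    ultimately show ?thesis
      unfolding energy_def reg_sum_window[OF N] E_def[symmetric] by (simp add: field_simps)
  qed
  finally show ?thesis by (simp add: mult.commute)
qed

lemma charge_add_box [simp]: "s \<in> addable S \<Longrightarrow> charge (add_box s S) = charge S"
  and energy_add_box [simp]: "s \<in> addable S \<Longrightarrow> energy (add_box s S) = energy S + 1"
  and charge_remove_box [simp]: "s \<in> removable S \<Longrightarrow> charge (remove_box s S) = charge S"
  and energy_remove_box [simp]: "s \<in> removable S \<Longrightarrow> energy (remove_box s S) = energy S - 1"
  by (simp_all add: charge_def energy_def reg_sum_add_box reg_sum_remove_box)

definition level :: "nat \<Rightarrow> maya set" where
  "level n = {S. charge S = 0 \<and> energy S = int n}"

definition vac :: maya where "vac = Maya {..<0}"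

lemma ptcls_vac [simp]: "ptcls vac = {..<0}"
proof -
  have "{..<0} \<inter> {0..} = ({} :: int set)" by auto
  then show ?thesis unfolding vac_def by (intro Maya_inverse) simp
qed

lemma reg_sum_vac [simp]: "reg_sum g vac = 0"
proof -
  have "{..<0} \<inter> {0..} = ({} :: int set)" by auto
  then show ?thesis by (simp add: reg_sum_def)
qed

lemma energy_eq: "energy S = (\<Sum>s\<in>ptcls S \<inter> {0..}. s) + (\<Sum>s\<in>{..<0} - ptcls S. - s)"
  unfolding energy_def reg_sum_def by (simp add: sum_negf)

lemma energy_nonneg: "0 \<le> energy S"
  unfolding energy_eq by (intro add_nonneg_nonneg sum_nonneg) auto

lemma particle_le_energy: "s \<in> ptcls S \<Longrightarrow> s \<ge> 0 \<Longrightarrow> s \<le> energy S"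
  and hole_ge_energy: "s \<notin> ptcls S \<Longrightarrow> s < 0 \<Longrightarrow> - s \<le> energy S"
proof -
  have pos: "(\<Sum>s\<in>ptcls S \<inter> {0..}. s) \<ge> 0" "(\<Sum>s\<in>{..<0} - ptcls S. - s) \<ge> 0"
    by (intro sum_nonneg; auto)+
  show "s \<le> energy S" if "s \<in> ptcls S" "s \<ge> 0"
    using member_le_sum[of s "ptcls S \<inter> {0..}" "\<lambda>s. s"] finite_ptcls[of S] pos that
    unfolding energy_eq by auto
  show "- s \<le> energy S" if "s \<notin> ptcls S" "s < 0"
    using member_le_sum[of s "{..<0} - ptcls S" "\<lambda>s. - s"] finite_holes[of S] pos that
    unfolding energy_eq by auto
qed

lemma level_0: "level 0 = {vac}"
proof -
  have "S = vac" if "S \<in> level 0" for S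
  proof (rule maya_eqI)
    have e: "charge S = 0" "energy S = 0" using that by (auto simp: level_def)
    have no_holes: "{..<0} - ptcls S = {}"
      using hole_ge_energy[of _ S] e by fastforce
    then have "ptcls S \<inter> {0..} = {}"
    proof -
      have "card ({..<0} - ptcls S) = 0" by (simp only: no_holes card.empty)
      then show ?thesis using e(1) finite_ptcls[of S] unfolding charge_def reg_sum_def by simp
    qed
    with no_holes show "ptcls S = ptcls vac" by (auto simp: not_less[symmetric])
  qed
  then show ?thesis by (auto simp: level_def charge_def energy_def)
qed

text \<open>A particle s \<ge> 0 or a hole s < 0 costs energy \<bar>s\<bar>, and no contribution is
  negative. So S agrees with the vacuum outside [- n, n], whatever its charge.\<close>

lemma finite_energy_le: "finite {S. energy S \<le> n}"
proof (rule finite_subset)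
  let ?I = "{- n..n}"
  show "{S. energy S \<le> n} \<subseteq> (\<lambda>X. Maya ({..<- n} \<union> X)) ` Pow ?I \<union> {S. energy S < 0 }"
  proof
    fix S assume "S \<in> {S. energy S \<le> n}"
    then have n: "energy S \<le> n" by simp
    have "ptcls S = {..<- n} \<union> (ptcls S \<inter> ?I)" if "0 \<le> n"
      using particle_le_energy[of _ S] hole_ge_energy[of _ S] n that by fastforce
    then have "0 \<le> n \<Longrightarrow> S = Maya ({..<- n} \<union> (ptcls S \<inter> ?I))"
      by (metis ptcls_inverse)
    then show "S \<in> (\<lambda>X. Maya ({..<- n} \<union> X)) ` Pow ?I \<union> {S. energy S < 0 }"
      using n by (cases "0 \<le> n") (auto intro!: image_eqI[of S _ "ptcls S \<inter> ?I"])
  qed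
  have "{S. energy S < 0} = {}" using energy_nonneg by (auto simp: not_less)
  then show "finite ((\<lambda>X. Maya ({..<- n} \<union> X)) ` Pow ?I \<union> {S. energy S < 0 })" by simp
qed

lemma finite_level: "finite (level n)"
  by (rule finite_subset[OF _ finite_energy_le[of "int n"]]) (auto simp: level_def)

lemma add_box_level: "s \<in> addable S \<Longrightarrow> add_box s S \<in> level (Suc n) \<longleftrightarrow> S \<in> level n"
  and remove_box_level: "s \<in> removable S \<Longrightarrow> remove_box s S \<in> level n \<longleftrightarrow> S \<in> level (Suc n)"
  by (auto simp: level_def)

lemma inv_hook_prod_vac [simp]: "inv_hook_prod vac = 1"
proof -
  have "hook_pairs vac = {}" by (auto simp: hook_pairs_def)
  then show ?thesis by (simp add: inv_hook_prod_def)
qed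

text \<open>The coefficient \<open>fact n * inv_hook_prod S\<close> is the number of standard
  tableaux, that is, of paths from the vacuum to S; the induction step is their recursion
  \<open>hook_length_recursion\<close>.\<close>

lemma down_power:
  "app (down ^ n) f vac = (\<Sum>S\<in>level n. fact n * inv_hook_prod S * f S :: 'a::field_char_0)"
proof (induction n arbitrary: f)
  case 0
  show ?case by (simp add: level_0)
next
  case (Suc n)
  have "app (down ^ Suc n) f vac = app (down ^ n) (app down f) vac"
    by (simp only: power_Suc2 app_simps)
  also have "\<dots> = (\<Sum>S\<in>level n. \<Sum>s\<in>addable S. fact n * inv_hook_prod S * f (add_box s S))"
    unfolding Suc.IH by (simp add: sum_distrib_left)
  also have "\<dots> = (\<Sum>(S, s)\<in>(SIGMA S:level n. addable S). fact n * inv_hook_prod S * f (add_box s S))"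
    by (rule sum.Sigma) (auto simp: finite_level finite_addable)
  also have "\<dots> = (\<Sum>(S, s)\<in>(SIGMA S:level (Suc n). removable S). fact n * inv_hook_prod (remove_box s S) * f S)"
    by (rule sum.reindex_bij_witness[of _ "\<lambda>(S, s). (remove_box s S, s)" "\<lambda>(S, s). (add_box s S, s)"])
       (auto simp: removable_add addable_remove add_box_level remove_box_level)
  also have "\<dots> = (\<Sum>S\<in>level (Suc n). \<Sum>s\<in>removable S. fact n * inv_hook_prod (remove_box s S) * f S)"
    by (rule sum.Sigma[symmetric]) (auto simp: finite_level finite_removable)
  also have "\<dots> = (\<Sum>S\<in>level (Suc n). fact (Suc n) * inv_hook_prod S * f S)"
  proof (intro sum.cong refl)
    fix S assume S: "S \<in> level (Suc n)"
    have "(\<Sum>s\<in>removable S. fact n * inv_hook_prod (remove_box s S) * f S) =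
        fact n * f S * (\<Sum>s\<in>removable S. inv_hook_prod (remove_box s S))"
      by (simp add: sum_distrib_left mult_ac)
    also have "\<dots> = fact (Suc n) * inv_hook_prod S * f S"
      using S by (simp add: hook_length_recursion level_def algebra_simps)
    finally show "(\<Sum>s\<in>removable S. fact n * inv_hook_prod (remove_box s S) * f S) =
        fact (Suc n) * inv_hook_prod S * f S" .
  qed
  finally show ?case .
qed

lemma up_power:
  "app (up (\<lambda>_. 1) ^ n) (\<lambda>S. if S = vac then 1 else 0) S =
     (if S \<in> level n then fact n * inv_hook_prod S else 0 :: 'a::field_char_0)"
proof (induction n arbitrary: S)
  case 0
  show ?case by (simp add: level_0)
next
  case (Suc n)
  have "app (up (\<lambda>_. 1) ^ Suc n) (\<lambda>S. if S = vac then 1 else 0) S =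
      (\<Sum>s\<in>removable S. if remove_box s S \<in> level n then fact n * inv_hook_prod (remove_box s S) else 0 :: 'a)"
    by (simp add: Suc.IH)
  also have "\<dots> = (\<Sum>s\<in>removable S. if S \<in> level (Suc n) then fact n * inv_hook_prod (remove_box s S) else 0)"
    by (intro sum.cong refl) (simp add: remove_box_level)
  also have "\<dots> = (if S \<in> level (Suc n) then fact (Suc n) * inv_hook_prod S else 0)"
    by (auto simp: sum_distrib_left[symmetric] hook_length_recursion level_def algebra_simps)
  finally show ?case .
qed

text \<open>Each half contributes the number of standard tableaux, so this is n! times the
  Plancherel average of p over the partitions of n.\<close>

lemma linop_sandwich:
  "app (down ^ n * diag p * up (\<lambda>_. 1) ^ n) (\<lambda>S. if S = vac then 1 else 0) vac =
     (fact n)\<^sup>2 * (\<Sum>S\<in>level n. (inv_hook_prod S)\<^sup>2 * p S :: 'a::field_char_0)"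
  by (simp add: down_power up_power sum_distrib_left power2_eq_square mult_ac)

text \<open>At charge 0 this is the sum of z^c over the contents c: in row i they run from 1 - i to
  the beta number s, and the geometric sum is z / (z - 1) times z^s - z^(- i).\<close>

definition content_sum :: "'a::field_char_0 \<Rightarrow> maya \<Rightarrow> 'a" where
  "content_sum z S = z / (z - 1) * reg_sum (\<lambda>s. z powi s) S"

section \<open>The box operators as an instance of \<open>vacuum_algebra\<close>\<close>

lemma diag_mult: "diag p * diag q = diag (\<lambda>s. p s * q s)"
  by (rule linop_eqI) (simp add: mult_ac)

lemma diag_const_commute: "diag (\<lambda>_. c) * T = T * diag (\<lambda>_. c)"
  by (rule linop_eqI) (simp add: app_scale)

text \<open>Commuting the content operator at x with \<open>up g\<close> multiplies g by x^s, where
  s is the content of the added box. The factors for z and 1 / z cancel, which is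
  \<open>AX'\<close>. The relation \<open>DX\<close> is \<open>sum_addable_removable\<close> for the
  function x^(s + 1), whose value at - 1 is the constant 1.\<close>

lemma vacuum_algebra_linop:
  fixes z :: "'a::field_char_0"
  assumes z: "z \<noteq> 0" "z \<noteq> 1"
  shows "vacuum_algebra down (up (\<lambda>_. 1)) (diag (content_sum z)) (diag (content_sum (1 / z)))
    (diag (\<lambda>_. (z - 1)\<^sup>2 / z)) (\<lambda>T. app T (\<lambda>S. if S = vac then 1 else 0) vac) ((z - 1)\<^sup>2 / z)"
proof -
  have cs: "content_sum x = reg_sum (\<lambda>s. x / (x - 1) * x powi s)" for x :: 'a
    unfolding content_sum_def reg_sum_def
    by (simp add: fun_eq_iff sum_distrib_left right_diff_distrib)
  have X: "diag (content_sum x) * up g - up g * diag (content_sum x) = up (\<lambda>s. x powi s * g s)"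
    if "x \<noteq> 0" "x \<noteq> 1" for x :: 'a and g
  proof -
    have "x / (x - 1) * x powi s - x / (x - 1) * x powi (s - 1) = x powi s" for s
    proof -
      have "x / (x - 1) * x powi (s - 1) = x powi s / (x - 1)"
        using that by (simp add: power_int_diff)
      then have "x / (x - 1) * x powi s - x / (x - 1) * x powi (s - 1) = (x - 1) * x powi s / (x - 1)"
        by (simp add: diff_divide_distrib left_diff_distrib)
      then show ?thesis using that by simp
    qed
    then show ?thesis unfolding cs diag_up_commutator by simp
  qed
  have DX: "down * up (\<lambda>s. x powi s) = up (\<lambda>s. x powi s) * down + 1 + diag (\<lambda>_. (x - 1)\<^sup>2 / x) * diag (content_sum x)"
    if x: "x \<noteq> 0" "x \<noteq> 1" for x :: 'a
  proof -
    have "(\<Sum>s\<in>addable S. x powi (s + 1)) - (\<Sum>s\<in>removable S. x powi (s + 1)) =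
        1 + (x - 1)\<^sup>2 / x * content_sum x S" for S
    proof -
      have "reg_sum (\<lambda>s. x powi (s + 1)) S = x * reg_sum (\<lambda>s. x powi s) S"
        using x by (simp add: reg_sum_def power_int_add sum_distrib_left right_diff_distrib mult.commute)
      then show ?thesis
        unfolding sum_addable_removable[of "\<lambda>s. x powi (s + 1)" S] content_sum_def
        using x by (simp add: field_simps power2_eq_square)
    qed
    then show ?thesis unfolding down_up_commutator diag_mult
      by (intro linop_eqI) (simp add: algebra_simps)
  qed
  have z': "1 / z \<noteq> 0" "1 / z \<noteq> 1" using z by auto
  have w: "(1 / z - 1)\<^sup>2 / (1 / z) = (z - 1)\<^sup>2 / z"
    using z by (simp add: field_simps power2_eq_square)
  show ?thesis
  proof
    fix T :: "(maya, 'a) linop"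
    let ?v = "\<lambda>S. if S = vac then 1 else 0 :: 'a"
    show "app (T * diag (\<lambda>_. (z - 1)\<^sup>2 / z)) ?v vac = (z - 1)\<^sup>2 / z * app T ?v vac"
      using app_scale[of T "(z - 1)\<^sup>2 / z" ?v] by simp
    have "removable vac = {}" by (auto simp: removable_def)
    then show "app (up (\<lambda>_. 1) * T) ?v vac = 0" by simp
    have "app down ?v = (\<lambda>S. 0 * ?v S)"
    proof
      fix S
      have "add_box s S \<noteq> vac" if "s \<in> addable S" for s
      proof
        assume "add_box s S = vac"
        then have eq: "insert (s + 1) (ptcls S - {s}) = {..<0}" by (metis ptcls_add_box ptcls_vac)
        have "s + 1 \<in> insert (s + 1) (ptcls S - {s})" "s \<notin> insert (s + 1) (ptcls S - {s})" by auto
        then show False unfolding eq by simp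
      qed
      then show "app down ?v S = 0 * ?v S" by simp
    qed
    then show "app (T * down) ?v vac = 0" using app_scale[of T 0 ?v] by simp
    have "app (diag (content_sum x)) ?v = (\<lambda>S. 0 * ?v S)" for x :: 'a
      by (simp add: fun_eq_iff content_sum_def)
    then show "app (T * diag (content_sum z)) ?v vac = 0" "app (T * diag (content_sum (1 / z))) ?v vac = 0"
      using app_scale[of T 0 ?v] by simp_all
  next
    show "down * (diag (content_sum z) * up (\<lambda>_. 1) - up (\<lambda>_. 1) * diag (content_sum z)) =
      (diag (content_sum z) * up (\<lambda>_. 1) - up (\<lambda>_. 1) * diag (content_sum z)) * down + 1 +
      diag (\<lambda>_. (z - 1)\<^sup>2 / z) * diag (content_sum z)"
      unfolding X[OF z] using DX[OF z] by simp
    show "down * (diag (content_sum (1 / z)) * up (\<lambda>_. 1) - up (\<lambda>_. 1) * diag (content_sum (1 / z))) =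
      (diag (content_sum (1 / z)) * up (\<lambda>_. 1) - up (\<lambda>_. 1) * diag (content_sum (1 / z))) * down + 1 +
      diag (\<lambda>_. (z - 1)\<^sup>2 / z) * diag (content_sum (1 / z))"
      unfolding X[OF z'] using DX[OF z'] unfolding w by simp
    show "diag (content_sum z) * (diag (content_sum (1 / z)) * up (\<lambda>_. 1) - up (\<lambda>_. 1) * diag (content_sum (1 / z))) -
      (diag (content_sum (1 / z)) * up (\<lambda>_. 1) - up (\<lambda>_. 1) * diag (content_sum (1 / z))) * diag (content_sum z) =
      up (\<lambda>_. 1)"
      unfolding X[OF z'] X[OF z] using z by (simp add: power_int_divide_distrib)
    show "down * up (\<lambda>_. 1) = up (\<lambda>_. 1) * down + (1 :: (maya, 'a) linop)"
      unfolding down_up_commutator using sum_addable_removable[of "\<lambda>_. 1 :: 'a"]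
      by (intro linop_eqI) simp
  qed (simp_all add: diag_const_commute diag_mult mult.commute)
qed

lemma sum_inv_hook_prod: "(\<Sum>S\<in>level n. (inv_hook_prod S)\<^sup>2) = (1 / fact n :: 'a::field_char_0)"
proof -
  \<comment> \<open>The value z = 2 is an arbitrary choice; the claim does not involve z.\<close>
  interpret vacuum_algebra "down :: (maya, 'a) linop" "up (\<lambda>_. 1)" "diag (content_sum 2)" "diag (content_sum (1 / 2))"
    "diag (\<lambda>_. (2 - 1)\<^sup>2 / 2)" "\<lambda>T. app T (\<lambda>S. if S = vac then 1 else 0) vac" "(2 - 1)\<^sup>2 / 2"
    by (rule vacuum_algebra_linop) auto
  have "diag (\<lambda>_. 1) = (1 :: (maya, 'a) linop)" by (rule linop_eqI) simp
  then have "(fact n)\<^sup>2 * (\<Sum>S\<in>level n. (inv_hook_prod S)\<^sup>2) = (fact n :: 'a)"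
    using linop_sandwich[of n "\<lambda>_. 1 :: 'a"] L_D_power_U_power[of 0 n 1] by simp
  then show ?thesis by (simp add: power2_eq_square field_simps)
qed

lemma sum_content_sums:
  fixes z :: "'a::field_char_0"
  assumes z: "z \<noteq> 0" "z \<noteq> 1"
  defines "w \<equiv> (z - 1)\<^sup>2 / z"
  shows "(\<Sum>S\<in>level n. (inv_hook_prod S)\<^sup>2 *
      (w * (content_sum z S * content_sum (1 / z) S) + content_sum z S + content_sum (1 / z) S)) =
    (\<Sum>k=1..n. (w ^ k * of_nat ((2 * k - 2) choose (k - 1)) + w ^ (k - 1) * of_nat ((2 * k) choose k))
      / ((fact k)\<^sup>2 * fact (n - k)))"
proof -
  interpret vacuum_algebra "down :: (maya, 'a) linop" "up (\<lambda>_. 1)" "diag (content_sum z)" "diag (content_sum (1 / z))"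
    "diag (\<lambda>_. w)" "\<lambda>T. app T (\<lambda>S. if S = vac then 1 else 0) vac" w
    unfolding w_def by (rule vacuum_algebra_linop) fact+
  have "(fact n)\<^sup>2 * (\<Sum>S\<in>level n. (inv_hook_prod S)\<^sup>2 *
      (w * (content_sum z S * content_sum (1 / z) S) + content_sum z S + content_sum (1 / z) S)) =
    (\<Sum>k=1..n. of_nat (n choose k) * (fact n / fact k) *
      (w ^ k * of_nat ((2 * k - 2) choose (k - 1)) + w ^ (k - 1) * of_nat ((2 * k) choose k)))"
    unfolding L_hook_sum[of n, symmetric] diag_mult linop_sandwich
    by (simp only: distrib_left sum.distrib sum_distrib_left mult_ac)
  also have "\<dots> = (fact n)\<^sup>2 * (\<Sum>k=1..n. (w ^ k * of_nat ((2 * k - 2) choose (k - 1)) + w ^ (k - 1) * of_nat ((2 * k) choose k))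
      / ((fact k)\<^sup>2 * fact (n - k)))"
    unfolding sum_distrib_left
  proof (intro sum.cong refl)
    fix k assume "k \<in> {1..n}"
    then have "of_nat (n choose k) = (fact n / (fact k * fact (n - k)) :: 'a)"
      by (simp add: binomial_fact)
    then show "of_nat (n choose k) * (fact n / fact k) * x = (fact n)\<^sup>2 * (x / ((fact k)\<^sup>2 * fact (n - k)))" for x :: 'a
      by (simp add: power2_eq_square)
  qed
  finally show ?thesis by simp
qed

section \<open>Okada's formula\<close>

lemma sum_powi_below:
  fixes z :: "'a::field_char_0"
  assumes "z \<noteq> 0" "z \<noteq> 1" "a \<le> b"
  shows "(\<Sum>s\<in>{a..<b}. z powi (b - s)) = z * (z powi (b - a) - 1) / (z - 1)"
proof -
  have "(\<Sum>s\<in>{a..<b}. z powi (b - s)) = (\<Sum>i<nat (b - a). z * z ^ i)"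
    by (rule sum.reindex_bij_witness[of _ "\<lambda>i. b - 1 - int i" "\<lambda>s. nat (b - 1 - s)"])
       (auto simp: power_int_def nat_diff_distrib' nat_add_distrib Suc_nat_eq_nat_zadd1 simp flip: power_Suc)
  also have "\<dots> = z * ((z ^ nat (b - a) - 1) / (z - 1))"
    using assms by (simp add: sum_distrib_left[symmetric] geometric_sum)
  also have "z ^ nat (b - a) = z powi (b - a)" using assms by (simp add: power_int_def)
  finally show ?thesis by simp
qed

lemma content_sum_window:
  fixes z :: "'a::field_char_0" and N :: nat
  assumes z: "z \<noteq> 0" "z \<noteq> 1" and N: "{..<- int N} \<subseteq> ptcls S"
  shows "content_sum z S = z / (z - 1) *
    ((\<Sum>b\<in>ptcls S \<inter> {- int N..}. z powi b) - (1 - 1 / z ^ N) / (z - 1))"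
proof -
  have "(\<Sum>s\<in>{- int N..<0}. z powi s) = (\<Sum>s\<in>{- int N..<0}. (1 / z) powi (0 - s))"
    by (intro sum.cong refl) (simp add: power_int_minus power_int_divide_distrib)
  also have "\<dots> = 1 / z * ((1 / z) powi (int N) - 1) / (1 / z - 1)"
    using sum_powi_below[of "1 / z" "- int N" 0] z by simp
  also have "\<dots> = ((1 / z) ^ N - 1) / (z * (1 / z - 1))" by simp
  also have "z * (1 / z - 1) = 1 - z" using z by (simp add: field_simps)
  also have "((1 / z) ^ N - 1) / (1 - z) = (1 - 1 / z ^ N) / (z - 1)"
    by (simp add: power_one_over minus_divide_divide[of "1 - 1 / z ^ N" "z - 1", symmetric])
  finally show ?thesis unfolding content_sum_def reg_sum_window[OF N] by simp
qed

text \<open>For every particle b the hooks are the differences to all lower positions of the window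
  minus the differences to lower particles. The former are geometric sums. The latter, with both
  signs of the exponent, make up all ordered pairs of distinct particles, hence P Q without its N
  diagonal terms.\<close>

lemma hook_sum_content_sum:
  fixes z :: "'a::field_char_0"
  assumes z: "z \<noteq> 0" "z \<noteq> 1" and charge: "charge S = 0"
  shows "(\<Sum>(s, s')\<in>hook_pairs S. z powi (s - s') + (1 / z) powi (s - s')) =
    content_sum z S + content_sum (1 / z) S + (z - 1)\<^sup>2 / z * (content_sum z S * content_sum (1 / z) S)"
proof -
  obtain N where N: "{..<- int N} \<subseteq> ptcls S" by (rule window_exists)
  define E where "E = ptcls S \<inter> {- int N..}"
  have fin: "finite E" unfolding E_def by (rule finite_window)
  have cardE: "card E = N"
    using charge unfolding charge_def reg_sum_window[OF N] E_def by simp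
  define f where "f h = z powi h + (1 / z) powi h" for h
  define P where "P = (\<Sum>b\<in>E. z powi b)"
  define Q where "Q = (\<Sum>b\<in>E. (1 / z) powi b)"
  have z': "1 / z \<noteq> 0" "1 / z \<noteq> 1" using z by auto
  have "(\<Sum>(s, s')\<in>hook_pairs S. f (s - s')) = (\<Sum>b\<in>E. \<Sum>c\<in>{- int N..<b} - ptcls S. f (b - c))"
    unfolding hook_pairs_window[OF N] E_def[symmetric] using fin by (subst sum.Sigma) auto
  also have "\<dots> = (\<Sum>b\<in>E. (\<Sum>c\<in>{- int N..<b}. f (b - c)) - (\<Sum>c\<in>{c\<in>E. c < b}. f (b - c)))"
  proof (intro sum.cong refl)
    fix b
    have split: "{- int N..<b} = ({- int N..<b} - ptcls S) \<union> {c\<in>E. c < b}" by (auto simp: E_def)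
    have "(\<Sum>c\<in>{- int N..<b}. f (b - c)) =
      (\<Sum>c\<in>{- int N..<b} - ptcls S. f (b - c)) + (\<Sum>c\<in>{c\<in>E. c < b}. f (b - c))"
      by (subst split, rule sum.union_disjoint) (use fin in \<open>auto simp: E_def\<close>)
    then show "(\<Sum>c\<in>{- int N..<b} - ptcls S. f (b - c)) =
        (\<Sum>c\<in>{- int N..<b}. f (b - c)) - (\<Sum>c\<in>{c\<in>E. c < b}. f (b - c))" by simp
  qed
  also have "\<dots> = (\<Sum>b\<in>E. \<Sum>c\<in>{- int N..<b}. f (b - c)) - (\<Sum>b\<in>E. \<Sum>c\<in>{c\<in>E. c < b}. f (b - c))"
    by (rule sum_subtractf)
  also have "(\<Sum>b\<in>E. \<Sum>c\<in>{c\<in>E. c < b}. f (b - c)) = P * Q - of_nat N"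
  proof -
    have "P * Q = (\<Sum>b\<in>E. \<Sum>c\<in>E. z powi (b - c))"
      unfolding P_def Q_def sum_product using z
      by (intro sum.cong refl) (simp add: power_int_diff power_int_divide_distrib)
    also have "\<dots> = (\<Sum>b\<in>E. (\<Sum>c\<in>E. if c < b then z powi (b - c) else 0) + 1 +
        (\<Sum>c\<in>E. if b < c then z powi (b - c) else 0))"
    proof (intro sum.cong refl)
      fix b assume b: "b \<in> E"
      have "(\<Sum>c\<in>E. z powi (b - c)) = (\<Sum>c\<in>E. (if c < b then z powi (b - c) else 0) +
          (if c = b then 1 else 0) + (if b < c then z powi (b - c) else 0))"
        by (intro sum.cong refl) auto
      then show "(\<Sum>c\<in>E. z powi (b - c)) = (\<Sum>c\<in>E. if c < b then z powi (b - c) else 0) + 1 +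
        (\<Sum>c\<in>E. if b < c then z powi (b - c) else 0)"
        using b fin by (simp add: sum.distrib)
    qed
    also have "\<dots> = (\<Sum>b\<in>E. \<Sum>c\<in>E. if c < b then z powi (b - c) else 0) + of_nat N +
        (\<Sum>b\<in>E. \<Sum>c\<in>E. if b < c then z powi (b - c) else 0)"
      by (simp add: sum.distrib cardE)
    also have "(\<Sum>b\<in>E. \<Sum>c\<in>E. if b < c then z powi (b - c) else 0) =
        (\<Sum>b\<in>E. \<Sum>c\<in>E. if c < b then (1 / z) powi (b - c) else 0)"
      using z by (subst sum.swap, intro sum.cong refl) (simp add: power_int_diff power_int_divide_distrib)
    finally have "P * Q - of_nat N = (\<Sum>b\<in>E. \<Sum>c\<in>E. if c < b then f (b - c) else 0)"
      by (simp add: f_def sum.distrib[symmetric] if_distrib cong: if_cong)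
    also have "\<dots> = (\<Sum>b\<in>E. \<Sum>c\<in>{c\<in>E. c < b}. f (b - c))"
      using fin by (intro sum.cong refl sum.inter_filter[symmetric])
    finally show ?thesis ..
  qed
  also have "(\<Sum>b\<in>E. \<Sum>c\<in>{- int N..<b}. f (b - c)) =
      (\<Sum>b\<in>E. z * (z powi (b + int N) - 1) / (z - 1) + 1 / z * ((1 / z) powi (b + int N) - 1) / (1 / z - 1))"
    by (intro sum.cong refl)
       (use sum_powi_below[OF z] sum_powi_below[OF z'] in \<open>auto simp: f_def sum.distrib E_def\<close>)
  also have "\<dots> = (z * (z ^ N * P - of_nat N)) / (z - 1) + (1 / z * (Q / z ^ N - of_nat N)) / (1 / z - 1)"
  proof -
    have 1: "(\<Sum>b\<in>E. z powi (b + int N)) = z ^ N * P" "(\<Sum>b\<in>E. (1 / z) powi (b + int N)) = Q / z ^ N"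
      unfolding P_def Q_def sum_distrib_left sum_divide_distrib
      using z by (auto intro!: sum.cong simp: power_int_add power_int_divide_distrib)
    have "(\<Sum>b\<in>E. z * (z powi (b + int N) - 1) / (z - 1)) = (z * ((\<Sum>b\<in>E. z powi (b + int N)) - of_nat N)) / (z - 1)"
      by (simp add: sum_divide_distrib[symmetric] sum_distrib_left[symmetric] sum_subtractf cardE)
    moreover have "(\<Sum>b\<in>E. 1 / z * ((1 / z) powi (b + int N) - 1) / (1 / z - 1)) =
        1 / z * ((\<Sum>b\<in>E. (1 / z) powi (b + int N)) - of_nat N) / (1 / z - 1)"
      unfolding sum_divide_distrib[symmetric] sum_distrib_left[symmetric] sum_subtractf by (simp add: cardE)
    ultimately show ?thesis unfolding sum.distrib 1 by simp
  qed
  finally have H: "(\<Sum>(s, s')\<in>hook_pairs S. f (s - s')) = (z * (z ^ N * P - of_nat N)) / (z - 1)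
      + (1 / z * (Q / z ^ N - of_nat N)) / (1 / z - 1) - (P * Q - of_nat N)" .
  have c1: "content_sum z S = z / (z - 1) * (P - (1 - 1 / z ^ N) / (z - 1))"
    using content_sum_window[OF z N] by (simp add: P_def E_def)
  have c2: "content_sum (1 / z) S = (1 / z) / (1 / z - 1) * (Q - (1 - z ^ N) / (1 / z - 1))"
    using content_sum_window[OF z' N] by (simp add: Q_def E_def power_one_over)
  have i: "1 / z - 1 = (1 - z) / z" "1 - z = - (z - 1)" using z by (simp_all add: field_simps)
  \<comment> \<open>What remains is a rational identity in z, Y = z^N, P and Q; with y as
    denominator it can be cleared and checked by expansion.\<close>
  define y where "y = z - 1"
  have y: "y \<noteq> 0" "z = y + 1" using z by (auto simp: y_def)
  define Y where "Y = z ^ N"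
  have Y: "Y \<noteq> 0" using z by (simp add: Y_def)
  have s: "(1 / z) / (- y / z) = - (1 / y)" "(1 - Y) / (- y / z) = - (z * (1 - Y) / y)"
    using z y by (simp_all add: field_simps)
  have "(z * (Y * P - of_nat N)) / y + (1 / z * (Q / Y - of_nat N)) / (- y / z) - (P * Q - of_nat N) =
     z / y * (P - (1 - 1 / Y) / y) + (- (1 / y)) * (Q + z * (1 - Y) / y) +
     y\<^sup>2 / z * (z / y * (P - (1 - 1 / Y) / y) * (- (1 / y) * (Q + z * (1 - Y) / y)))"
    using z(1) y Y by (simp add: divide_simps) (simp add: y(2) algebra_simps power2_eq_square)
  then show ?thesis
    unfolding H[unfolded f_def] c1 c2 i Y_def[symmetric] y_def[symmetric] s by simp
qed

section \<open>Central factorials and the expansion of z^h + z^(- h)\<close>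

definition square_falling :: "nat \<Rightarrow> 'a::field_char_0 \<Rightarrow> 'a" where
  "square_falling k x = (\<Prod>i=1..k. x\<^sup>2 - of_nat i ^ 2)"

lemma square_falling_0 [simp]: "square_falling 0 x = 1"
  and square_falling_Suc [simp]: "square_falling (Suc k) x = square_falling k x * (x\<^sup>2 - of_nat (Suc k) ^ 2)"
  by (simp_all add: square_falling_def)

lemma square_falling_eq_0: "0 < h \<Longrightarrow> h \<le> k \<Longrightarrow> square_falling k (of_nat h) = 0"
  unfolding square_falling_def by (rule prod_zero) (auto intro!: bexI[of _ h])

lemma square_falling_uminus [simp]: "square_falling k (- x) = square_falling k x"
  by (simp add: square_falling_def)

text \<open>\<open>x * square_falling k x\<close> is the product of the 2 k + 1 consecutive factors
  from x - k to x + k; replacing k by k + 1 and x by x + 1 appends two factors at the upper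
  end.\<close>

lemma square_falling_shift:
  "(x + 1)\<^sup>2 * square_falling (Suc k) (x + 1) =
     x * square_falling k x * (x + of_nat k + 1) * (x + 1) * (x + of_nat k + 2)"
proof (induction k)
  case (Suc k)
  have "(x + 1)\<^sup>2 * square_falling (Suc (Suc k)) (x + 1) =
      ((x + 1)\<^sup>2 * square_falling (Suc k) (x + 1)) * ((x + 1)\<^sup>2 - (of_nat k + 2)\<^sup>2)"
  proof -
    have "of_nat (Suc (Suc k)) = of_nat k + (2 :: 'a)" by simp
    then show ?thesis by (simp only: square_falling_Suc[of "Suc k"] mult.assoc)
  qed
  also have "\<dots> = x * square_falling (Suc k) x * (x + of_nat (Suc k) + 1) * (x + 1) * (x + of_nat (Suc k) + 2)"
    unfolding Suc by (simp add: algebra_simps power2_eq_square)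
  finally show ?case .
qed (simp add: algebra_simps power2_eq_square)

text \<open>\<open>square_falling\<close> is even, so the value at x - 1 follows from the shift
  formula at - x. The second central difference lowers the index, as differentiating twice does for
  even powers.\<close>

lemma square_falling_second_difference:
  "(x + 1)\<^sup>2 * square_falling (Suc k) (x + 1) + (x - 1)\<^sup>2 * square_falling (Suc k) (x - 1) =
     2 * (x\<^sup>2 * square_falling (Suc k) x) + of_nat ((2 * k + 3) * (2 * k + 4)) * (x\<^sup>2 * square_falling k x)"
proof -
  have "(x - 1)\<^sup>2 * square_falling (Suc k) (x - 1) = (- x + 1)\<^sup>2 * square_falling (Suc k) (- x + 1)"
  proof -
    have "x - 1 = - (- x + 1)" by simp
    then show ?thesis by (simp only: square_falling_uminus power2_minus)
  qed
  also have "\<dots> = - (x * square_falling k x * (- x + of_nat k + 1) * (- x + 1) * (- x + of_nat k + 2))"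
    unfolding square_falling_shift by simp
  finally show ?thesis
    unfolding square_falling_shift by (simp add: algebra_simps power2_eq_square)
qed

text \<open>The coefficient of w^k in z^x + z^(- x) for w = z - 2 + 1/z. With z = e^u this expands 2
  cosh(x u) in powers of (2 sinh(u/2))^2. The case k = 0 is separate, since k - 1 would
  truncate.\<close>

definition cosh_coeff :: "nat \<Rightarrow> 'a::field_char_0 \<Rightarrow> 'a" where
  "cosh_coeff k x = (if k = 0 then 2 else 2 / fact (2 * k) * (x\<^sup>2 * square_falling (k - 1) x))"

text \<open>Coefficientwise form of f (x + 1) + f (x - 1) = (w + 2) f x, which f x = z^x + z^(- x)
  satisfies.\<close>

lemma cosh_coeff_recurrence:
  "cosh_coeff (Suc k) (x + 1) + cosh_coeff (Suc k) (x - 1) =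
     2 * cosh_coeff (Suc k) x + (cosh_coeff k x :: 'a::field_char_0)"
proof (cases k)
  case 0
  then show ?thesis by (simp add: cosh_coeff_def algebra_simps power2_eq_square numeral_2_eq_2)
next
  case (Suc j)
  define M where "M = (of_nat ((2 * j + 3) * (2 * j + 4)) :: 'a)"
  define d where "d = (2 / fact (2 * Suc k) :: 'a)"
  have "M \<noteq> 0" unfolding M_def of_nat_eq_0_iff by simp
  moreover have "fact (2 * Suc k) = M * fact (2 * k)"
    unfolding Suc M_def by (simp add: algebra_simps)
  ultimately have d: "2 / fact (2 * k) = d * M"
    unfolding d_def by (simp del: mult_Suc_right fact_Suc)
  have "cosh_coeff (Suc k) (x + 1) + cosh_coeff (Suc k) (x - 1) =
      d * ((x + 1)\<^sup>2 * square_falling k (x + 1) + (x - 1)\<^sup>2 * square_falling k (x - 1))"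
    unfolding cosh_coeff_def d_def by (simp add: distrib_left)
  also have "\<dots> = d * (2 * (x\<^sup>2 * square_falling k x)) + (2 / fact (2 * k)) * (x\<^sup>2 * square_falling j x)"
    unfolding Suc square_falling_second_difference d[unfolded Suc] M_def by (simp only: distrib_left mult.assoc)
  also have "\<dots> = 2 * cosh_coeff (Suc k) x + cosh_coeff k x"
    unfolding cosh_coeff_def d_def Suc by simp
  finally show ?thesis .
qed

text \<open>The coefficients beyond h vanish. The free bound n \<ge> h allows a common truncation
  for all hooks of all partitions of one size.\<close>

lemma power_plus_inverse:
  fixes z :: "'a::field_char_0"
  assumes z: "z \<noteq> 0" and h: "h \<le> n"
  shows "z ^ h + (1 / z) ^ h = (\<Sum>k\<le>n. cosh_coeff k (of_nat h) * ((z - 1)\<^sup>2 / z) ^ k)"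
proof -
  define w where "w = (z - 1)\<^sup>2 / z"
  have w: "w + 2 = z + 1 / z" using z by (simp add: w_def field_simps power2_eq_square)
  have "h \<le> n \<Longrightarrow> z ^ h + (1 / z) ^ h = (\<Sum>k\<le>n. cosh_coeff k (of_nat h) * w ^ k)"
  proof (induction h rule: less_induct)
    case (less h)
    define g where "g h = (\<Sum>k\<le>n. cosh_coeff k (of_nat h) * w ^ k)" for h
    consider "h = 0" | "h = 1" | i where "h = Suc (Suc i)"
      by (metis One_nat_def not0_implies_Suc)
    then show ?case
    proof cases
      case 1
      have "g 0 = (\<Sum>k\<in>{0}. cosh_coeff k 0 * w ^ k)"
        unfolding g_def by (intro sum.mono_neutral_cong_right) (auto simp: cosh_coeff_def)
      then have "g 0 = 2" by (simp add: cosh_coeff_def)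
      then show ?thesis unfolding g_def[symmetric] 1 by simp
    next
      case 2
      have zero: "cosh_coeff k 1 = (0 :: 'a)" if "2 \<le> k" for k
        using square_falling_eq_0[of 1 "k - 1", where 'a = 'a] that by (simp add: cosh_coeff_def)
      have "g 1 = (\<Sum>k\<in>{0, 1}. cosh_coeff k 1 * w ^ k)"
        unfolding g_def using less.prems 2 zero
        by (intro sum.mono_neutral_cong_right) auto
      then have "g 1 = w + 2" by (simp add: cosh_coeff_def)
      then show ?thesis unfolding g_def[symmetric] 2 w by simp
    next
      case (3 i)
      obtain m where m: "n = Suc m" using less.prems 3 by (cases n) auto
      \<comment> \<open>As i + 1 < n, the top coefficient vanishes and the sum up to m is already
        all of \<open>g (Suc i)\<close>.\<close>
      have zero: "cosh_coeff n (of_nat (Suc i)) = (0 :: 'a)"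
        using square_falling_eq_0[of "Suc i" "n - 1", where 'a = 'a] less.prems 3
        by (auto simp: cosh_coeff_def simp del: of_nat_Suc)
      have rec: "cosh_coeff (Suc k) (of_nat (Suc (Suc i))) = 2 * cosh_coeff (Suc k) (of_nat (Suc i))
          + cosh_coeff k (of_nat (Suc i)) - (cosh_coeff (Suc k) (of_nat i) :: 'a)" for k
        using cosh_coeff_recurrence[of k "of_nat (Suc i) :: 'a"] by (simp add: algebra_simps)
      have "g (Suc (Suc i)) = 2 + (\<Sum>k\<le>m. cosh_coeff (Suc k) (of_nat (Suc (Suc i))) * w ^ Suc k)"
        unfolding g_def m sum.atMost_Suc_shift by (simp add: cosh_coeff_def)
      also have "\<dots> = 2 * (2 + (\<Sum>k\<le>m. cosh_coeff (Suc k) (of_nat (Suc i)) * w ^ Suc k))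
          + w * (\<Sum>k\<le>m. cosh_coeff k (of_nat (Suc i)) * w ^ k)
          - (2 + (\<Sum>k\<le>m. cosh_coeff (Suc k) (of_nat i) * w ^ Suc k))"
        unfolding rec by (simp add: sum.distrib sum_subtractf sum_distrib_left algebra_simps)
      also have "2 + (\<Sum>k\<le>m. cosh_coeff (Suc k) (of_nat (Suc i)) * w ^ Suc k) = g (Suc i)"
        unfolding g_def m sum.atMost_Suc_shift by (simp add: cosh_coeff_def)
      also have "2 + (\<Sum>k\<le>m. cosh_coeff (Suc k) (of_nat i) * w ^ Suc k) = g i"
        unfolding g_def m sum.atMost_Suc_shift by (simp add: cosh_coeff_def)
      also have "(\<Sum>k\<le>m. cosh_coeff k (of_nat (Suc i)) * w ^ k) = g (Suc i)"
        unfolding g_def using zero by (simp add: m)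
      also have "2 * g (Suc i) + w * g (Suc i) - g i = (w + 2) * g (Suc i) - g i"
        by (simp add: algebra_simps)
      also have "g (Suc i) = z ^ Suc i + (1 / z) ^ Suc i"
        using less.IH[of "Suc i"] less.prems 3 by (simp add: g_def)
      also have "g i = z ^ i + (1 / z) ^ i"
        using less.IH[of i] less.prems 3 by (simp add: g_def)
      also have "(w + 2) * (z ^ Suc i + (1 / z) ^ Suc i) - (z ^ i + (1 / z) ^ i) = z ^ h + (1 / z) ^ h"
        unfolding w 3 using z by (simp add: field_simps)
      finally show ?thesis by (simp add: g_def 3)
    qed
  qed
  with h show ?thesis by (simp add: w_def)
qed

text \<open>As a function of z, w takes the same value only at z and 1 / z, so the integers z \<ge>
  2 have distinct images.\<close>

lemma infinite_plus_inverse: "infinite (range (\<lambda>m :: nat. (of_nat (m + 2) - 1)\<^sup>2 / of_nat (m + 2) :: 'a::field_char_0))"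
proof (rule range_inj_infinite, rule injI)
  fix m n :: nat
  define x y where "x = m + 2" and "y = n + 2"
  assume "(of_nat (m + 2) - 1)\<^sup>2 / of_nat (m + 2) = ((of_nat (n + 2) - 1)\<^sup>2 / of_nat (n + 2) :: 'a)"
  then have *: "(of_nat x - 1)\<^sup>2 / of_nat x = ((of_nat y - 1)\<^sup>2 / of_nat y :: 'a)" by (simp only: x_def y_def)
  have "of_nat x \<noteq> (0 :: 'a)" "of_nat y \<noteq> (0 :: 'a)" unfolding x_def y_def by (simp_all only: of_nat_eq_0_iff)
  with * have "(of_nat x - 1)\<^sup>2 * of_nat y = ((of_nat y - 1)\<^sup>2 * of_nat x :: 'a)"
    by (simp add: frac_eq_eq)
  then have "(of_nat x - of_nat y) * (of_nat x * of_nat y - 1) = (0 :: 'a)"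
    by (simp add: algebra_simps power2_eq_square)
  then have "of_nat x = (of_nat y :: 'a) \<or> of_nat (x * y) = (of_nat 1 :: 'a)" by simp
  then have "x = y \<or> x * y = 1" by (simp only: of_nat_eq_iff)
  then show "m = n" by (auto simp: x_def y_def)
qed

text \<open>This identifies \<open>C\<close> with the coefficient in the second summand of
  \<open>hook_moment_cosh\<close>, up to the normalising factor of
  \<open>cosh_coeff\<close>.\<close>

lemma C_eq: "2 / fact (2 * k) * C k = (of_nat ((2 * k + 2) choose (k + 1)) / (fact (k + 1))\<^sup>2 :: 'a::field_char_0)"
proof -
  have central: "of_nat ((2 * k) choose k) = (fact (2 * k) / (fact k)\<^sup>2 :: 'a)"
    by (simp add: binomial_fact power2_eq_square)
  define a where "a = (of_nat k + 1 :: 'a)"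
  have a: "a \<noteq> 0" using of_nat_neq_0[of k, where 'a = 'a] by (simp add: a_def add.commute)
  have fact: "fact (k + 1) = a * fact k" by (simp add: a_def add.commute)
  show ?thesis
    unfolding C_def central fact a_def[symmetric] using a
    by (simp del: binomial_Suc_Suc add: divide_simps power2_eq_square)
qed

section \<open>Okada's average of hook lengths\<close>

definition hook_moment :: "nat \<Rightarrow> nat \<Rightarrow> 'a::field_char_0" where
  "hook_moment k n = (\<Sum>S\<in>level n. (inv_hook_prod S)\<^sup>2 * (\<Sum>(s, s')\<in>hook_pairs S. square_falling k (of_int (s - s'))))"

text \<open>The average of z^h + z^(- h), summed over the hooks, is a polynomial in w. Its
  coefficients are obtained once from the hooks by \<open>power_plus_inverse\<close> and once from
  the contents by \<open>sum_content_sums\<close>.\<close>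

lemma hook_moment_cosh:
  "(\<Sum>S\<in>level n. (inv_hook_prod S)\<^sup>2 * (\<Sum>(s, s')\<in>hook_pairs S. cosh_coeff k (of_int (s - s')))) =
    ((if k \<in> {1..n} then of_nat ((2 * k - 2) choose (k - 1)) / ((fact k)\<^sup>2 * fact (n - k)) else 0) +
     (if k < n then of_nat ((2 * k + 2) choose (k + 1)) / ((fact (k + 1))\<^sup>2 * fact (n - k - 1)) else 0) :: 'a::field_char_0)"
proof -
  define H where "H = (\<Union>S\<in>level n. (\<lambda>(s, s'). nat (s - s')) ` hook_pairs S)"
  have finH: "finite H" unfolding H_def using finite_level finite_hook_pairs by blast
  \<comment> \<open>An upper bound for all hooks of all partitions of n, enlarged so that the
    coefficient of index k lies in the range.\<close>
  define K where "K = n + k + Max (insert 0 H)"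
  have K: "nat (s - s') \<le> K" if "S \<in> level n" "(s, s') \<in> hook_pairs S" for S s s'
  proof -
    have "nat (s - s') \<in> H" unfolding H_def using that by force
    then have "nat (s - s') \<le> Max (insert 0 H)" using finH by (intro Max_ge) auto
    then show ?thesis by (simp add: K_def)
  qed
  define l where "l k = (\<Sum>S\<in>level n. (inv_hook_prod S :: 'a)\<^sup>2 * (\<Sum>(s, s')\<in>hook_pairs S. cosh_coeff k (of_int (s - s')))) " for k
  define a where "a k = (of_nat ((2 * k - 2) choose (k - 1)) / ((fact k)\<^sup>2 * fact (n - k)) :: 'a)" for k
  define b where "b k = (of_nat ((2 * k) choose k) / ((fact k)\<^sup>2 * fact (n - k)) :: 'a)" for k
  define p where "p = (\<Sum>k\<le>K. monom (l k) k)"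
  define q where "q = (\<Sum>k=1..n. monom (a k) k + monom (b k) (k - 1))"
  have pq: "poly p w = poly q w"
    if "w \<in> range (\<lambda>m :: nat. (of_nat (m + 2) - 1)\<^sup>2 / of_nat (m + 2))" for w
  proof -
    from that obtain m :: nat where "w = (of_nat (m + 2) - 1)\<^sup>2 / of_nat (m + 2)" by blast
    moreover define z where "z = (of_nat (m + 2) :: 'a)"
    ultimately have w: "w = (z - 1)\<^sup>2 / z" by simp
    have z: "z \<noteq> 0" "z \<noteq> 1"
      using of_nat_eq_iff[of "m + 2" 0, where 'a = 'a] of_nat_eq_iff[of "m + 2" 1, where 'a = 'a]
      unfolding z_def by auto
    have "poly p w = (\<Sum>k\<le>K. l k * w ^ k)" unfolding p_def poly_sum poly_monom ..
    also have "\<dots> = (\<Sum>k\<le>K. \<Sum>S\<in>level n. (inv_hook_prod S)\<^sup>2 * (\<Sum>(s, s')\<in>hook_pairs S. cosh_coeff k (of_int (s - s')) * w ^ k))"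
      unfolding l_def sum_distrib_right mult.assoc by (simp add: case_prod_unfold)
    also have "\<dots> = (\<Sum>S\<in>level n. (inv_hook_prod S)\<^sup>2 * (\<Sum>(s, s')\<in>hook_pairs S. \<Sum>k\<le>K. cosh_coeff k (of_int (s - s')) * w ^ k))"
    proof -
      have inner: "(\<Sum>(s, s')\<in>hook_pairs S. \<Sum>k\<le>K. cosh_coeff k (of_int (s - s')) * w ^ k) =
          (\<Sum>k\<le>K. \<Sum>(s, s')\<in>hook_pairs S. cosh_coeff k (of_int (s - s')) * w ^ k)" for S
        unfolding case_prod_unfold by (rule sum.swap)
      show ?thesis unfolding inner sum_distrib_left[where A = "{..K}"] by (rule sum.swap)
    qed
    also have "\<dots> = (\<Sum>S\<in>level n. (inv_hook_prod S)\<^sup>2 * (\<Sum>(s, s')\<in>hook_pairs S. z powi (s - s') + (1 / z) powi (s - s')))"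
    proof (intro sum.cong refl arg_cong[of _ _ "\<lambda>x. _ * x"])
      fix S x assume S: "S \<in> level n" and x: "x \<in> hook_pairs S"
      obtain s s' where ss: "x = (s, s')" by force
      define h where "h = nat (s - s')"
      have h: "s - s' = int h" "h \<le> K"
        using x K[OF S, of s s'] by (auto simp: ss hook_pairs_def h_def)
      show "(case x of (s, s') \<Rightarrow> \<Sum>k\<le>K. cosh_coeff k (of_int (s - s')) * w ^ k) =
          (case x of (s, s') \<Rightarrow> z powi (s - s') + (1 / z) powi (s - s'))"
        unfolding ss prod.case h(1) of_int_of_nat_eq w power_int_of_nat
        using power_plus_inverse[OF z(1) h(2)] by simp
    qed
    also have "\<dots> = (\<Sum>S\<in>level n. (inv_hook_prod S)\<^sup>2 *
        (w * (content_sum z S * content_sum (1 / z) S) + content_sum z S + content_sum (1 / z) S))"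
      by (intro sum.cong refl) (simp add: hook_sum_content_sum[OF z] level_def w)
    also have "\<dots> = poly q w"
      unfolding sum_content_sums[OF z, folded w] q_def poly_sum
      by (simp add: poly_monom a_def b_def add_divide_distrib mult.commute)
    finally show ?thesis .
  qed
  have "p = q"
  proof (rule ccontr)
    assume "p \<noteq> q"
    then have "finite {x. poly (p - q) x = 0}" by (intro poly_roots_finite) simp
    moreover have "range (\<lambda>m :: nat. (of_nat (m + 2) - 1)\<^sup>2 / of_nat (m + 2)) \<subseteq> {x. poly (p - q) x = 0}"
      using pq by auto
    ultimately show False using infinite_plus_inverse[where 'a = 'a] finite_subset by blast
  qed
  have "l k = coeff p k" unfolding p_def coeff_sum coeff_monom by (simp add: K_def)
  also have "\<dots> = (\<Sum>j=1..n. if j = k then a j else 0) + (\<Sum>j=1..n. if j - 1 = k then b j else 0)"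
    unfolding \<open>p = q\<close> q_def coeff_sum by (simp add: sum.distrib)
  also have "(\<Sum>j=1..n. if j - 1 = k then b j else 0) = (\<Sum>j=1..n. if j = Suc k then b j else 0)"
    by (intro sum.cong refl) auto
  finally show ?thesis by (auto simp: l_def a_def b_def)
qed

text \<open>Writing x^2 as (x^2 - (k + 1)^2) + (k + 1)^2, the average in
  \<open>hook_moment_cosh\<close> at k + 1 becomes a combination of the moments k + 1 and k. By
  induction the k-th moment cancels the first summand there, and \<open>C_eq\<close> reads the
  moment k + 1 off the second.\<close>

lemma hook_moment_eq:
  "hook_moment k n = (if k < n then C k / fact (n - k - 1) else 0 :: 'a::field_char_0)"
proof (induction k)
  case 0
  have "2 * hook_moment 0 n = (if 0 < n then 2 / fact (n - 1) else 0 :: 'a)"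
    using hook_moment_cosh[where n = n and k = 0 and 'a = 'a]
    by (simp add: hook_moment_def cosh_coeff_def case_prod_unfold sum_distrib_left mult_ac)
  then have "2 * hook_moment 0 n = 2 * (if 0 < n then 1 / fact (n - 1) else 0 :: 'a)" by simp
  then show ?case by (simp only: mult_cancel_left) (simp add: C_def)
next
  case (Suc k)
  define c where "c = (2 / fact (2 * Suc k) :: 'a)"
  have c: "c \<noteq> 0" unfolding c_def by (simp del: fact_Suc mult_Suc_right)
  have "(\<Sum>S\<in>level n. (inv_hook_prod S)\<^sup>2 * (\<Sum>(s, s')\<in>hook_pairs S. cosh_coeff (Suc k) (of_int (s - s')))) =
      c * (hook_moment (Suc k) n + of_nat (Suc k) ^ 2 * hook_moment k n)"
  proof -
    have "cosh_coeff (Suc k) x = c * (square_falling (Suc k) x + of_nat (Suc k) ^ 2 * square_falling k x)" for x :: 'a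
      unfolding cosh_coeff_def c_def by (simp add: algebra_simps)
    then show ?thesis
      unfolding hook_moment_def
      by (simp only: case_prod_unfold sum_distrib_left sum.distrib distrib_left mult_ac)
  qed
  note lhs = this
  have i: "2 * Suc k - 2 = 2 * k" "Suc k - 1 = k" by simp_all
  have step: "c * (hook_moment (Suc k) n + of_nat (Suc k) ^ 2 * hook_moment k n) =
    (if Suc k \<in> {1..n} then of_nat ((2 * k) choose k) / (fact (Suc k))\<^sup>2 / fact (n - Suc k) else 0) +
    (if Suc k < n then c * C (Suc k) / fact (n - Suc k - 1) else 0)"
    unfolding lhs[symmetric] hook_moment_cosh i divide_divide_eq_left[symmetric]
      C_eq[of "Suc k", where 'a = 'a, folded c_def, symmetric] ..
  have "c * of_nat (Suc k) ^ 2 * C k = (of_nat ((2 * k) choose k) / (fact (Suc k))\<^sup>2 :: 'a)"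
  proof -
    define F where "F = (fact (2 * Suc k) :: 'a)"
    define a where "a = (of_nat (Suc k) :: 'a)"
    have nz: "F \<noteq> 0" "a \<noteq> 0" unfolding F_def a_def by (rule fact_nonzero, rule of_nat_neq_0)
    have "of_nat ((2 * k + 2) choose (k + 1)) = (F / (fact (Suc k))\<^sup>2 :: 'a)"
      using binomial_fact[of "k + 1" "2 * k + 2", where 'a = 'a]
      by (simp add: power2_eq_square F_def del: binomial_Suc_Suc fact_Suc)
    moreover have "of_nat k + 1 = a" by (simp add: a_def)
    ultimately show ?thesis
      unfolding C_def c_def F_def[symmetric] a_def[symmetric] using nz by (simp del: fact_Suc)
  qed
  then have prev: "c * of_nat (Suc k) ^ 2 * hook_moment k n =
      (if Suc k \<in> {1..n} then of_nat ((2 * k) choose k) / (fact (Suc k))\<^sup>2 / fact (n - Suc k) else 0)"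
    unfolding Suc.IH by (cases "k < n") (simp_all only: if_True if_False, auto)
  have "c * hook_moment (Suc k) n = (if Suc k < n then c * C (Suc k) / fact (n - Suc k - 1) else 0)"
    using step unfolding distrib_left mult.assoc[symmetric] prev by simp
  then have "c * hook_moment (Suc k) n = c * (if Suc k < n then C (Suc k) / fact (n - Suc k - 1) else 0)"
    by simp
  then show ?case using c by (simp only: mult_cancel_left) simp
qed

section \<open>Self-conjugate partitions\<close>

context
  fixes l :: "nat list"
  assumes l: "l \<in> partitions"
begin

lemma part_antimono: "1 \<le> i \<Longrightarrow> i \<le> j \<Longrightarrow> part l j \<le> part l i"
  using l sorted_wrt_nth_less[of "(\<ge>)" l "i - 1" "j - 1"]
  by (cases "i = j") (auto simp: part_def partitions_def)

lemma part_pos_iff: "1 \<le> i \<Longrightarrow> 0 < part l i \<longleftrightarrow> i \<le> length l"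
  using l by (auto simp: part_def partitions_def)

lemma part_conjugate: "1 \<le> j \<Longrightarrow> part (conjugate l) j = card {i. 1 \<le> i \<and> j \<le> part l i}"
proof -
  assume j: "1 \<le> j"
  have "{i. 1 \<le> i \<and> i \<le> length l \<and> j \<le> part l i} = {i. 1 \<le> i \<and> j \<le> part l i}"
    using j part_pos_iff by fastforce
  moreover have "card {i. 1 \<le> i \<and> j \<le> part l i} = 0" if "j > part l 1"
  proof -
    have "{i. 1 \<le> i \<and> j \<le> part l i} = {}" using that part_antimono[of 1] by (force simp: not_le)
    then show ?thesis by (simp only: card.empty)
  qed
  moreover have len: "length (conjugate l) = part l 1" by (simp add: conjugate_def del: upt_Suc)
  moreover have "conjugate l ! (j - 1) = card {i. 1 \<le> i \<and> i \<le> length l \<and> j \<le> part l i}" if "j \<le> part l 1"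
    using j that by (cases j) (simp_all add: conjugate_def nth_append del: upt_Suc)
  ultimately show ?thesis
    using j unfolding part_def[of "conjugate l" j] by (cases "j \<le> part l 1") auto
qed

text \<open>Parts decrease, so the rows with at least j boxes form an initial segment, and its
  length is the j-th part of the conjugate.\<close>

lemma le_part_iff: "1 \<le> i \<Longrightarrow> 1 \<le> j \<Longrightarrow> j \<le> part l i \<longleftrightarrow> i \<le> part (conjugate l) j"
proof -
  assume i: "1 \<le> i" and j: "1 \<le> j"
  define I where "I = {i. 1 \<le> i \<and> j \<le> part l i}"
  have "I \<subseteq> {1..length l}" using part_pos_iff j by (fastforce simp: I_def)
  then have fin: "finite I" by (rule finite_subset) simp
  have "{1..i} \<subseteq> I" if "i \<in> I"
    using that part_antimono[of _ i] by (force simp: I_def)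
  then have "i \<le> card I" if "i \<in> I" using that card_mono[OF fin, of "{1..i}"] by simp
  moreover have "card I < i" if "i \<notin> I"
  proof -
    have "I \<subseteq> {1..<i}" using that part_antimono[OF i] i by (force simp: I_def not_le)
    then have "card I \<le> card {1..<i}" by (intro card_mono) auto
    then show ?thesis using i by simp
  qed
  ultimately show ?thesis unfolding part_conjugate[OF j] I_def[symmetric]
    using i by (auto simp: I_def not_le[symmetric])
qed

lemma conjugate_partition: "conjugate l \<in> partitions"
proof -
  have len: "length (conjugate l) = part l 1" by (simp add: conjugate_def del: upt_Suc)
  have nth: "conjugate l ! j = part (conjugate l) (Suc j)" if "j < part l 1" for j
    using that by (simp add: part_def len)
  have "sorted_wrt (\<ge>) (conjugate l)"
    unfolding sorted_wrt_iff_nth_less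
  proof (intro allI impI)
    fix i j assume ij: "i < j" "j < length (conjugate l)"
    have "part (conjugate l) (Suc j) \<le> part (conjugate l) (Suc i)"
    proof (cases "part (conjugate l) (Suc j)")
      case (Suc k)
      then have "Suc j \<le> part l (Suc k)" using le_part_iff[of "Suc k" "Suc j"] by simp
      then have "Suc i \<le> part l (Suc k)" using ij by simp
      then show ?thesis using le_part_iff[of "Suc k" "Suc i"] Suc by simp
    qed simp
    then show "conjugate l ! j \<le> conjugate l ! i" using ij by (simp add: nth len)
  qed
  moreover have "0 < p" if p: "p \<in> set (conjugate l)" for p
  proof -
    obtain j where j: "j < part l 1" "p = conjugate l ! j" using p by (metis in_set_conv_nth len)
    then have "Suc j \<le> part l 1" by simp
    then have "1 \<le> part (conjugate l) (Suc j)" using le_part_iff[of 1 "Suc j"] by simp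
    then show ?thesis using j nth by simp
  qed
  ultimately show ?thesis by (simp add: partitions_def)
qed

lemma diagram_eq: "diagram l = {(i, j). 1 \<le> i \<and> 1 \<le> j \<and> j \<le> part l i}"
  using part_pos_iff by (fastforce simp: diagram_def)

end

section \<open>Beta numbers\<close>

definition beta :: "nat list \<Rightarrow> nat \<Rightarrow> int" where
  "beta l i = int (part l i) - int i"

definition beta_set :: "nat list \<Rightarrow> int set" where
  "beta_set l = beta l ` {1..}"

lemma beta_strict: "l \<in> partitions \<Longrightarrow> 1 \<le> i \<Longrightarrow> i < j \<Longrightarrow> beta l j < beta l i"
  using part_antimono[of l i j] by (simp add: beta_def)

lemma inj_on_beta: "l \<in> partitions \<Longrightarrow> inj_on (beta l) {1..}"
proof (rule inj_onI)
  fix i j assume "l \<in> partitions" "i \<in> {1..}" "j \<in> {1..}" "beta l i = beta l j"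
  then show "i = j" using beta_strict[of l i j] beta_strict[of l j i] by (cases i j rule: linorder_cases) auto
qed

text \<open>Every unit step of the boundary path ends a row or a column, never both. A common
  position would mean that part i of l and part j of the conjugate add up to i + j - 1; by
  \<open>le_part_iff\<close> their sum is at least i + j or at most i + j - 2.\<close>

lemma beta_set_conjugate:
  assumes l: "l \<in> partitions"
  shows "m \<in> beta_set l \<longleftrightarrow> - 1 - m \<notin> beta_set (conjugate l)"
proof
  assume "m \<in> beta_set l"
  then obtain i where i: "1 \<le> i" "m = beta l i" by (auto simp: beta_set_def)
  show "- 1 - m \<notin> beta_set (conjugate l)"
  proof
    assume "- 1 - m \<in> beta_set (conjugate l)"
    then obtain j where j: "1 \<le> j" "- 1 - m = beta (conjugate l) j" by (auto simp: beta_set_def)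
    then show False using i le_part_iff[OF l i(1) j(1)] by (auto simp: beta_def)
  qed
next
  assume nin: "- 1 - m \<notin> beta_set (conjugate l)"
  show "m \<in> beta_set l"
  proof (rule ccontr)
    assume m: "m \<notin> beta_set l"
    let ?P = "\<lambda>i. 1 \<le> i \<and> beta l i \<le> m"
    have "?P (Suc (length l + nat (- m)))" by (auto simp: beta_def part_def)
    then have ex: "\<exists>i. ?P i" by blast
    define i where "i = (LEAST i. ?P i)"
    have i: "1 \<le> i" "beta l i \<le> m" using LeastI_ex[OF ex] by (auto simp: i_def)
    have lt: "beta l i < m" using i m by (force simp: beta_set_def)
    have prev: "m < beta l i'" if "1 \<le> i'" "i' < i" for i'
      using not_less_Least[of i' ?P] that unfolding i_def by auto
    \<comment> \<open>Row i is the first one whose beta number lies below m. The column that ends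
      between rows i - 1 and i at this position has length i - 1, and its beta number is - 1 - m
      exactly for j = m + i.\<close>
    define j where "j = nat (m + int i)"
    have j: "1 \<le> j" "int j = m + int i" using lt by (auto simp: j_def beta_def)
    have "\<not> j \<le> part l i" using lt j by (simp add: beta_def)
    then have "part (conjugate l) j < i" using le_part_iff[OF l i(1) j(1)] by simp
    moreover have "i - 1 \<le> part (conjugate l) j"
    proof (cases "i = 1")
      case False
      then have "m < beta l (i - 1)" using prev[of "i - 1"] i by simp
      then have "j \<le> part l (i - 1)" using j i by (simp add: beta_def)
      then show ?thesis using le_part_iff[OF l _ j(1), of "i - 1"] i False by simp
    qed simp
    ultimately have "beta (conjugate l) j = - 1 - m" using j i by (simp add: beta_def)
    moreover have "beta (conjugate l) j \<in> beta_set (conjugate l)" using j by (simp add: beta_set_def)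
    ultimately show False using nin by simp
  qed
qed

text \<open>The i-th beta number is recovered as the element with exactly i - 1 larger ones; the
  length is then the number of positive parts.\<close>

lemma beta_set_inject:
  assumes "l \<in> partitions" "l' \<in> partitions" "beta_set l = beta_set l'"
  shows "l = l'"
proof -
  have above: "card {m \<in> beta_set l. beta l i < m} = i - 1" if l: "l \<in> partitions" and i: "1 \<le> i" for l i
  proof -
    have "{m \<in> beta_set l. beta l i < m} = beta l ` {1..<i}"
    proof (intro set_eqI iffI)
      fix m assume "m \<in> {m \<in> beta_set l. beta l i < m}"
      then obtain j where "1 \<le> j" "m = beta l j" "beta l i < beta l j" by (auto simp: beta_set_def)
      then show "m \<in> beta l ` {1..<i}"
        using beta_strict[OF l i, of j] by (cases i j rule: linorder_cases) auto
    qed (use beta_strict[OF l _, of _ i] i in \<open>auto simp: beta_set_def\<close>)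
    moreover have "inj_on (beta l) {1..<i}" using inj_on_beta[OF l] by (rule inj_on_subset) auto
    ultimately show ?thesis by (simp add: card_image)
  qed
  have eq: "part l i = part l' i" if i: "1 \<le> i" for i
  proof -
    have "beta l i \<in> beta_set l'" using i assms(3) by (auto simp: beta_set_def)
    then obtain j where j: "1 \<le> j" "beta l i = beta l' j" by (auto simp: beta_set_def)
    then have "i - 1 = j - 1" using above[OF assms(1) i] above[OF assms(2) j(1)] assms(3) by simp
    then have "i = j" using i j(1) by linarith
    then show ?thesis using j by (simp add: beta_def)
  qed
  have le: "length l \<le> length l'" if "l \<in> partitions" "l' \<in> partitions" "\<And>i. 1 \<le> i \<Longrightarrow> part l i = part l' i" for l l'
    using part_pos_iff[OF that(1), of "length l"] part_pos_iff[OF that(2), of "length l"] that(3)[of "length l"]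
    by (cases "length l") auto
  have len: "length l = length l'" using le[OF assms(1,2) eq] le[OF assms(2,1) eq[symmetric]] by simp
  show ?thesis
  proof (rule nth_equalityI[OF len])
    fix i assume "i < length l"
    then show "l ! i = l' ! i" using eq[of "Suc i"] len by (simp add: part_def)
  qed
qed

lemma beta_set_window:
  assumes "l \<in> partitions"
  shows "beta_set l \<inter> {- int (length l)..} = beta l ` {1..length l}" "{..<- int (length l)} \<subseteq> beta_set l"
proof -
  have low: "beta l i = - int i" if "i > length l" for i using that by (simp add: beta_def part_def)
  have high: "beta l i \<ge> - int (length l)" if "i \<le> length l" for i using that by (simp add: beta_def)
  show "beta_set l \<inter> {- int (length l)..} = beta l ` {1..length l}"
    using low high by (force simp: beta_set_def not_le[symmetric])
  show "{..<- int (length l)} \<subseteq> beta_set l"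
  proof
    fix m assume "m \<in> {..<- int (length l)}"
    then show "m \<in> beta_set l"
      unfolding beta_set_def by (intro image_eqI[of _ _ "nat (- m)"]) (auto simp: low)
  qed
qed

section \<open>The Maya diagram of a partition and its statistics\<close>

definition maya_of :: "nat list \<Rightarrow> maya" where
  "maya_of l = Maya (beta_set l)"

lemma ptcls_maya_of:
  assumes "l \<in> partitions"
  shows "ptcls (maya_of l) = beta_set l"
proof -
  note w = beta_set_window[OF assms]
  have "finite (beta_set l \<inter> {0..})"
  proof (rule finite_subset)
    show "beta_set l \<inter> {0..} \<subseteq> beta l ` {1..length l}" unfolding w(1)[symmetric] by auto
  qed simp
  moreover have "finite ({..<0} - beta_set l)"
  proof (rule finite_subset)
    show "{..<0} - beta_set l \<subseteq> {- int (length l)..<0}"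
    proof
      fix x assume x: "x \<in> {..<0} - beta_set l"
      then have "\<not> x < - int (length l)" using w(2) by blast
      then show "x \<in> {- int (length l)..<0}" using x by simp
    qed
  qed simp
  ultimately show ?thesis unfolding maya_of_def by (intro Maya_inverse) simp
qed

lemma reg_sum_maya_of:
  assumes l: "l \<in> partitions"
  shows "reg_sum g (maya_of l) = (\<Sum>i=1..length l. g (beta l i) - g (- int i))"
proof -
  have "inj_on (beta l) {1..length l}" using inj_on_beta[OF l] by (rule inj_on_subset) auto
  then have "sum g (beta l ` {1..length l}) = (\<Sum>i=1..length l. g (beta l i))"
    by (simp add: sum.reindex)
  moreover have "sum g {- int (length l)..<0} = (\<Sum>i=1..length l. g (- int i))"
    by (rule sum.reindex_bij_witness[of _ "\<lambda>i. - int i" "\<lambda>s. nat (- s)"]) auto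
  ultimately show ?thesis
    using reg_sum_window[of "length l" "maya_of l" g] beta_set_window[OF l]
    by (simp add: ptcls_maya_of[OF l] sum_subtractf)
qed

lemma energy_maya_of:
  assumes l: "l \<in> partitions"
  shows "energy (maya_of l) = int (sum_list l)"
proof -
  have "energy (maya_of l) = (\<Sum>i=1..length l. int (part l i))"
    by (simp add: energy_def reg_sum_maya_of[OF l] beta_def)
  also have "\<dots> = (\<Sum>i<length l. int (l ! i))"
    by (rule sum.reindex_bij_witness[of _ Suc "\<lambda>i. i - 1"]) (auto simp: part_def)
  finally show ?thesis by (simp add: sum_list_sum_nth atLeast0LessThan)
qed

definition parity_sign :: "int \<Rightarrow> int" where
  "parity_sign s = (if even s then 1 else - 1)"

text \<open>Along a row the alternating signs telescope: twice their sum is the difference of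
  \<open>parity_sign\<close> at the beta number and at - i.\<close>

lemma BG_rank_maya_of:
  assumes l: "l \<in> partitions"
  shows "2 * BG_rank l = reg_sum parity_sign (maya_of l)"
proof -
  have "diagram l = (SIGMA i:{1..length l}. {1..part l i})"
    by (auto simp: diagram_def)
  then have "BG_rank l = (\<Sum>i=1..length l. \<Sum>j=1..part l i. (- 1) ^ (i + j))"
    unfolding BG_rank_def by (simp add: sum.Sigma)
  moreover have "2 * (\<Sum>j=1..p. (- 1) ^ (i + j)) = parity_sign (int p - int i) - parity_sign (- int i)" for p i :: nat
    by (induction p) (auto simp: parity_sign_def)
  ultimately show ?thesis
    by (simp add: reg_sum_maya_of[OF l] beta_def sum_distrib_left)
qed

section \<open>Self-conjugate partitions as self-dual diagrams\<close>

definition self_dual :: "maya set" where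
  "self_dual = {S. \<forall>m. m \<in> ptcls S \<longleftrightarrow> - 1 - m \<notin> ptcls S}"

text \<open>At charge 0 the window contains exactly N particles. In decreasing order, with the row
  numbers added, they give N weakly decreasing numbers, from which the trailing zeros are cut off to
  obtain positive parts.\<close>

lemma maya_of_surj:
  assumes S: "charge S = 0"
  obtains l where "l \<in> partitions" "maya_of l = S"
proof -
  obtain N where N: "{..<- int N} \<subseteq> ptcls S" by (rule window_exists)
  define E where "E = ptcls S \<inter> {- int N..}"
  have fin: "finite E" unfolding E_def by (rule finite_window)
  have cardE: "card E = N" using S unfolding charge_def reg_sum_window[OF N] E_def by simp
  define xs where "xs = rev (sorted_list_of_set E)"
  have xs: "length xs = N" "set xs = E" "sorted_wrt (>) xs"
    using fin cardE by (auto simp: xs_def sorted_wrt_rev strict_sorted_list_of_set)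
  \<comment> \<open>The list is indexed from 0, so the row number is i + 1.\<close>
  define p where "p i = nat (xs ! i + int i + 1)" for i
  have lower: "xs ! i \<ge> - int i - 1" if "i < N" for i
  proof -
    have "xs ! (N - 1 - k) \<ge> int k - int N" if "k < N" for k
      using that
    proof (induction k)
      case 0
      then have "xs ! (N - 1) \<in> E" using xs by (metis One_nat_def diff_less less_numeral_extra(1) nth_mem)
      then show ?case by (simp add: E_def)
    next
      case (Suc k)
      have "xs ! (N - 1 - k) < xs ! (N - 1 - Suc k)"
        using xs Suc.prems by (intro sorted_wrt_nth_less[OF xs(3)]) auto
      then show ?case using Suc by simp
    qed
    from this[of "N - 1 - i"] that show ?thesis by (simp add: of_nat_diff)
  qed
  have p: "int (p i) = xs ! i + int i + 1" if "i < N" for i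
    using lower[OF that] by (simp add: p_def)
  have p_anti: "p j \<le> p i" if "i < j" "j < N" for i j
  proof -
    have step: "xs ! (i + k) + int k \<le> xs ! i" if "i + k < N" for k
      using that
    proof (induction k)
      case (Suc k)
      have "xs ! (i + Suc k) < xs ! (i + k)"
        using xs Suc.prems by (intro sorted_wrt_nth_less[OF xs(3)]) auto
      then show ?case using Suc by simp
    qed simp
    have "int (p j) \<le> int (p i)" using step[of "j - i"] that p[of i] p[of j] by simp
    then show ?thesis by simp
  qed
  define M where "M = card {i. i < N \<and> 0 < p i}"
  have M: "i < M \<longleftrightarrow> 0 < p i" if "i < N" for i
  proof -
    let ?I = "{i. i < N \<and> 0 < p i}"
    have fin: "finite ?I" by simp
    show ?thesis
    proof
      assume "0 < p i"
      then have "k < N \<and> 0 < p k" if "k \<le> i" for k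
        using p_anti[of k i] \<open>i < N\<close> that by (cases "k = i") auto
      then have "{..i} \<subseteq> ?I" by auto
      then have "card {..i} \<le> M" unfolding M_def by (rule card_mono[OF fin])
      then show "i < M" by simp
    next
      assume i: "i < M"
      show "0 < p i"
      proof (rule ccontr)
        assume "\<not> 0 < p i"
        then have "k < i" if "k < N" "0 < p k" for k
          using p_anti[of i k] that by (cases i k rule: linorder_cases) auto
        then have "?I \<subseteq> {..<i}" by auto
        then have "M \<le> card {..<i}" unfolding M_def by (intro card_mono) auto
        then show False using i by simp
      qed
    qed
  qed
  have MN: "M \<le> N" unfolding M_def by (rule order.trans[OF card_mono[of "{..<N}"]]) auto
  define l where "l = map p [0..<M]"
  have l: "l \<in> partitions"
  proof -
    have "sorted_wrt (\<ge>) l"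
      unfolding l_def sorted_wrt_map unfolding sorted_wrt_iff_nth_less using MN p_anti by auto
    moreover have "0 < p k" if "k < M" for k using M[of k] MN that by simp
    ultimately show ?thesis by (auto simp: partitions_def l_def)
  qed
  have part_l: "int (part l i) = xs ! (i - 1) + int i" if "1 \<le> i" "i \<le> N" for i
  proof -
    obtain k where k: "i = Suc k" "k < N" using \<open>1 \<le> i\<close> \<open>i \<le> N\<close> by (cases i) auto
    show ?thesis using M[OF k(2)] p[OF k(2)] by (auto simp: k(1) part_def l_def)
  qed
  have "beta_set l = ptcls S"
  proof -
    have 1: "beta l ` {1..N} = E"
    proof -
      have "beta l ` {1..N} = (\<lambda>i. xs ! i) ` {..<N}"
        using part_l by (force simp: beta_def image_iff Bex_def)
      also have "\<dots> = E" using xs by (auto simp: set_conv_nth)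
      finally show ?thesis .
    qed
    have 2: "beta l ` {N<..} = {..<- int N}"
    proof -
      have "beta l i = - int i" if "i > N" for i using that MN by (simp add: beta_def part_def l_def)
      then have "beta l ` {N<..} = (\<lambda>i. - int i) ` {N<..}" by (intro image_cong) auto
      also have "\<dots> = {..<- int N}"
        by (auto intro!: image_eqI[of _ _ "nat (- _)"])
      finally show ?thesis .
    qed
    have "{1..} = {1..N} \<union> {N<..}" by auto
    then have "beta_set l = E \<union> {..<- int N}" unfolding beta_set_def image_Un[symmetric] 1[symmetric] 2[symmetric] by simp
    then show ?thesis using N by (auto simp: E_def)
  qed
  then have "maya_of l = S" by (intro maya_eqI) (simp add: ptcls_maya_of[OF l])
  with l show ?thesis by (rule that)
qed

lemma bij_betw_self_dual: "bij_betw maya_of self_conjugate self_dual"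
  unfolding bij_betw_def
proof
  show "inj_on maya_of self_conjugate"
  proof (rule inj_onI)
    fix l l' assume "l \<in> self_conjugate" "l' \<in> self_conjugate" and eq: "maya_of l = maya_of l'"
    then have p: "l \<in> partitions" "l' \<in> partitions" by (auto simp: self_conjugate_def)
    have "beta_set l = beta_set l'" using eq ptcls_maya_of[OF p(1)] ptcls_maya_of[OF p(2)] by simp
    then show "l = l'" by (rule beta_set_inject[OF p])
  qed
  show "maya_of ` self_conjugate = self_dual"
  proof (intro set_eqI iffI)
    fix S assume "S \<in> maya_of ` self_conjugate"
    then obtain l where l: "l \<in> partitions" "conjugate l = l" "S = maya_of l" by (auto simp: self_conjugate_def)
    show "S \<in> self_dual"
      unfolding self_dual_def l(3) mem_Collect_eq ptcls_maya_of[OF l(1)]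
      using beta_set_conjugate[OF l(1), unfolded l(2)] by (rule allI)
  next
    fix S assume S: "S \<in> self_dual"
    then have mem: "m \<in> ptcls S \<longleftrightarrow> - 1 - m \<notin> ptcls S" for m unfolding self_dual_def mem_Collect_eq by (rule spec)
    \<comment> \<open>The reflection at - 1/2 exchanges nonnegative particles with negative holes,
      so self-duality forces charge 0.\<close>
    have "card (ptcls S \<inter> {0..}) = card ({..<0} - ptcls S)"
    proof (rule bij_betw_same_card[of "\<lambda>m. - 1 - m"], rule bij_betw_byWitness[of _ "\<lambda>m. - 1 - m"])
      show "(\<lambda>m. - 1 - m) ` (ptcls S \<inter> {0..}) \<subseteq> {..<0} - ptcls S"
      proof (rule image_subsetI)
        fix m assume "m \<in> ptcls S \<inter> {0..}"
        then show "- 1 - m \<in> {..<0} - ptcls S" using mem[of m] by simp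
      qed
      show "(\<lambda>m. - 1 - m) ` ({..<0} - ptcls S) \<subseteq> ptcls S \<inter> {0..}"
      proof (rule image_subsetI)
        fix m assume "m \<in> {..<0} - ptcls S"
        then show "- 1 - m \<in> ptcls S \<inter> {0..}" using mem[of m] by simp
      qed
    qed auto
    then have "charge S = 0" by (simp add: charge_def reg_sum_def)
    then obtain l where l: "l \<in> partitions" "maya_of l = S" by (rule maya_of_surj)
    have "beta_set (conjugate l) = beta_set l"
    proof (rule set_eqI)
      fix m :: int
      have "- 1 - (- 1 - m) = m" by linarith
      then show "m \<in> beta_set (conjugate l) \<longleftrightarrow> m \<in> beta_set l"
        using beta_set_conjugate[OF l(1), of "- 1 - m"] mem[of m] ptcls_maya_of[OF l(1)] l(2) by simp
    qed
    then have "conjugate l = l" using beta_set_inject[OF conjugate_partition[OF l(1)] l(1)] by simp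
    then show "S \<in> maya_of ` self_conjugate" using l by (auto simp: self_conjugate_def)
  qed
qed

text \<open>As rows and columns have the same lengths, the box (i, j) corresponds to the particle
  \<open>beta l i\<close> and the hole \<open>- 1 - beta l j\<close>, whose difference is its hook
  length.\<close>

lemma hooks_maya_of:
  assumes l: "l \<in> self_conjugate"
  shows "hooks t l = image_mset (\<lambda>(s, s'). nat (s - s')) (mset_set {(s, s') \<in> hook_pairs (maya_of l). int t dvd s - s'})"
proof -
  have lp: "l \<in> partitions" "conjugate l = l" using l by (auto simp: self_conjugate_def)
  define f where "f = (\<lambda>(i, j). (beta l i, - 1 - beta l j))"
  have diag: "diagram l = {(i, j). 1 \<le> i \<and> 1 \<le> j \<and> j \<le> part l i}" by (rule diagram_eq[OF lp(1)])
  have sym: "j \<le> part l i \<longleftrightarrow> i \<le> part l j" if "1 \<le> i" "1 \<le> j" for i j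
    using le_part_iff[OF lp(1) that] lp(2) by simp
  have hook: "int (hook_length l (i, j)) = beta l i - (- 1 - beta l j)" if "(i, j) \<in> diagram l" for i j
    using that sym[of i j] by (simp add: diag hook_length_def beta_def lp(2))
  have inj: "inj_on f (diagram l)"
    using inj_on_beta[OF lp(1)] by (auto simp: inj_on_def f_def diag)
  have img: "f ` diagram l = hook_pairs (maya_of l)"
  proof (intro set_eqI iffI)
    fix x assume "x \<in> f ` diagram l"
    then obtain i j where ij: "(i, j) \<in> diagram l" "x = (beta l i, - 1 - beta l j)" by (auto simp: f_def)
    have pos: "1 \<le> i" "1 \<le> j" using ij by (auto simp: diag)
    have "- 1 - beta l j \<notin> beta_set l"
      using beta_set_conjugate[OF lp(1), of "beta l j"] pos lp(2) by (auto simp: beta_set_def)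
    moreover have "- 1 - beta l j < beta l i" using hook[OF ij(1)] by (simp add: hook_length_def)
    ultimately show "x \<in> hook_pairs (maya_of l)"
      using pos by (auto simp: hook_pairs_def ij ptcls_maya_of[OF lp(1)] beta_set_def)
  next
    fix x assume x: "x \<in> hook_pairs (maya_of l)"
    obtain s s' where ss: "x = (s, s')" by force
    have *: "s \<in> beta_set l" "s' \<notin> beta_set l" "s' < s"
      using x by (auto simp: ss hook_pairs_def ptcls_maya_of[OF lp(1)])
    then have "- 1 - s' \<in> beta_set l" using beta_set_conjugate[OF lp(1), of s'] lp(2) by simp
    with * obtain i j where ij: "1 \<le> i" "1 \<le> j" "s = beta l i" "- 1 - s' = beta l j"
      by (auto simp: beta_set_def)
    then have "j \<le> part l i" using * sym[of i j] by (auto simp: beta_def)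
    then show "x \<in> f ` diagram l"
      using ij by (auto simp: ss diag f_def intro!: image_eqI[of _ _ "(i, j)"])
  qed
  have eq: "hook_length l x = (\<lambda>(s, s'). nat (s - s')) (f x)" if "x \<in> diagram l" for x
    using hook[of "fst x" "snd x"] that by (auto simp: f_def case_prod_unfold)
  have fin: "finite (diagram l)" using img inj finite_hook_pairs by (metis finite_imageD)
  have "image_mset (hook_length l) (mset_set (diagram l)) =
      image_mset (\<lambda>(s, s'). nat (s - s')) (image_mset f (mset_set (diagram l)))"
    unfolding multiset.map_comp
    by (intro image_mset_cong) (use eq fin in \<open>auto simp: comp_def\<close>)
  also have "image_mset f (mset_set (diagram l)) = mset_set (hook_pairs (maya_of l))"
    using inj by (simp add: image_mset_mset_set img)
  finally have "hooks t l = filter_mset (\<lambda>h. t dvd h) (image_mset (\<lambda>(s, s'). nat (s - s')) (mset_set (hook_pairs (maya_of l))))"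
    by (simp add: hooks_def)
  also have "\<dots> = image_mset (\<lambda>(s, s'). nat (s - s')) (filter_mset (\<lambda>(s, s'). int t dvd s - s') (mset_set (hook_pairs (maya_of l))))"
    unfolding filter_mset_image_mset
    by (intro arg_cong[of _ _ "image_mset _"] filter_mset_cong refl)
       (use finite_hook_pairs in \<open>auto simp: hook_pairs_def nat_dvd_iff int_dvd_int_iff[symmetric] simp del: int_dvd_int_iff\<close>)
  finally show ?thesis
    using finite_hook_pairs by (simp add: filter_mset_mset_set case_prod_unfold)
qed

section \<open>The Littlewood decomposition\<close>

lemma div_mod_lincomb:
  assumes "i < t"
  shows "(int t * m + int i) div int t = m" "(int t * m + int i) mod int t = int i"
  using assms by (simp_all add: div_pos_pos_trivial mod_pos_pos_trivial)

lemma lincomb_nonneg_iff: "i < t \<Longrightarrow> 0 \<le> int t * m + int i \<longleftrightarrow> 0 \<le> m"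
  using div_mod_lincomb(1)[of i t m] by (metis add_nonneg_nonneg mult_nonneg_nonneg of_nat_0_le_iff
      order.strict_trans1 pos_imp_zdiv_nonneg_iff zero_le of_nat_0_less_iff)

lemma lincomb_less_iff: "0 < t \<Longrightarrow> int t * m + int i < int t * m' + int i \<longleftrightarrow> m < m'"
  by simp

text \<open>The i-th runner of the t-abacus with its own charge. The charges encode the t-core, the
  runners up to charge the t-quotient.\<close>

definition quot_comp :: "nat \<Rightarrow> nat \<Rightarrow> maya \<Rightarrow> maya" where
  "quot_comp t i S = Maya {m. int t * m + int i \<in> ptcls S}"

lemma ptcls_quot_comp:
  assumes "i < t"
  shows "ptcls (quot_comp t i S) = {m. int t * m + int i \<in> ptcls S}"
proof -
  let ?T = "{m. int t * m + int i \<in> ptcls S}"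
  let ?f = "\<lambda>m. int t * m + int i"
  have inj: "inj_on ?f A" for A using assms by (auto simp: inj_on_def)
  have "finite (?T \<inter> {0..})"
    by (rule finite_imageD[OF _ inj], rule finite_subset[OF _ finite_ptcls[of S]])
       (use assms in auto)
  moreover have "finite ({..<0} - ?T)"
    by (rule finite_imageD[OF _ inj], rule finite_subset[OF _ finite_holes[of S]])
       (use lincomb_nonneg_iff[OF assms] in \<open>auto simp: not_le[symmetric]\<close>)
  ultimately show ?thesis unfolding quot_comp_def by (intro Maya_inverse) simp
qed

lemma sum_residues:
  assumes t: "0 < t" and A: "\<And>i. i < t \<Longrightarrow> A' i = {m. int t * m + int i \<in> A}" and fin: "finite A"
  shows "sum g A = (\<Sum>i<t. \<Sum>m\<in>A' i. g (int t * m + int i))"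
proof -
  have finA': "finite (A' i)" if i: "i < t" for i
  proof (rule finite_imageD)
    show "finite ((\<lambda>m. int t * m + int i) ` A' i)"
      using A[OF i] by (auto intro: finite_subset[OF _ fin])
    show "inj_on (\<lambda>m. int t * m + int i) (A' i)" using t by (auto simp: inj_on_def)
  qed
  have "sum g A = (\<Sum>(i, m)\<in>(SIGMA i:{..<t}. A' i). g (int t * m + int i))"
  proof (rule sum.reindex_bij_witness[of _ "\<lambda>(i, m). int t * m + int i" "\<lambda>s. (nat (s mod int t), s div int t)"])
    fix s assume s: "s \<in> A"
    have lt: "nat (s mod int t) < t" using t by (simp add: nat_less_iff)
    have eq: "int t * (s div int t) + int (nat (s mod int t)) = s" using t by simp
    then show "(case (nat (s mod int t), s div int t) of (i, m) \<Rightarrow> int t * m + int i) = s" by simp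
    show "(nat (s mod int t), s div int t) \<in> (SIGMA i:{..<t}. A' i)"
      using s lt eq by (simp add: A)
    show "(case (nat (s mod int t), s div int t) of (i, m) \<Rightarrow> g (int t * m + int i)) = g s"
      using eq by simp
  qed (auto simp: A div_mod_lincomb)
  also have "\<dots> = (\<Sum>i<t. \<Sum>m\<in>A' i. g (int t * m + int i))"
    by (rule sum.Sigma[symmetric]) (auto simp: finA')
  finally show ?thesis .
qed

lemma reg_sum_quot_comp:
  assumes t: "0 < t"
  shows "reg_sum g S = (\<Sum>i<t. reg_sum (\<lambda>m. g (int t * m + int i)) (quot_comp t i S))"
  unfolding reg_sum_def sum_subtractf
  using lincomb_nonneg_iff[of _ t]
  by (intro arg_cong2[of _ _ _ _ minus] sum_residues t)
     (auto simp: ptcls_quot_comp finite_ptcls finite_holes not_le[symmetric])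

text \<open>A difference of two positions is divisible by t exactly when they lie on the same
  runner, and along the runner it appears divided by t.\<close>

lemma hook_pairs_quot_comp:
  assumes t: "0 < t"
  shows "bij_betw (\<lambda>(i, m, m'). (int t * m + int i, int t * m' + int i))
    (SIGMA i:{..<t}. hook_pairs (quot_comp t i S)) {(s, s') \<in> hook_pairs S. int t dvd s - s'}"
proof (rule bij_betw_byWitness[where f' = "\<lambda>(s, s'). (nat (s mod int t), s div int t, s' div int t)"])
  let ?f = "\<lambda>(i, m, m'). (int t * m + int i, int t * m' + int i)"
  let ?g = "\<lambda>(s, s'). (nat (s mod int t), s div int t, s' div int t)"
  let ?A = "SIGMA i:{..<t}. hook_pairs (quot_comp t i S)" and ?B = "{(s, s') \<in> hook_pairs S. int t dvd s - s'}"
  show "\<forall>a\<in>?A. ?g (?f a) = a" by (auto simp: div_mod_lincomb)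
  have unsplit: "int t * (s div int t) + int (nat (s mod int t)) = s \<and> int t * (s' div int t) + int (nat (s mod int t)) = s'"
    if "int t dvd s - s'" for s s'
  proof -
    have "s' mod int t = s mod int t" using that by (metis mod_eq_dvd_iff)
    then show ?thesis using t by (metis mult_div_mod_eq int_nat_eq of_nat_0_less_iff pos_mod_sign)
  qed
  show "\<forall>b\<in>?B. ?f (?g b) = b" using unsplit by auto
  show "?f ` ?A \<subseteq> ?B"
    using t by (auto simp: hook_pairs_def ptcls_quot_comp right_diff_distrib[symmetric])
  show "?g ` ?B \<subseteq> ?A"
  proof (rule image_subsetI)
    fix b assume b: "b \<in> ?B"
    obtain s s' where ss: "b = (s, s')" by force
    define i where "i = nat (s mod int t)"
    have i: "i < t" using t by (simp add: i_def nat_less_iff)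
    have *: "int t * (s div int t) + int i = s" "int t * (s' div int t) + int i = s'"
      using unsplit[of s s'] b unfolding i_def ss by auto
    have "s' < s" using b by (simp add: ss hook_pairs_def)
    then have "s' div int t < s div int t" using lincomb_less_iff[OF t, of "s' div int t" i "s div int t"] * by simp
    then show "?g b \<in> ?A"
      using b i * by (auto simp: ss hook_pairs_def ptcls_quot_comp i_def[symmetric])
  qed
qed

section \<open>Conjugation on the runners\<close>

definition mirrored :: "maya \<Rightarrow> maya \<Rightarrow> bool" where
  "mirrored S S' \<longleftrightarrow> (\<forall>m. m \<in> ptcls S' \<longleftrightarrow> - 1 - m \<notin> ptcls S)"

lemma mirroredD: "mirrored S S' \<Longrightarrow> m \<in> ptcls S' \<longleftrightarrow> - 1 - m \<notin> ptcls S"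
  unfolding mirrored_def by blast

lemma mirroredD': "mirrored S S' \<Longrightarrow> - 1 - m \<in> ptcls S' \<longleftrightarrow> m \<notin> ptcls S"
  using mirroredD[of S S' "- 1 - m"] by simp

lemma hook_pairs_mirrored:
  assumes "mirrored S S'"
  shows "bij_betw (\<lambda>(m, m'). (- 1 - m', - 1 - m)) (hook_pairs S) (hook_pairs S')"
  by (rule bij_betw_byWitness[where f' = "\<lambda>(m, m'). (- 1 - m', - 1 - m)"])
     (auto simp: hook_pairs_def mirroredD'[OF assms] mirroredD[OF assms])

text \<open>With g constant this shows that the mirror image has the opposite charge; at charge 0 it
  is the conjugate partition.\<close>

lemma reg_sum_mirrored:
  assumes "mirrored S S'"
  shows "reg_sum g S' = - reg_sum (\<lambda>m. g (- 1 - m)) S"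
proof -
  have "sum g (ptcls S' \<inter> {0..}) = sum (\<lambda>m. g (- 1 - m)) ({..<0} - ptcls S)"
    by (rule sum.reindex_bij_witness[of _ "\<lambda>m. - 1 - m" "\<lambda>m. - 1 - m"])
       (auto simp: mirroredD'[OF assms] mirroredD[OF assms])
  moreover have "sum g ({..<0} - ptcls S') = sum (\<lambda>m. g (- 1 - m)) (ptcls S \<inter> {0..})"
    by (rule sum.reindex_bij_witness[of _ "\<lambda>m. - 1 - m" "\<lambda>m. - 1 - m"])
       (auto simp: mirroredD'[OF assms] mirroredD[OF assms])
  ultimately show ?thesis by (simp add: reg_sum_def)
qed

lemma self_dual_iff: "S \<in> self_dual \<longleftrightarrow> mirrored S S"
  unfolding self_dual_def mirrored_def by blast

text \<open>The reflection s \<mapsto> - 1 - s sends the residue i to t - 1 - i. For even t these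
  differ, so no runner is its own mirror image and half of the runners determine S.\<close>

lemma mirrored_quot_comp:
  assumes S: "S \<in> self_dual" and i: "i < t"
  shows "mirrored (quot_comp t i S) (quot_comp t (t - 1 - i) S)"
  unfolding mirrored_def
proof
  fix m
  have "int t * m + int (t - 1 - i) = - 1 - (int t * (- 1 - m) + int i)"
    using i by (simp add: algebra_simps of_nat_diff)
  then have "int t * m + int (t - 1 - i) \<in> ptcls S \<longleftrightarrow> int t * (- 1 - m) + int i \<notin> ptcls S"
    using mirroredD'[OF S[unfolded self_dual_iff]] by simp
  moreover have "t - 1 - i < t" using i by simp
  ultimately show "m \<in> ptcls (quot_comp t (t - 1 - i) S) \<longleftrightarrow> - 1 - m \<notin> ptcls (quot_comp t i S)"
    using i by (simp only: ptcls_quot_comp mem_Collect_eq)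
qed

lemma sum_pair_up: "(\<Sum>i<2 * k. f i) = (\<Sum>i<k. f i + f (2 * k - 1 - i) :: 'a::comm_monoid_add)"
  and prod_pair_up: "(\<Prod>i<2 * k. g i) = (\<Prod>i<k. g i * g (2 * k - 1 - i) :: 'b::comm_monoid_mult)" for k :: nat
proof -
  have split: "{..<2 * k} = {..<k} \<union> {k..<2 * k}" by auto
  have "sum f {k..<2 * k} = (\<Sum>i<k. f (2 * k - 1 - i))"
    by (rule sum.reindex_bij_witness[of _ "\<lambda>i. 2 * k - 1 - i" "\<lambda>i. 2 * k - 1 - i"]) auto
  then show "(\<Sum>i<2 * k. f i) = (\<Sum>i<k. f i + f (2 * k - 1 - i))"
    unfolding split by (subst sum.union_disjoint) (auto simp: sum.distrib)
  have "prod g {k..<2 * k} = (\<Prod>i<k. g (2 * k - 1 - i))"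
    by (rule prod.reindex_bij_witness[of _ "\<lambda>i. 2 * k - 1 - i" "\<lambda>i. 2 * k - 1 - i"]) auto
  then show "(\<Prod>i<2 * k. g i) = (\<Prod>i<k. g i * g (2 * k - 1 - i))"
    unfolding split by (subst prod.union_disjoint) (auto simp: prod.distrib)
qed

context
  fixes S :: maya and k :: nat
  assumes S: "S \<in> self_dual" and k: "0 < k"
begin

lemma sum_hooks_self_dual:
  fixes F :: "int \<Rightarrow> 'a::comm_semiring_1"
  shows "(\<Sum>(s, s')\<in>{(s, s') \<in> hook_pairs S. int (2 * k) dvd s - s'}. F (s - s')) =
    2 * (\<Sum>i<k. \<Sum>(m, m')\<in>hook_pairs (quot_comp (2 * k) i S). F (int (2 * k) * (m - m')))"
proof -
  define h where "h i = (\<Sum>(m, m')\<in>hook_pairs (quot_comp (2 * k) i S). F (int (2 * k) * (m - m')))" for i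
  have t: "0 < 2 * k" using k by simp
  have "(\<Sum>(s, s')\<in>{(s, s') \<in> hook_pairs S. int (2 * k) dvd s - s'}. F (s - s')) =
    (\<Sum>(i, m, m')\<in>(SIGMA i:{..<2 * k}. hook_pairs (quot_comp (2 * k) i S)). F (int (2 * k) * (m - m')))"
    by (subst sum.reindex_bij_betw[OF hook_pairs_quot_comp[OF t], symmetric])
       (simp add: case_prod_unfold right_diff_distrib)
  also have "\<dots> = (\<Sum>i<2 * k. h i)"
    unfolding h_def by (subst sum.Sigma) (auto simp: finite_hook_pairs)
  also have "\<dots> = (\<Sum>i<k. h i + h (2 * k - 1 - i))" by (rule sum_pair_up)
  also have "\<dots> = (\<Sum>i<k. h i + h i)"
  proof (intro sum.cong refl arg_cong2[of _ _ _ _ "(+)"])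
    fix i assume "i \<in> {..<k}"
    then have "mirrored (quot_comp (2 * k) i S) (quot_comp (2 * k) (2 * k - 1 - i) S)"
      by (intro mirrored_quot_comp S) auto
    from sum.reindex_bij_betw[OF hook_pairs_mirrored[OF this], of "\<lambda>(m, m'). F (int (2 * k) * (m - m'))", symmetric]
    show "h (2 * k - 1 - i) = h i"
      unfolding h_def by (simp add: case_prod_unfold)
  qed
  also have "\<dots> = 2 * (\<Sum>i<k. h i)" by (simp only: sum.distrib mult_2)
  finally show ?thesis unfolding h_def .
qed

lemma prod_hooks_self_dual:
  fixes F :: "int \<Rightarrow> 'a::comm_semiring_1"
  shows "(\<Prod>(s, s')\<in>{(s, s') \<in> hook_pairs S. int (2 * k) dvd s - s'}. F (s - s')) =
    (\<Prod>i<k. (\<Prod>(m, m')\<in>hook_pairs (quot_comp (2 * k) i S). F (int (2 * k) * (m - m')))\<^sup>2)"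
proof -
  define h where "h i = (\<Prod>(m, m')\<in>hook_pairs (quot_comp (2 * k) i S). F (int (2 * k) * (m - m')))" for i
  have t: "0 < 2 * k" using k by simp
  have "(\<Prod>(s, s')\<in>{(s, s') \<in> hook_pairs S. int (2 * k) dvd s - s'}. F (s - s')) =
    (\<Prod>(i, m, m')\<in>(SIGMA i:{..<2 * k}. hook_pairs (quot_comp (2 * k) i S)). F (int (2 * k) * (m - m')))"
    by (subst prod.reindex_bij_betw[OF hook_pairs_quot_comp[OF t], symmetric])
       (simp add: case_prod_unfold right_diff_distrib)
  also have "\<dots> = (\<Prod>i<2 * k. h i)"
    unfolding h_def by (subst prod.Sigma) (auto simp: finite_hook_pairs)
  also have "\<dots> = (\<Prod>i<k. h i * h (2 * k - 1 - i))" by (rule prod_pair_up)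
  also have "\<dots> = (\<Prod>i<k. h i * h i)"
  proof (intro prod.cong refl arg_cong2[of _ _ _ _ "(*)"])
    fix i assume "i \<in> {..<k}"
    then have "mirrored (quot_comp (2 * k) i S) (quot_comp (2 * k) (2 * k - 1 - i) S)"
      by (intro mirrored_quot_comp S) auto
    from prod.reindex_bij_betw[OF hook_pairs_mirrored[OF this], of "\<lambda>(m, m'). F (int (2 * k) * (m - m'))", symmetric]
    show "h (2 * k - 1 - i) = h i"
      unfolding h_def by (simp add: case_prod_unfold)
  qed
  finally show ?thesis unfolding h_def power2_eq_square .
qed

lemma reg_sum_self_dual:
  "reg_sum g S = (\<Sum>i<k. reg_sum (\<lambda>m. g (int (2 * k) * m + int i) - g (- 1 - (int (2 * k) * m + int i))) (quot_comp (2 * k) i S))"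
proof -
  define h where "h i = reg_sum (\<lambda>m. g (int (2 * k) * m + int i)) (quot_comp (2 * k) i S)" for i
  have "reg_sum g S = (\<Sum>i<2 * k. h i)" unfolding h_def using k by (intro reg_sum_quot_comp) simp
  also have "\<dots> = (\<Sum>i<k. h i + h (2 * k - 1 - i))" by (rule sum_pair_up)
  also have "\<dots> = (\<Sum>i<k. reg_sum (\<lambda>m. g (int (2 * k) * m + int i) - g (- 1 - (int (2 * k) * m + int i))) (quot_comp (2 * k) i S))"
  proof (intro sum.cong refl)
    fix i assume i: "i \<in> {..<k}"
    then have mir: "mirrored (quot_comp (2 * k) i S) (quot_comp (2 * k) (2 * k - 1 - i) S)"
      by (intro mirrored_quot_comp S) auto
    have "int (2 * k) * (- 1 - m) + int (2 * k - 1 - i) = - 1 - (int (2 * k) * m + int i)" for m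
      using i by (simp add: algebra_simps of_nat_diff)
    then show "h i + h (2 * k - 1 - i) = reg_sum (\<lambda>m. g (int (2 * k) * m + int i) - g (- 1 - (int (2 * k) * m + int i))) (quot_comp (2 * k) i S)"
      unfolding h_def reg_sum_mirrored[OF mir] by (simp add: reg_sum_def sum_subtractf)
  qed
  finally show ?thesis .
qed

text \<open>A particle s together with its mirrored hole - 1 - s contributes 2 s + 1, which is 4 k m
  + 2 i + 1 at position m of runner i.\<close>

lemma energy_self_dual:
  "energy S = (\<Sum>i<k. 2 * int (2 * k) * energy (quot_comp (2 * k) i S) + (2 * int i + 1) * charge (quot_comp (2 * k) i S))"
  unfolding energy_def reg_sum_self_dual[of "\<lambda>s. s"] charge_def
  by (intro sum.cong refl)
     (simp add: reg_sum_def sum.distrib sum_subtractf sum_distrib_left algebra_simps sum_negf)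

lemma parity_self_dual:
  "reg_sum parity_sign S = 2 * (\<Sum>i<k. (- 1) ^ i * charge (quot_comp (2 * k) i S))"
  unfolding reg_sum_self_dual[of parity_sign] charge_def sum_distrib_left
proof (intro sum.cong refl)
  fix i
  have "parity_sign (int (2 * k) * m + int i) - parity_sign (- 1 - (int (2 * k) * m + int i)) = 2 * (- 1) ^ i" for m
    by (auto simp: parity_sign_def)
  then show "reg_sum (\<lambda>m. parity_sign (int (2 * k) * m + int i) - parity_sign (- 1 - (int (2 * k) * m + int i))) (quot_comp (2 * k) i S) =
      2 * ((- 1) ^ i * reg_sum (\<lambda>_. 1) (quot_comp (2 * k) i S))"
    by (simp add: reg_sum_def algebra_simps)
qed

end

section \<open>Reassembling a self-dual diagram from half of its runners\<close>

definition assemble :: "nat \<Rightarrow> (nat \<Rightarrow> maya) \<Rightarrow> maya" where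
  "assemble k h = Maya {s. let i = nat (s mod int (2 * k)); m = s div int (2 * k) in
     if i < k then m \<in> ptcls (h i) else - 1 - m \<notin> ptcls (h (2 * k - 1 - i))}"

text \<open>The substance is that the prescribed set is a Maya diagram. The finitely many runners
  share a window, and outside the corresponding range of s the set agrees with the vacuum.\<close>

lemma lincomb_mem_assemble:
  assumes i: "i < 2 * k"
  shows "int (2 * k) * m + int i \<in> ptcls (assemble k h) \<longleftrightarrow>
    (if i < k then m \<in> ptcls (h i) else - 1 - m \<notin> ptcls (h (2 * k - 1 - i)))"
proof -
  let ?T = "{s. let i = nat (s mod int (2 * k)); m = s div int (2 * k) in
     if i < k then m \<in> ptcls (h i) else - 1 - m \<notin> ptcls (h (2 * k - 1 - i))}"
  define t where "t = int (2 * k)"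
  have t: "0 < t" using i by (simp add: t_def)
  obtain N where N: "\<And>i. i < k \<Longrightarrow> {..<- int N} \<subseteq> ptcls (h i) \<and> ptcls (h i) \<subseteq> {..<int N}"
  proof -
    have "\<forall>i. \<exists>N :: nat. {..<- int N} \<subseteq> ptcls (h i) \<and> ptcls (h i) \<subseteq> {..<int N}"
      using window_exists by metis
    then obtain M :: "nat \<Rightarrow> nat" where M: "\<And>i. {..<- int (M i)} \<subseteq> ptcls (h i) \<and> ptcls (h i) \<subseteq> {..<int (M i)}"
      by metis
    have "int (M i) \<le> int (\<Sum>i<k. M i)" if "i < k" for i
      using that by (simp only: of_nat_le_iff) (auto intro: member_le_sum)
    then have "{..<- int (\<Sum>i<k. M i)} \<subseteq> ptcls (h i) \<and> ptcls (h i) \<subseteq> {..<int (\<Sum>i<k. M i)}" if "i < k" for i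
      using that M[of i] by fastforce
    then show ?thesis by (rule that)
  qed
  have out: "(s \<in> ?T) = (s div t < 0)" if "s div t < - int N - 1 \<or> s div t > int N" for s
  proof -
    define i where "i = nat (s mod int (2 * k))"
    have i: "i < 2 * k" using i by (simp add: i_def nat_less_iff)
    have "m \<in> ptcls (h j)" if "m < - int N" "j < k" for m j using N[OF that(2)] that(1) by blast
    moreover have "m \<notin> ptcls (h j)" if "m \<ge> int N" "j < k" for m j using N[OF that(2)] that(1) by fastforce
    moreover have "s \<in> ?T \<longleftrightarrow> (if i < k then s div t \<in> ptcls (h i) else - 1 - s div t \<notin> ptcls (h (2 * k - 1 - i)))"
      unfolding i_def t_def Let_def mem_Collect_eq ..
    ultimately show ?thesis
      using that i by (cases "i < k") (auto simp del: mem_Collect_eq)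
  qed
  have div: "t * (s div t) \<le> s" "s < t * (s div t) + t" for s
  proof -
    have "t * (s div t) + s mod t = s" "0 \<le> s mod t" "s mod t < t" using t by simp_all
    then show "t * (s div t) \<le> s" "s < t * (s div t) + t" by linarith+
  qed
  have bnd: "s \<in> {t * (- int N - 1)..t * int N + t}" if "\<not> (s div t < - int N - 1 \<or> s div t > int N)" for s
  proof -
    have "t * (- int N - 1) \<le> t * (s div t)" "t * (s div t) \<le> t * int N"
      using that t by (intro mult_left_mono; simp)+
    then show ?thesis using div[of s] unfolding atLeastAtMost_iff by linarith
  qed
  have "finite (?T \<inter> {0..})" "finite ({..<0} - ?T)"
  proof -
    have "s \<in> {t * (- int N - 1)..t * int N + t}" if "s \<in> ?T \<inter> {0..} \<or> s \<in> {..<0} - ?T" for s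
    proof (rule ccontr)
      assume "s \<notin> {t * (- int N - 1)..t * int N + t}"
      then have "(s \<in> ?T) = (s div t < 0)" using bnd out by blast
      moreover have "s div t < 0 \<longleftrightarrow> s < 0" using t by (rule pos_imp_zdiv_neg_iff)
      ultimately show False using that by auto
    qed
    then have "?T \<inter> {0..} \<subseteq> {t * (- int N - 1)..t * int N + t}" "{..<0} - ?T \<subseteq> {t * (- int N - 1)..t * int N + t}"
      by blast+
    then show "finite (?T \<inter> {0..})" "finite ({..<0} - ?T)"
      using finite_atLeastAtMost_int finite_subset by blast+
  qed
  then have "ptcls (assemble k h) = ?T" unfolding assemble_def by (intro Maya_inverse) simp
  then show ?thesis using div_mod_lincomb[OF i, of m] by (simp add: Let_def)
qed

lemma bij_betw_quot_comp:
  assumes k: "0 < k"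
  shows "bij_betw (\<lambda>S. restrict (\<lambda>i. quot_comp (2 * k) i S) {..<k}) self_dual (PiE {..<k} (\<lambda>_. UNIV))"
proof (rule bij_betw_byWitness[where f' = "assemble k"])
  have decomp: "\<exists>i m. i < 2 * k \<and> s = int (2 * k) * m + int i" for s
  proof (intro exI conjI)
    show "nat (s mod int (2 * k)) < 2 * k" using k by (simp add: nat_less_iff)
    show "s = int (2 * k) * (s div int (2 * k)) + int (nat (s mod int (2 * k)))" using k by simp
  qed
  show "\<forall>S\<in>self_dual. assemble k (restrict (\<lambda>i. quot_comp (2 * k) i S) {..<k}) = S"
  proof
    fix S assume S: "S \<in> self_dual"
    show "assemble k (restrict (\<lambda>i. quot_comp (2 * k) i S) {..<k}) = S"
    proof (intro maya_eqI set_eqI)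
      fix s
      obtain i m where i: "i < 2 * k" and s: "s = int (2 * k) * m + int i" using decomp by blast
      have mir: "- 1 - m \<notin> ptcls (quot_comp (2 * k) (2 * k - 1 - i) S) \<longleftrightarrow> m \<in> ptcls (quot_comp (2 * k) i S)"
        using mirroredD'[OF mirrored_quot_comp[OF S i], of m] by simp
      show "s \<in> ptcls (assemble k (restrict (\<lambda>i. quot_comp (2 * k) i S) {..<k})) \<longleftrightarrow> s \<in> ptcls S"
      proof -
        have q: "m \<in> ptcls (quot_comp (2 * k) i S) \<longleftrightarrow> int (2 * k) * m + int i \<in> ptcls S"
          by (simp only: ptcls_quot_comp[OF i] mem_Collect_eq)
        show ?thesis
        proof (cases "i < k")
          case True
          then show ?thesis
            unfolding s lincomb_mem_assemble[OF i] using q by (simp only: if_True restrict_apply lessThan_iff)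
        next
          case False
          moreover from False have "2 * k - 1 - i < k" using i by simp
          ultimately show ?thesis
            unfolding s lincomb_mem_assemble[OF i] using q mir
            by (simp only: if_True if_False restrict_apply lessThan_iff)
        qed
      qed
    qed
  qed
  show "\<forall>h\<in>PiE {..<k} (\<lambda>_. UNIV). restrict (\<lambda>i. quot_comp (2 * k) i (assemble k h)) {..<k} = h"
  proof
    fix h assume h: "h \<in> PiE {..<k} (\<lambda>_. UNIV :: maya set)"
    show "restrict (\<lambda>i. quot_comp (2 * k) i (assemble k h)) {..<k} = h"
    proof (rule PiE_ext[OF _ h])
      fix i assume i: "i \<in> {..<k}"
      have "quot_comp (2 * k) i (assemble k h) = h i"
      proof (intro maya_eqI)
        show "ptcls (quot_comp (2 * k) i (assemble k h)) = ptcls (h i)"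
          using i lincomb_mem_assemble[of i k _ h] by (subst ptcls_quot_comp) auto
      qed
      then show "restrict (\<lambda>i. quot_comp (2 * k) i (assemble k h)) {..<k} i = h i" using i by simp
    qed auto
  qed
  show "(\<lambda>S. restrict (\<lambda>i. quot_comp (2 * k) i S) {..<k}) ` self_dual \<subseteq> PiE {..<k} (\<lambda>_. UNIV)"
    by (simp add: image_subset_iff restrict_PiE_iff)
  show "assemble k ` PiE {..<k} (\<lambda>_. UNIV) \<subseteq> self_dual"
  proof (rule image_subsetI)
    fix h
    show "assemble k h \<in> self_dual"
      unfolding self_dual_iff mirrored_def
    proof
      fix s
      obtain i m where i: "i < 2 * k" and s: "s = int (2 * k) * m + int i" using decomp by blast
      have i': "2 * k - 1 - i < 2 * k" using i by simp
      have eq: "- 1 - s = int (2 * k) * (- 1 - m) + int (2 * k - 1 - i)"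
        using i by (simp add: s algebra_simps of_nat_diff)
      show "s \<in> ptcls (assemble k h) \<longleftrightarrow> - 1 - s \<notin> ptcls (assemble k h)"
        unfolding eq lincomb_mem_assemble[OF i'] unfolding s lincomb_mem_assemble[OF i] using i by auto
    qed
  qed
qed

section \<open>Generating functions\<close>

unbundle no vec_syntax and fps_syntax

text \<open>The series of c a q^(d a) over A, given by its coefficients so that products and
  bijections reduce to finite sums; \<open>has_sum_wgf\<close> identifies it with the topological
  sum.\<close>

definition wgf :: "'b set \<Rightarrow> ('b \<Rightarrow> nat) \<Rightarrow> ('b \<Rightarrow> 'a::comm_ring_1) \<Rightarrow> 'a fps" where
  "wgf A d c = Abs_fps (\<lambda>n. \<Sum>a\<in>{a \<in> A. d a = n}. c a)"

definition finite_levels :: "'b set \<Rightarrow> ('b \<Rightarrow> nat) \<Rightarrow> bool" where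
  "finite_levels A d \<longleftrightarrow> (\<forall>n. finite {a \<in> A. d a = n})"

lemma finite_levels_le: "finite_levels A d \<Longrightarrow> finite {a \<in> A. d a \<le> n}"
proof -
  assume "finite_levels A d"
  then have "finite (\<Union>m\<le>n. {a \<in> A. d a = m})" by (auto simp: finite_levels_def)
  then show ?thesis by (rule finite_subset[rotated]) auto
qed

lemma wgf_cong: "(\<And>a. a \<in> A \<Longrightarrow> d a = d' a) \<Longrightarrow> (\<And>a. a \<in> A \<Longrightarrow> c a = c' a) \<Longrightarrow> wgf A d c = wgf A d' c'"
  unfolding wgf_def by (intro arg_cong[of _ _ Abs_fps] ext sum.cong) auto

lemma wgf_reindex:
  assumes f: "bij_betw f A A'"
  shows "wgf A (\<lambda>a. d (f a)) (\<lambda>a. c (f a)) = wgf A' d c"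
  unfolding wgf_def
proof (intro arg_cong[of _ _ Abs_fps] ext)
  fix n
  have "bij_betw f {a \<in> A. d (f a) = n} {a \<in> A'. d a = n}"
    using f unfolding bij_betw_def by (auto simp: inj_on_def)
  then show "(\<Sum>a\<in>{a \<in> A. d (f a) = n}. c (f a)) = (\<Sum>a\<in>{a \<in> A'. d a = n}. c a)"
    by (rule sum.reindex_bij_betw)
qed

lemma finite_levels_reindex:
  assumes f: "bij_betw f A A'"
  shows "finite_levels A (\<lambda>a. d (f a)) \<longleftrightarrow> finite_levels A' d"
proof -
  have "bij_betw f {a \<in> A. d (f a) = n} {a \<in> A'. d a = n}" for n
    using f unfolding bij_betw_def by (auto simp: inj_on_def)
  then show ?thesis unfolding finite_levels_def using bij_betw_finite by blast
qed

text \<open>Every finite subset containing all a with d a = n already has the final coefficient of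
  q^n.\<close>

lemma has_sum_wgf:
  fixes c :: "'b \<Rightarrow> 'a::comm_ring_1"
  assumes "finite_levels A d"
  shows "((\<lambda>a. fps_X ^ d a * fps_const (c a)) has_sum wgf A d c) A"
  unfolding has_sum_def
proof (rule tendsto_fpsI)
  fix n
  let ?L = "{a \<in> A. d a = n}"
  have fin: "finite ?L" using assms by (simp add: finite_levels_def)
  have "\<forall>\<^sub>F F in finite_subsets_at_top A. ?L \<subseteq> F \<and> finite F \<and> F \<subseteq> A"
    using fin by (auto simp: eventually_finite_subsets_at_top)
  then show "\<forall>\<^sub>F F in finite_subsets_at_top A.
      (\<Sum>a\<in>F. fps_X ^ d a * fps_const (c a)) $ n = wgf A d c $ n"
  proof eventually_elim
    case (elim F)
    have "(\<Sum>a\<in>F. fps_X ^ d a * fps_const (c a)) $ n = (\<Sum>a\<in>F. if d a = n then c a else 0)"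
      by (auto simp: fps_sum_nth fps_X_power_nth intro!: sum.cong)
    also have "\<dots> = (\<Sum>a\<in>?L. c a)"
      using elim by (intro sum.mono_neutral_cong_right) auto
    finally show ?case by (simp add: wgf_def)
  qed
qed

lemma wgf_times:
  assumes A: "finite_levels A d" and E: "finite_levels E e"
  shows "wgf A d c * wgf E e c' = wgf (A \<times> E) (\<lambda>(a, b). d a + e b) (\<lambda>(a, b). c a * c' b)"
    and "finite_levels (A \<times> E) (\<lambda>(a, b). d a + e b)"
proof -
  have finA: "finite {a \<in> A. d a = n}" and finE: "finite {b \<in> E. e b = n}" for n
    using A E by (auto simp: finite_levels_def)
  show "finite_levels (A \<times> E) (\<lambda>(a, b). d a + e b)"
    unfolding finite_levels_def
  proof
    fix n
    have "finite ({a \<in> A. d a \<le> n} \<times> {b \<in> E. e b \<le> n})"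
      using finite_levels_le[OF A] finite_levels_le[OF E] by simp
    then show "finite {p \<in> A \<times> E. (case p of (a, b) \<Rightarrow> d a + e b) = n}"
      by (rule finite_subset[rotated]) auto
  qed
  show "wgf A d c * wgf E e c' = wgf (A \<times> E) (\<lambda>(a, b). d a + e b) (\<lambda>(a, b). c a * c' b)"
  proof (rule fps_ext)
    fix n
    have "(wgf A d c * wgf E e c') $ n =
        (\<Sum>i=0..n. (\<Sum>a\<in>{a \<in> A. d a = i}. c a) * (\<Sum>b\<in>{b \<in> E. e b = n - i}. c' b))"
      by (simp add: wgf_def fps_mult_nth)
    also have "\<dots> = (\<Sum>i=0..n. \<Sum>(a, b)\<in>{a \<in> A. d a = i} \<times> {b \<in> E. e b = n - i}. c a * c' b)"
      by (simp add: sum_product sum.cartesian_product)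
    also have "\<dots> = (\<Sum>(i, a, b)\<in>(SIGMA i:{0..n}. {a \<in> A. d a = i} \<times> {b \<in> E. e b = n - i}). c a * c' b)"
      using finA finE by (subst sum.Sigma) (auto simp: case_prod_unfold)
    also have "\<dots> = (\<Sum>(a, b)\<in>{p \<in> A \<times> E. (case p of (a, b) \<Rightarrow> d a + e b) = n}. c a * c' b)"
      by (rule sum.reindex_bij_witness[of _ "\<lambda>(a, b). (d a, a, b)" "\<lambda>(i, a, b). (a, b)"]) auto
    finally show "(wgf A d c * wgf E e c') $ n =
        wgf (A \<times> E) (\<lambda>(a, b). d a + e b) (\<lambda>(a, b). c a * c' b) $ n"
      by (simp add: wgf_def)
  qed
qed

lemma wgf_prod:
  assumes "finite I" "\<And>i. i \<in> I \<Longrightarrow> finite_levels A (d i)"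
  shows "(\<Prod>i\<in>I. wgf A (d i) (c i)) =
      wgf (PiE I (\<lambda>_. A)) (\<lambda>h. \<Sum>i\<in>I. d i (h i)) (\<lambda>h. \<Prod>i\<in>I. c i (h i) :: 'a::comm_ring_1)"
    and "finite_levels (PiE I (\<lambda>_. A)) (\<lambda>h. \<Sum>i\<in>I. d i (h i))"
proof -
  have "(\<Prod>i\<in>I. wgf A (d i) (c i)) =
      wgf (PiE I (\<lambda>_. A)) (\<lambda>h. \<Sum>i\<in>I. d i (h i)) (\<lambda>h. \<Prod>i\<in>I. c i (h i)) \<and>
    finite_levels (PiE I (\<lambda>_. A)) (\<lambda>h. \<Sum>i\<in>I. d i (h i))"
    using assms
  proof (induction I rule: finite_induct)
    case empty
    have "wgf {\<lambda>_. undefined} (\<lambda>h. 0) (\<lambda>h. 1 :: 'a) = 1"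
      by (rule fps_ext) (simp add: wgf_def)
    then show ?case by (simp add: finite_levels_def)
  next
    case (insert j I)
    define f where "f = (\<lambda>(a, h). h(j := a) :: 'b \<Rightarrow> 'c)"
    have bij: "bij_betw f (A \<times> PiE I (\<lambda>_. A)) (PiE (insert j I) (\<lambda>_. A))"
      unfolding bij_betw_def f_def
      using insert.hyps inj_combinator[of j I "\<lambda>_. A"] by (auto simp: PiE_insert_eq)
    have fj: "f p j = fst p" and fi: "i \<in> I \<Longrightarrow> f p i = snd p i" for p i
      using insert.hyps by (auto simp: f_def case_prod_unfold)
    have IH: "(\<Prod>i\<in>I. wgf A (d i) (c i)) =
        wgf (PiE I (\<lambda>_. A)) (\<lambda>h. \<Sum>i\<in>I. d i (h i)) (\<lambda>h. \<Prod>i\<in>I. c i (h i))"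
      "finite_levels (PiE I (\<lambda>_. A)) (\<lambda>h. \<Sum>i\<in>I. d i (h i))"
      using insert by auto
    have d: "(\<Sum>i\<in>insert j I. d i (f p i)) = (case p of (a, h) \<Rightarrow> d j a + (\<Sum>i\<in>I. d i (h i)))" for p
      using insert.hyps fj fi by (simp add: case_prod_unfold)
    have c: "(\<Prod>i\<in>insert j I. c i (f p i)) = (case p of (a, h) \<Rightarrow> c j a * (\<Prod>i\<in>I. c i (h i)))" for p
      using insert.hyps fj fi by (simp add: case_prod_unfold)
    note times = wgf_times[OF insert.prems[of j, simplified] IH(2)]
    have "(\<Prod>i\<in>insert j I. wgf A (d i) (c i)) =
        wgf (A \<times> PiE I (\<lambda>_. A)) (\<lambda>p. \<Sum>i\<in>insert j I. d i (f p i)) (\<lambda>p. \<Prod>i\<in>insert j I. c i (f p i))"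
      unfolding d c using insert.hyps by (simp add: IH(1) times(1))
    also have "\<dots> = wgf (PiE (insert j I) (\<lambda>_. A)) (\<lambda>h. \<Sum>i\<in>insert j I. d i (h i)) (\<lambda>h. \<Prod>i\<in>insert j I. c i (h i))"
      by (rule wgf_reindex[OF bij])
    finally show ?case
      using times(2) finite_levels_reindex[OF bij, of "\<lambda>h. \<Sum>i\<in>insert j I. d i (h i)"] unfolding d by simp
  qed
  then show "(\<Prod>i\<in>I. wgf A (d i) (c i)) =
      wgf (PiE I (\<lambda>_. A)) (\<lambda>h. \<Sum>i\<in>I. d i (h i)) (\<lambda>h. \<Prod>i\<in>I. c i (h i))"
    "finite_levels (PiE I (\<lambda>_. A)) (\<lambda>h. \<Sum>i\<in>I. d i (h i))" by auto
qed

lemma wgf_sum: "wgf A d (\<lambda>a. \<Sum>j\<in>J. c j a) = (\<Sum>j\<in>J. wgf A d (c j))"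
  unfolding wgf_def by (rule fps_ext) (simp add: fps_sum_nth sum.swap[of _ _ J])

lemma wgf_const_mult: "wgf A d (\<lambda>a. x * c a) = fps_const x * wgf A d c"
  unfolding wgf_def by (rule fps_ext) (simp add: sum_distrib_left)

text \<open>Factor j is 1 up to degree j, so later factors no longer affect a given coefficient. The
  limit has constant term 1 and is thus nonzero, as convergence of an infinite product
  demands.\<close>

lemma prodinf_fps:
  fixes f :: "nat \<Rightarrow> 'a::idom fps"
  assumes f: "\<And>j i. i \<le> j \<Longrightarrow> f j $ i = 1 $ i"
    and le: "n \<le> M"
  shows "prodinf f $ n = (\<Prod>j<M. f j) $ n"
proof -
  have step: "(\<Prod>j<n + k. f j) $ i = (\<Prod>j<n. f j) $ i" if "i \<le> n" for n k i
  proof (induction k)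
    case (Suc k)
    have "(\<Prod>j<n + Suc k. f j) $ i = (\<Sum>l=0..i. (\<Prod>j<n + k. f j) $ l * f (n + k) $ (i - l))"
      by (simp add: fps_mult_nth)
    also have "\<dots> = (\<Sum>l=0..i. (\<Prod>j<n + k. f j) $ l * 1 $ (i - l))"
      using that by (intro sum.cong refl arg_cong2[of _ _ _ _ "(*)"] f) auto
    also have "\<dots> = ((\<Prod>j<n + k. f j) * 1) $ i" by (simp only: fps_mult_nth)
    finally show ?case using Suc by simp
  qed simp
  have stable: "(\<Prod>j<M. f j) $ n = (\<Prod>j<n. f j) $ n" if "n \<le> M" for n M
    using step[of n n "M - n"] that by simp
  define P where "P = Abs_fps (\<lambda>n. (\<Prod>j<n. f j) $ n)"
  have "(\<lambda>n. \<Prod>i\<le>n. f i) \<longlonglongrightarrow> P"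
  proof (rule tendsto_fpsI)
    fix n
    show "\<forall>\<^sub>F m in sequentially. (\<Prod>i\<le>m. f i) $ n = P $ n"
      using eventually_ge_at_top[of n]
    proof eventually_elim
      case (elim m)
      then show ?case using stable[of n "Suc m"] unfolding P_def lessThan_Suc_atMost by simp
    qed
  qed
  moreover have "P $ 0 = 1" by (simp add: P_def)
  then have "P \<noteq> 0" by auto
  ultimately have "f has_prod P" unfolding has_prod_def raw_has_prod_def by simp
  then have "prodinf f = P" by (rule has_prod_unique[symmetric])
  then have "prodinf f $ n = (\<Prod>j<n. f j) $ n" by (simp only: P_def fps_nth_Abs_fps)
  also have "\<dots> = (\<Prod>j<M. f j) $ n" by (rule stable[OF le, symmetric])
  finally show ?thesis .
qed

lemma qpochhammer_inf_nth:
  fixes a :: "'a::idom fps"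
  assumes q: "0 < m" and a: "a $ 0 = 0" and n: "n \<le> M"
  shows "qpochhammer_inf a (fps_X ^ m) $ n = (\<Prod>j<M. 1 - a * fps_X ^ (m * j)) $ n"
proof -
  have "(a * fps_X ^ (m * j)) $ i = 0" if "i \<le> j" for i j
  proof (cases "i < m * j")
    case False
    moreover have "j \<le> m * j" using q by simp
    ultimately have "i = m * j" using that by linarith
    then show ?thesis using a by (simp add: fps_X_power_mult_right_nth)
  qed (simp add: fps_X_power_mult_right_nth)
  then have "(1 - a * (fps_X ^ m) ^ j) $ i = 1 $ i" if "i \<le> j" for i j
    using that by (simp add: power_mult[symmetric])
  then show ?thesis
    unfolding qpochhammer_inf_def using prodinf_fps[of "\<lambda>j. 1 - a * (fps_X ^ m) ^ j", OF _ n]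
    by (simp add: power_mult[symmetric])
qed

lemma sum_card_below: "finite E \<Longrightarrow> 2 * (\<Sum>b\<in>E. int (card {c\<in>E. c < b})) = int (card E) * (int (card E) - 1)"
  for E :: "int set"
proof (induction E rule: finite_linorder_max_induct)
  case (insert b E)
  have "{c \<in> insert b E. c < a} = {c\<in>E. c < a}" if "a \<in> E" for a
    using insert.hyps that by force
  then have "(\<Sum>a\<in>E. int (card {c \<in> insert b E. c < a})) = (\<Sum>a\<in>E. int (card {c\<in>E. c < a}))" by simp
  moreover have "{c \<in> insert b E. c < b} = E" using insert.hyps by auto
  moreover have "b \<notin> E" using insert.hyps by auto
  ultimately have "(\<Sum>a\<in>insert b E. int (card {c \<in> insert b E. c < a})) = int (card E) + (\<Sum>a\<in>E. int (card {c\<in>E. c < a}))"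
    using insert.hyps by simp
  with insert show ?case using \<open>b \<notin> E\<close> by (simp add: algebra_simps)
qed simp

text \<open>Particle b has b + N positions of the window below it. Those occupied by other particles
  amount to N (N - 1) / 2 over all b, and the rest adds up to the energy.\<close>

lemma card_hook_pairs:
  assumes "charge S = 0"
  shows "int (card (hook_pairs S)) = energy S"
proof -
  obtain N where N: "{..<- int N} \<subseteq> ptcls S" by (rule window_exists)
  define E where "E = ptcls S \<inter> {- int N..}"
  have fin: "finite E" unfolding E_def by (rule finite_window)
  have cardE: "card E = N"
    using assms unfolding charge_def reg_sum_window[OF N] E_def by simp
  have "int (card (hook_pairs S)) = (\<Sum>b\<in>E. int (card ({- int N..<b} - ptcls S)))"
    unfolding hook_pairs_window[OF N] E_def[symmetric] using fin by simp
  also have "\<dots> = (\<Sum>b\<in>E. (b + int N) - int (card {c\<in>E. c < b}))"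
  proof (intro sum.cong refl)
    fix b assume "b \<in> E"
    then have b: "- int N \<le> b" by (simp add: E_def)
    have "{- int N..<b} = ({- int N..<b} - ptcls S) \<union> {c\<in>E. c < b}" by (auto simp: E_def)
    then have "card {- int N..<b} = card ({- int N..<b} - ptcls S) + card {c\<in>E. c < b}"
      using fin by (subst card_Un_disjoint[symmetric]) (auto simp: E_def)
    then show "int (card ({- int N..<b} - ptcls S)) = (b + int N) - int (card {c\<in>E. c < b})"
      using b by simp
  qed
  also have "\<dots> = \<Sum>E + int N * int N - (\<Sum>b\<in>E. int (card {c\<in>E. c < b}))"
    by (simp add: sum_subtractf sum.distrib cardE)
  finally have "2 * int (card (hook_pairs S)) = 2 * energy S"
    using sum_card_below[OF fin] sum_below_zero[of N]
    unfolding energy_def reg_sum_window[OF N] E_def[symmetric] cardE by (simp add: algebra_simps)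
  then show ?thesis by simp
qed

section \<open>Shifting the charge\<close>

definition shift :: "int \<Rightarrow> maya \<Rightarrow> maya" where
  "shift c S = Maya {s. s - c \<in> ptcls S}"

lemma shift_window:
  obtains N M :: nat where "{..<- int N} \<subseteq> ptcls S" "{..<- int M} \<subseteq> ptcls (shift c S)"
    "int M = int N - c" "ptcls (shift c S) = {s. s - c \<in> ptcls S}"
proof -
  obtain N0 where N0: "{..<- int N0} \<subseteq> ptcls S" "ptcls S \<subseteq> {..<int N0}" by (rule window_exists)
  define N where "N = N0 + nat \<bar>c\<bar>"
  define M where "M = nat (int N - c)"
  have M: "int M = int N - c" by (simp add: M_def N_def)
  have N: "{..<- int N} \<subseteq> ptcls S" using N0 by (auto simp: N_def)
  have low: "{..<- int M} \<subseteq> {s. s - c \<in> ptcls S}" using N M by auto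
  have "finite ({s. s - c \<in> ptcls S} \<inter> {0..})"
    by (rule finite_subset[of _ "{0..int N0 + c}"]) (use N0(2) in force)+
  moreover have "finite ({..<0} - {s. s - c \<in> ptcls S})"
  proof (rule finite_subset)
    show "{..<0} - {s. s - c \<in> ptcls S} \<subseteq> {- int M..<0}"
      using low by (force simp del: mem_Collect_eq simp: not_less[symmetric])
  qed simp
  ultimately have "ptcls (shift c S) = {s. s - c \<in> ptcls S}"
    unfolding shift_def by (intro Maya_inverse) simp
  then show ?thesis using that[OF N _ M] low by simp
qed

lemma ptcls_shift: "ptcls (shift c S) = {s. s - c \<in> ptcls S}"
  by (rule shift_window)

text \<open>The quadratic term in the energy is that of the lowest state of charge c. It is the
  source of the quadratic exponents in \<open>theta\<close>.\<close>

lemma charge_shift: "charge (shift c S) = charge S + c"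
  and energy_shift: "charge S = 0 \<Longrightarrow> 2 * energy (shift c S) = 2 * energy S + c * (c - 1)"
proof -
  obtain N M where w: "{..<- int N} \<subseteq> ptcls S" "{..<- int M} \<subseteq> ptcls (shift c S)" "int M = int N - c"
    by (rule shift_window)
  define E where "E = ptcls S \<inter> {- int N..}"
  have fin: "finite E" unfolding E_def by (rule finite_window)
  have img: "ptcls (shift c S) \<inter> {- int M..} = (\<lambda>s. s + c) ` E"
    using w(3) by (auto simp: ptcls_shift E_def intro!: image_eqI[of _ _ "_ - c"])
  have inj: "inj_on (\<lambda>s. s + c) E" by (simp add: inj_on_def)
  show ch: "charge (shift c S) = charge S + c"
    unfolding charge_def reg_sum_window[OF w(1)] reg_sum_window[OF w(2)] img E_def[symmetric]
    using w(3) by (simp add: card_image inj)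
  assume "charge S = 0"
  then have cardE: "card E = N" unfolding charge_def reg_sum_window[OF w(1)] E_def by simp
  have "energy (shift c S) = \<Sum>E + int N * c - (\<Sum>s\<in>{- int M..<0}. s)"
    unfolding energy_def reg_sum_window[OF w(2)] img using inj by (simp add: sum.reindex sum.distrib cardE)
  moreover have "energy S = \<Sum>E - (\<Sum>s\<in>{- int N..<0}. s)"
    unfolding energy_def reg_sum_window[OF w(1)] E_def ..
  ultimately show "2 * energy (shift c S) = 2 * energy S + c * (c - 1)"
    using sum_below_zero[of N] sum_below_zero[of M] unfolding w(3) by (simp add: algebra_simps)
qed

lemma hook_pairs_shift:
  "bij_betw (\<lambda>(s, s'). (s + c, s' + c)) (hook_pairs S) (hook_pairs (shift c S))"
  by (rule bij_betw_byWitness[where f' = "\<lambda>(s, s'). (s - c, s' - c)"])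
     (auto simp: hook_pairs_def ptcls_shift)

lemma bij_betw_shift: "bij_betw (\<lambda>(c, S). shift c S) (UNIV \<times> {S. charge S = 0}) UNIV"
proof (rule bij_betw_byWitness[where f' = "\<lambda>S. (charge S, shift (- charge S) S)"])
  have undo: "shift (- c) (shift c S) = S" for c S by (rule maya_eqI) (simp add: ptcls_shift)
  show "\<forall>p\<in>UNIV \<times> {S. charge S = 0}. (charge (case p of (c, S) \<Rightarrow> shift c S),
      shift (- charge (case p of (c, S) \<Rightarrow> shift c S)) (case p of (c, S) \<Rightarrow> shift c S)) = p"
    by (auto simp: charge_shift undo)
  show "\<forall>S\<in>UNIV. (case (charge S, shift (- charge S) S) of (c, S) \<Rightarrow> shift c S) = S"
    using undo[of "- charge _"] by simp
qed (auto simp: charge_shift)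

section \<open>Euler's product\<close>

definition bounded_level :: "nat \<Rightarrow> int \<Rightarrow> maya set" where
  "bounded_level N n = {S. charge S = 0 \<and> energy S = n \<and> {..<- int N} \<subseteq> ptcls S}"

definition window_sets :: "nat \<Rightarrow> int \<Rightarrow> int set set" where
  "window_sets N n = {E. finite E \<and> E \<subseteq> {- int N..} \<and> card E = N \<and> \<Sum>E = n + (\<Sum>s\<in>{- int N..<0}. s)}"

text \<open>A diagram of charge 0 that is filled below - N is a partition with at most N parts, and
  its window consists of N beta numbers. The level is an integer so that the recursion below may
  subtract freely; negative levels are empty.\<close>

lemma bij_betw_window_sets:
  "bij_betw (\<lambda>S. ptcls S \<inter> {- int N..}) (bounded_level N n) (window_sets N n)"
proof (rule bij_betw_byWitness[where f' = "\<lambda>E. Maya ({..<- int N} \<union> E)"])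
  have low: "P = {..<- int N} \<union> (P \<inter> {- int N..})" if "{..<- int N} \<subseteq> P" for P :: "int set"
    using that by auto
  show "\<forall>S\<in>bounded_level N n. Maya ({..<- int N} \<union> (ptcls S \<inter> {- int N..})) = S"
    using low by (auto simp: bounded_level_def ptcls_inverse simp flip: low)
  have ptcls: "ptcls (Maya ({..<- int N} \<union> E)) = {..<- int N} \<union> E" if "E \<in> window_sets N n" for E
  proof (rule Maya_inverse)
    have "finite E" using that by (simp add: window_sets_def)
    then have "finite (({..<- int N} \<union> E) \<inter> {0..})"
      by (rule finite_subset[rotated]) auto
    moreover have "finite ({..<0} - ({..<- int N} \<union> E))"
      by (rule finite_subset[of _ "{- int N..<0}"]) auto
    ultimately show "{..<- int N} \<union> E \<in> {S. finite (S \<inter> {0..}) \<and> finite ({..<0} - S)}" by simp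
  qed
  have inter: "({..<- int N} \<union> E) \<inter> {- int N..} = E" if "E \<in> window_sets N n" for E
    using that by (auto simp: window_sets_def)
  show "\<forall>E\<in>window_sets N n. ptcls (Maya ({..<- int N} \<union> E)) \<inter> {- int N..} = E"
    using ptcls inter by simp
  show "(\<lambda>S. ptcls S \<inter> {- int N..}) ` bounded_level N n \<subseteq> window_sets N n"
  proof (rule image_subsetI)
    fix S assume "S \<in> bounded_level N n"
    then have S: "charge S = 0" "energy S = n" "{..<- int N} \<subseteq> ptcls S" by (auto simp: bounded_level_def)
    then show "ptcls S \<inter> {- int N..} \<in> window_sets N n"
      using finite_window[of S N] unfolding charge_def energy_def reg_sum_window[OF S(3)]
      by (simp add: window_sets_def algebra_simps)
  qed
  show "(\<lambda>E. Maya ({..<- int N} \<union> E)) ` window_sets N n \<subseteq> bounded_level N n"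
  proof (rule image_subsetI)
    fix E assume E: "E \<in> window_sets N n"
    have w: "{..<- int N} \<subseteq> ptcls (Maya ({..<- int N} \<union> E))" using ptcls[OF E] by simp
    show "Maya ({..<- int N} \<union> E) \<in> bounded_level N n"
      unfolding bounded_level_def charge_def energy_def reg_sum_window[OF w] mem_Collect_eq
      unfolding ptcls[OF E] inter[OF E] using E by (simp add: window_sets_def)
  qed
qed

lemma finite_bounded_level: "finite (bounded_level N n)"
  by (rule finite_subset[OF _ finite_energy_le[of n]]) (auto simp: bounded_level_def)

lemma finite_window_sets: "finite (window_sets N n)"
  using bij_betw_window_sets finite_bounded_level bij_betw_finite by blast

text \<open>Either the lowest position is occupied, so that there are at most N parts, or all N + 1
  elements can be lowered by one, which removes a full first column.\<close>

lemma card_window_sets_Suc: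
  "card (window_sets (Suc N) n) = card (window_sets N n) + card (window_sets (Suc N) (n - int (Suc N)))"
proof -
  let ?a = "- int (Suc N)"
  have neg: "(\<Sum>s\<in>{- int (Suc N)..<0}. s) = ?a + (\<Sum>s\<in>{- int N..<0}. s)"
  proof -
    have "{- int (Suc N)..<0} = insert ?a {- int N..<0}" by auto
    then show ?thesis by simp
  qed
  have nin: "?a \<notin> E" if "E \<in> window_sets N n" for E using that by (auto simp: window_sets_def)
  have 1: "bij_betw (insert ?a) (window_sets N n) {E \<in> window_sets (Suc N) n. ?a \<in> E}"
  proof (rule bij_betw_byWitness[where f' = "\<lambda>E. E - {?a}"])
    show "\<forall>E\<in>window_sets N n. insert ?a E - {?a} = E" using nin by auto
    show "\<forall>E\<in>{E \<in> window_sets (Suc N) n. ?a \<in> E}. insert ?a (E - {?a}) = E" by auto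
    show "insert ?a ` window_sets N n \<subseteq> {E \<in> window_sets (Suc N) n. ?a \<in> E}"
    proof (rule image_subsetI)
      fix E assume E: "E \<in> window_sets N n"
      then show "insert ?a E \<in> {E \<in> window_sets (Suc N) n. ?a \<in> E}"
        using nin[OF E] neg by (auto simp: window_sets_def)
    qed
    show "(\<lambda>E. E - {?a}) ` {E \<in> window_sets (Suc N) n. ?a \<in> E} \<subseteq> window_sets N n"
    proof (rule image_subsetI)
      fix E assume E: "E \<in> {E \<in> window_sets (Suc N) n. ?a \<in> E}"
      then have "\<Sum>(E - {?a}) = \<Sum>E - ?a" "card (E - {?a}) = N"
        by (auto simp: window_sets_def sum_diff1)
      moreover have "E - {?a} \<subseteq> {- int N..}" using E by (force simp: window_sets_def)
      ultimately show "E - {?a} \<in> window_sets N n" using E neg by (auto simp: window_sets_def)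
    qed
  qed
  have 2: "bij_betw (\<lambda>E. (\<lambda>s. s + 1) ` E) (window_sets (Suc N) (n - int (Suc N))) {E \<in> window_sets (Suc N) n. ?a \<notin> E}"
  proof (rule bij_betw_byWitness[where f' = "\<lambda>E. (\<lambda>s. s - 1) ` E"])
    have inj: "inj_on (\<lambda>s. s + 1) E" "inj_on (\<lambda>s. s - 1) E" for E :: "int set" by (auto simp: inj_on_def)
    show "(\<lambda>E. (\<lambda>s. s + 1) ` E) ` window_sets (Suc N) (n - int (Suc N)) \<subseteq> {E \<in> window_sets (Suc N) n. ?a \<notin> E}"
      by (force simp: window_sets_def card_image[OF inj(1)] sum.reindex[OF inj(1)] sum.distrib)
    show "(\<lambda>E. (\<lambda>s. s - 1) ` E) ` {E \<in> window_sets (Suc N) n. ?a \<notin> E} \<subseteq> window_sets (Suc N) (n - int (Suc N))"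
    proof (rule image_subsetI)
      fix E assume E: "E \<in> {E \<in> window_sets (Suc N) n. ?a \<notin> E}"
      have "- int (Suc N) \<le> s - 1" if "s \<in> E" for s
      proof -
        have "?a \<le> s" "s \<noteq> ?a" using E that by (auto simp: window_sets_def)
        then show ?thesis by simp
      qed
      then show "(\<lambda>s. s - 1) ` E \<in> window_sets (Suc N) (n - int (Suc N))"
        using E by (auto simp: window_sets_def card_image[OF inj(2)] sum.reindex[OF inj(2)] sum_subtractf)
    qed
  qed (auto simp: image_image)
  have "window_sets (Suc N) n = {E \<in> window_sets (Suc N) n. ?a \<in> E} \<union> {E \<in> window_sets (Suc N) n. ?a \<notin> E}"
    by auto
  then have "card (window_sets (Suc N) n) = card {E \<in> window_sets (Suc N) n. ?a \<in> E} + card {E \<in> window_sets (Suc N) n. ?a \<notin> E}"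
    using finite_window_sets[of "Suc N" n] by (subst card_Un_disjoint[symmetric]) auto
  then show ?thesis using bij_betw_same_card[OF 1] bij_betw_same_card[OF 2] by simp
qed

lemma euler_bounded:
  "Abs_fps (\<lambda>n. of_nat (card (bounded_level N (int n)))) * (\<Prod>j<N. 1 - fps_X ^ Suc j) = (1 :: 'a::comm_ring_1 fps)"
proof (induction N)
  case 0
  have "bounded_level 0 (int n) = (if n = 0 then {vac} else {})" for n
  proof -
    have "S = vac" if "charge S = 0" "{..<0} \<subseteq> ptcls S" for S
    proof (rule maya_eqI)
      have "{..<0} - ptcls S = {}" using that by auto
      then have "card ({..<0} - ptcls S) = 0" by (simp only: card.empty)
      then have "ptcls S \<inter> {0..} = {}" using that(1) finite_ptcls[of S] by (simp add: charge_def reg_sum_def)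
      then show "ptcls S = ptcls vac" using that(2) by (auto simp: not_less[symmetric])
    qed
    then have "S = vac" if "S \<in> bounded_level 0 (int n)" for S
      using that by (simp add: bounded_level_def)
    moreover have "vac \<in> bounded_level 0 (int n) \<longleftrightarrow> n = 0"
      by (simp add: bounded_level_def charge_def energy_def)
    ultimately show ?thesis by auto
  qed
  then show ?case by (auto simp: fps_eq_iff)
next
  case (Suc N)
  define p where "p N = (Abs_fps (\<lambda>n. of_nat (card (bounded_level N (int n)))) :: 'a fps)" for N
  have card: "card (bounded_level N n) = card (window_sets N n)" for N n
    by (rule bij_betw_same_card[OF bij_betw_window_sets])
  have rec: "card (bounded_level (Suc N) n) = card (bounded_level N n) + card (bounded_level (Suc N) (n - int (Suc N)))" for n
    unfolding card by (rule card_window_sets_Suc)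
  have empty: "bounded_level N n = {}" if "n < 0" for N n
  proof -
    have "S \<notin> bounded_level N n" for S using energy_nonneg[of S] that by (auto simp: bounded_level_def)
    then show ?thesis by blast
  qed
  have "p (Suc N) * (1 - fps_X ^ Suc N) = p N"
  proof (rule fps_ext)
    fix n
    have "(p (Suc N) * (1 - fps_X ^ Suc N)) $ n = p (Suc N) $ n - (if n < Suc N then 0 else p (Suc N) $ (n - Suc N))"
      by (simp add: right_diff_distrib fps_X_power_mult_right_nth del: power_Suc)
    also have "\<dots> = p N $ n"
    proof (cases "n < Suc N")
      case True
      then have "bounded_level (Suc N) (int n - int (Suc N)) = {}" by (intro empty) simp
      then show ?thesis using True rec[of "int n"] by (simp add: p_def)
    next
      case False
      then have "int n - int (Suc N) = int (n - Suc N)" by simp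
      then show ?thesis using False rec[of "int n"] by (simp add: p_def)
    qed
    finally show "(p (Suc N) * (1 - fps_X ^ Suc N)) $ n = p N $ n" .
  qed
  then show ?case
    using Suc.IH unfolding p_def[symmetric] prod.lessThan_Suc by (metis mult.assoc mult.commute)
qed

lemma compose_X_power_nth:
  assumes "0 < m"
  shows "(f oo fps_X ^ m) $ n = (if m dvd n then f $ (n div m) else 0 :: 'a::comm_ring_1)"
proof -
  have "(f oo fps_X ^ m) $ n = (\<Sum>i=0..n. if n = m * i then f $ i else 0)"
    unfolding fps_compose_nth by (intro sum.cong refl) (simp add: power_mult[symmetric] fps_X_power_nth)
  also have "\<dots> = (\<Sum>i\<in>(if m dvd n then {n div m} else {}). f $ i)"
    using assms by (intro sum.mono_neutral_cong_right) (auto split: if_splits)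
  finally show ?thesis by simp
qed

text \<open>A partition of a number up to n has at most n parts, so up to degree n the series and
  the product may be replaced by those of \<open>euler_bounded\<close>.\<close>

lemma euler:
  assumes m: "0 < m"
  shows "(Abs_fps (\<lambda>n. of_nat (card (level n))) oo fps_X ^ m) * qpochhammer_inf (fps_X ^ m) (fps_X ^ m) = (1 :: 'a::idom fps)"
proof (rule fps_ext)
  fix n
  let ?P = "Abs_fps (\<lambda>n. of_nat (card (level n))) :: 'a fps"
  let ?p = "Abs_fps (\<lambda>k. of_nat (card (bounded_level n (int k)))) :: 'a fps"
  have level: "level k = bounded_level n (int k)" if "k \<le> n" for k
  proof -
    have "{..<- int n} \<subseteq> ptcls S" if "energy S = int k" for S
    proof
      fix s assume "s \<in> {..<- int n}"
      then show "s \<in> ptcls S" using hole_ge_energy[of s S] that \<open>k \<le> n\<close> by force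
    qed
    then show ?thesis by (auto simp: level_def bounded_level_def)
  qed
  have "((?P oo fps_X ^ m) * qpochhammer_inf (fps_X ^ m) (fps_X ^ m)) $ n =
      (\<Sum>i=0..n. (?p oo fps_X ^ m) $ i * (\<Prod>j<n. 1 - fps_X ^ m * fps_X ^ (m * j)) $ (n - i))"
    unfolding fps_mult_nth
  proof (intro sum.cong refl arg_cong2[of _ _ _ _ "(*)"])
    fix i assume i: "i \<in> {0..n}"
    have "i div m \<le> n" using i by (auto intro: order.trans[OF div_le_dividend])
    then show "(?P oo fps_X ^ m) $ i = (?p oo fps_X ^ m) $ i"
      by (simp add: compose_X_power_nth[OF m] level)
    show "qpochhammer_inf (fps_X ^ m) (fps_X ^ m) $ (n - i) = ((\<Prod>j<n. 1 - fps_X ^ m * fps_X ^ (m * j)) :: 'a fps) $ (n - i)"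
      using m by (intro qpochhammer_inf_nth) auto
  qed
  also have "\<dots> = ((?p oo fps_X ^ m) * (\<Prod>j<n. 1 - fps_X ^ m * fps_X ^ (m * j))) $ n"
    by (simp only: fps_mult_nth)
  also have "(\<Prod>j<n. 1 - fps_X ^ m * fps_X ^ (m * j)) = ((\<Prod>j<n. 1 - fps_X ^ Suc j) oo fps_X ^ m :: 'a fps)"
    using m by (simp add: fps_compose_prod_distrib fps_compose_sub_distrib fps_compose_power[symmetric]
        power_mult[symmetric] power_add[symmetric] del: power_Suc)
  also have "(?p oo fps_X ^ m) * \<dots> = (?p * (\<Prod>j<n. 1 - fps_X ^ Suc j)) oo fps_X ^ m"
    using m by (simp add: fps_compose_mult_distrib)
  also have "\<dots> = 1" unfolding euler_bounded by simp
  finally show "((?P oo fps_X ^ m) * qpochhammer_inf (fps_X ^ m) (fps_X ^ m)) $ n = (1 :: 'a fps) $ n" .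
qed

section \<open>Self-dual diagrams as sets of principal hooks\<close>

definition dual_extension :: "nat set \<Rightarrow> int set" where
  "dual_extension F = int ` F \<union> {m. m < 0 \<and> - 1 - m \<notin> int ` F}"

lemma ptcls_dual_extension:
  assumes "finite F"
  shows "ptcls (Maya (dual_extension F)) = dual_extension F"
proof (rule Maya_inverse)
  have "finite (dual_extension F \<inter> {0..})"
    by (rule finite_subset[of _ "int ` F"]) (use assms in \<open>auto simp: dual_extension_def\<close>)
  moreover have "finite ({..<0} - dual_extension F)"
    by (rule finite_subset[of _ "(\<lambda>m. - 1 - m) ` int ` F"])
       (use assms in \<open>auto simp: dual_extension_def intro!: image_eqI[of _ _ "- 1 - _"]\<close>)
  ultimately show "dual_extension F \<in> {S. finite (S \<inter> {0..}) \<and> finite ({..<0} - S)}" by simp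
qed

lemma dual_extension_ptcls:
  assumes S: "S \<in> self_dual"
  shows "dual_extension {s. int s \<in> ptcls S} = ptcls S"
proof (rule set_eqI)
  fix m
  have nonneg: "m \<in> int ` {s. int s \<in> ptcls S} \<longleftrightarrow> 0 \<le> m \<and> m \<in> ptcls S" for m
    by (auto intro!: image_eqI[of _ _ "nat m"])
  show "m \<in> dual_extension {s. int s \<in> ptcls S} \<longleftrightarrow> m \<in> ptcls S"
    unfolding dual_extension_def Un_iff mem_Collect_eq[of m] nonneg
    using mirroredD[OF S[unfolded self_dual_iff], of m] by (cases "0 \<le> m") simp_all
qed

text \<open>The nonnegative particles determine the rest by reflection and may form any finite set.
  They correspond to the diagonal boxes, s having the principal hook length 2 s + 1.\<close>

lemma bij_betw_nonneg_ptcls: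
  "bij_betw (\<lambda>S. {s. int s \<in> ptcls S}) self_dual {F. finite F}"
proof (rule bij_betw_byWitness[where f' = "\<lambda>F. Maya (dual_extension F)"])
  show "\<forall>S\<in>self_dual. Maya (dual_extension {s. int s \<in> ptcls S}) = S"
    by (simp add: dual_extension_ptcls ptcls_inverse)
  show "\<forall>F\<in>{F. finite F}. {s. int s \<in> ptcls (Maya (dual_extension F))} = F"
  proof
    fix F :: "nat set" assume "F \<in> {F. finite F}"
    then have F: "finite F" by simp
    show "{s. int s \<in> ptcls (Maya (dual_extension F))} = F"
      unfolding ptcls_dual_extension[OF F] by (auto simp: dual_extension_def)
  qed
  show "(\<lambda>S. {s. int s \<in> ptcls S}) ` self_dual \<subseteq> {F. finite F}"
  proof (rule image_subsetI)
    fix S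
    have "finite (int ` {s. int s \<in> ptcls S})" by (rule finite_subset[OF _ finite_ptcls[of S]]) auto
    then show "{s. int s \<in> ptcls S} \<in> {F. finite F}" by (simp add: finite_image_iff inj_on_def)
  qed
  show "(\<lambda>F. Maya (dual_extension F)) ` {F. finite F} \<subseteq> self_dual"
  proof (rule image_subsetI)
    fix F :: "nat set" assume "F \<in> {F. finite F}"
    then have F: "finite F" by simp
    show "Maya (dual_extension F) \<in> self_dual"
      unfolding self_dual_def ptcls_dual_extension[OF F] mem_Collect_eq
    proof
      fix m :: int
      have "- 1 - (- 1 - m) = m" by simp
      then show "m \<in> dual_extension F \<longleftrightarrow> - 1 - m \<notin> dual_extension F"
        by (cases "0 \<le> m") (auto simp: dual_extension_def)
    qed
  qed
qed

lemma reg_sum_self_dual_particles: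
  assumes S: "S \<in> self_dual"
  shows "reg_sum g S = (\<Sum>s\<in>{s. int s \<in> ptcls S}. g (int s) - g (- 1 - int s))"
proof -
  have mem: "- 1 - m \<in> ptcls S \<longleftrightarrow> m \<notin> ptcls S" for m
    using S unfolding self_dual_iff by (rule mirroredD')
  have "sum g (ptcls S \<inter> {0..}) = (\<Sum>s\<in>{s. int s \<in> ptcls S}. g (int s))"
    by (rule sum.reindex_bij_witness[of _ int nat]) auto
  moreover have "sum g ({..<0} - ptcls S) = (\<Sum>s\<in>{s. int s \<in> ptcls S}. g (- 1 - int s))"
  proof (rule sum.reindex_bij_witness[of _ "\<lambda>s. - 1 - int s" "\<lambda>m. nat (- 1 - m)"])
    fix m assume m: "m \<in> {..<0} - ptcls S"
    then have "int (nat (- 1 - m)) = - 1 - m" by simp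
    then show "nat (- 1 - m) \<in> {s. int s \<in> ptcls S}" "- 1 - int (nat (- 1 - m)) = m"
      "g (- 1 - int (nat (- 1 - m))) = g m"
      using mem[of m] m by auto
  qed (use mem in auto)
  ultimately show ?thesis by (simp add: reg_sum_def sum_subtractf)
qed

text \<open>b to the power of the BG-rank: the signs along the principal hook of length 2 s + 1 add
  up to (- 1)^s.\<close>

definition bg_weight :: "'a::field_char_0 \<Rightarrow> maya \<Rightarrow> 'a" where
  "bg_weight b S = b powi (\<Sum>s\<in>{s. int s \<in> ptcls S}. (- 1) ^ s)"

lemma parity_particles:
  assumes S: "S \<in> self_dual"
  shows "reg_sum parity_sign S = 2 * (\<Sum>s\<in>{s. int s \<in> ptcls S}. (- 1) ^ s)"
proof -
  have "parity_sign (int s) - parity_sign (- 1 - int s) = 2 * (- 1) ^ s" for s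
    by (auto simp: parity_sign_def)
  then show ?thesis unfolding reg_sum_self_dual_particles[OF S] by (simp add: sum_distrib_left)
qed

lemma power_int_sum: "b \<noteq> 0 \<Longrightarrow> b powi (\<Sum>i\<in>I. f i) = (\<Prod>i\<in>I. b powi f i)" for b :: "'a::field"
  by (induction I rule: infinite_finite_induct) (simp_all add: power_int_add)

lemma energy_particles:
  assumes S: "S \<in> self_dual"
  shows "energy S = int (\<Sum>s\<in>{s. int s \<in> ptcls S}. 2 * s + 1)"
  unfolding energy_def reg_sum_self_dual_particles[OF S] by (simp add: algebra_simps sum.distrib)

lemma prod_even_odd: "(\<Prod>s<2 * n. f s) = (\<Prod>j<n. f (2 * j)) * (\<Prod>j<n. f (2 * j + 1) :: 'a::comm_monoid_mult)" for n :: nat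
  by (induction n) (simp_all add: mult_ac)

text \<open>Principal hooks are present or absent independently, so the series is a product of
  binomials 1 + c q^(2 s + 1). Here c is b for even s and 1 / b for odd s, which separates the two
  Pochhammer symbols.\<close>

lemma wgf_self_dual:
  fixes b :: "'a::field_char_0"
  assumes b: "b \<noteq> 0"
  shows "wgf self_dual (\<lambda>S. nat (energy S)) (bg_weight b) =
    qpochhammer_inf (- (fps_const b * fps_X)) (fps_X ^ 4) * qpochhammer_inf (- (fps_const (1 / b) * fps_X ^ 3)) (fps_X ^ 4)"
proof -
  define \<beta> where "\<beta> s = (if even s then b else 1 / b)" for s :: nat
  have \<beta>: "b powi ((- 1) ^ s) = \<beta> s" for s
    by (cases "even s") (simp_all add: \<beta>_def power_int_minus inverse_eq_divide)
  define d where "d F = (\<Sum>s\<in>F. 2 * s + 1 :: nat)" for F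
  have "wgf self_dual (\<lambda>S. nat (energy S)) (bg_weight b) =
      wgf self_dual (\<lambda>S. d {s. int s \<in> ptcls S}) (\<lambda>S. \<Prod>s\<in>{s. int s \<in> ptcls S}. \<beta> s)"
    by (rule wgf_cong) (simp_all add: energy_particles bg_weight_def power_int_sum[OF b] \<beta> d_def del: of_nat_sum)
  also have "\<dots> = wgf {F. finite F} d (\<lambda>F. \<Prod>s\<in>F. \<beta> s)"
    by (rule wgf_reindex[OF bij_betw_nonneg_ptcls])
  also have "\<dots> = qpochhammer_inf (- (fps_const b * fps_X)) (fps_X ^ 4) * qpochhammer_inf (- (fps_const (1 / b) * fps_X ^ 3)) (fps_X ^ 4)"
    (is "_ = ?Q1 * ?Q2")
  proof (rule fps_ext)
    fix n
    let ?q1 = "\<Prod>j<n. 1 - (- (fps_const b * fps_X)) * fps_X ^ (4 * j)"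
    let ?q2 = "\<Prod>j<n. 1 - (- (fps_const (1 / b) * fps_X ^ 3)) * fps_X ^ (4 * j)"
    let ?m = "\<lambda>s. fps_const (\<beta> s) * fps_X ^ (2 * s + 1)"
    \<comment> \<open>In degree n only s < 2 n can occur, and these are exactly the s covered by the
      first n factors of both products.\<close>
    have small: "F \<subseteq> {..<2 * n}" if "finite F" "d F = n" for F
    proof
      fix s assume "s \<in> F"
      then show "s \<in> {..<2 * n}"
        using member_le_sum[of s F "\<lambda>s. 2 * s + 1"] that by (simp add: d_def)
    qed
    have "(?Q1 * ?Q2) $ n = (\<Sum>i=0..n. ?q1 $ i * ?q2 $ (n - i))"
      unfolding fps_mult_nth
      by (intro sum.cong refl arg_cong2[of _ _ _ _ "(*)"] qpochhammer_inf_nth) auto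
    also have "\<dots> = (?q1 * ?q2) $ n" by (simp only: fps_mult_nth)
    also have "?q1 * ?q2 = (\<Prod>s<2 * n. ?m s + 1)"
    proof -
      have gen: "g * fps_X ^ (a + e) + 1 = 1 - (- (g * fps_X ^ a)) * fps_X ^ e" for g :: "'a fps" and a e
        by (simp add: power_add mult.assoc)
      have e: "2 * (2 * j) + 1 = 1 + 4 * j" "2 * (2 * j + 1) + 1 = 3 + 4 * j"
        and \<beta>: "\<beta> (2 * j) = b" "\<beta> (2 * j + 1) = 1 / b" for j
        by (simp_all add: \<beta>_def)
      have "?m (2 * j) + 1 = 1 - (- (fps_const b * fps_X)) * fps_X ^ (4 * j)" for j
        unfolding e(1) \<beta>(1) using gen[of "fps_const b" 1 "4 * j"] by (simp only: power_one_right)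
      moreover have "?m (2 * j + 1) + 1 = 1 - (- (fps_const (1 / b) * fps_X ^ 3)) * fps_X ^ (4 * j)" for j
        unfolding e(2) \<beta>(2) by (rule gen)
      ultimately show ?thesis unfolding prod_even_odd by (simp only:)
    qed
    also have "\<dots> = (\<Sum>F\<in>Pow {..<2 * n}. \<Prod>s\<in>F. ?m s)"
      by (subst prod_add) simp_all
    also have "\<dots> $ n = (\<Sum>F\<in>Pow {..<2 * n}. if d F = n then \<Prod>s\<in>F. \<beta> s else 0)"
    proof -
      have const: "(\<Prod>s\<in>F. fps_const (\<beta> s)) = fps_const (\<Prod>s\<in>F. \<beta> s)" for F
        by (induction F rule: infinite_finite_induct) simp_all
      have "(\<Prod>s\<in>F. ?m s) = fps_const (\<Prod>s\<in>F. \<beta> s) * fps_X ^ d F" for F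
        unfolding prod.distrib const d_def power_sum ..
      then show ?thesis by (auto simp: fps_sum_nth fps_X_power_nth intro!: sum.cong)
    qed
    also have "\<dots> = (\<Sum>F\<in>{F \<in> {F. finite F}. d F = n}. \<Prod>s\<in>F. \<beta> s)"
      using small by (intro sum.mono_neutral_cong_right) (auto intro: finite_subset)
    finally show "wgf {F. finite F} d (\<lambda>F. \<Prod>s\<in>F. \<beta> s) $ n = (?Q1 * ?Q2) $ n" by (simp add: wgf_def)
  qed
  finally show ?thesis .
qed

section \<open>The polynomials B\<close>

lemma poly_B_0: "poly (B r 0) \<alpha> = (\<Prod>j=1..r. \<alpha> ^ 2 - of_nat j ^ 2)" for \<alpha> :: "'a::comm_ring_1"
  by (subst B.simps) (simp add: poly_prod)

lemma poly_B_diag: "poly (B r r) \<alpha> = \<alpha> ^ (2 * r)" for \<alpha> :: "'a::comm_ring_1"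
  by (subst B.simps) (auto simp: poly_prod)

lemma poly_B_rec:
  fixes \<alpha> :: "'a::comm_ring_1"
  assumes "k < r"
  shows "poly (B (Suc r) (Suc k)) \<alpha> =
    (\<alpha> ^ 2 * (of_nat (Suc k) + 1) ^ 2 - of_nat (Suc r) ^ 2) * poly (B r (Suc k)) \<alpha> + \<alpha> ^ 2 * poly (B r k) \<alpha>"
  using assms by (subst B.simps) (simp add: of_nat_poly algebra_simps)

text \<open>This expansion is the meaning of \<open>B\<close>. Its recursion arises from splitting
  the new factor (\<alpha> h)^2 - (r + 1)^2 into \<alpha>^2 (h^2 - (k + 1)^2), which raises k, and
  the constant \<alpha>^2 (k + 1)^2 - (r + 1)^2, which keeps it.\<close>

lemma square_falling_scale:
  "square_falling r (\<alpha> * h) = (\<Sum>k\<le>r. poly (B r k) \<alpha> * square_falling k h)"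
proof (induction r)
  case 0
  show ?case by (simp add: poly_B_0)
next
  case (Suc r)
  define p where "p k = poly (B r k) \<alpha>" for k
  define u where "u k = \<alpha> ^ 2 * (of_nat k + 1) ^ 2 - of_nat (Suc r) ^ 2" for k
  have "square_falling (Suc r) (\<alpha> * h) = (\<Sum>k\<le>r. p k * square_falling k h) * ((\<alpha> * h)\<^sup>2 - of_nat (Suc r) ^ 2)"
    using Suc by (simp add: p_def)
  also have "\<dots> = (\<Sum>k\<le>r. u k * p k * square_falling k h + \<alpha> ^ 2 * p k * square_falling (Suc k) h)"
    unfolding sum_distrib_right
    by (intro sum.cong refl) (simp add: u_def algebra_simps power2_eq_square)
  also have "\<dots> = (\<Sum>k\<le>r. u k * p k * square_falling k h) + (\<Sum>k\<le>r. \<alpha> ^ 2 * p k * square_falling (Suc k) h)"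
    by (rule sum.distrib)
  also have "(\<Sum>k\<le>r. u k * p k * square_falling k h) = u 0 * p 0 + (\<Sum>k<r. u (Suc k) * p (Suc k) * square_falling (Suc k) h)"
    by (simp add: lessThan_Suc_atMost[symmetric] sum.lessThan_Suc_shift del: sum.lessThan_Suc)
  also have "(\<Sum>k\<le>r. \<alpha> ^ 2 * p k * square_falling (Suc k) h) =
      (\<Sum>k<r. \<alpha> ^ 2 * p k * square_falling (Suc k) h) + \<alpha> ^ 2 * p r * square_falling (Suc r) h"
    by (simp add: lessThan_Suc_atMost[symmetric])
  also have "u 0 * p 0 + (\<Sum>k<r. u (Suc k) * p (Suc k) * square_falling (Suc k) h) +
      ((\<Sum>k<r. \<alpha> ^ 2 * p k * square_falling (Suc k) h) + \<alpha> ^ 2 * p r * square_falling (Suc r) h) =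
      u 0 * p 0 + (\<Sum>k<r. (u (Suc k) * p (Suc k) + \<alpha> ^ 2 * p k) * square_falling (Suc k) h) +
      \<alpha> ^ 2 * p r * square_falling (Suc r) h"
    by (simp add: sum.distrib distrib_right)
  also have "u 0 * p 0 = poly (B (Suc r) 0) \<alpha> * square_falling 0 h"
    by (simp add: poly_B_0 p_def u_def)
  also have "(\<Sum>k<r. (u (Suc k) * p (Suc k) + \<alpha> ^ 2 * p k) * square_falling (Suc k) h) =
      (\<Sum>k<r. poly (B (Suc r) (Suc k)) \<alpha> * square_falling (Suc k) h)"
    by (intro sum.cong refl) (simp only: poly_B_rec lessThan_iff u_def p_def)
  also have "\<alpha> ^ 2 * p r * square_falling (Suc r) h = poly (B (Suc r) (Suc r)) \<alpha> * square_falling (Suc r) h"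
    by (simp only: poly_B_diag p_def mult_Suc_right power_add)
  also have "poly (B (Suc r) 0) \<alpha> * square_falling 0 h + (\<Sum>k<r. poly (B (Suc r) (Suc k)) \<alpha> * square_falling (Suc k) h) +
      poly (B (Suc r) (Suc r)) \<alpha> * square_falling (Suc r) h = (\<Sum>k\<le>Suc r. poly (B (Suc r) k) \<alpha> * square_falling k h)"
    unfolding lessThan_Suc_atMost[symmetric] sum.lessThan_Suc_shift[of _ "Suc r"] by (simp only: sum.lessThan_Suc add.assoc)
  finally show ?case .
qed

text \<open>\<open>square_falling_scale\<close> is evaluated at h = k + 1. The left side vanishes
  because t h \<le> r; on the right, terms with index above k vanish at h and those below k by
  induction.\<close>

lemma poly_B_eq_0:
  "k \<le> r \<Longrightarrow> t * Suc k \<le> r \<Longrightarrow> 0 < t \<Longrightarrow> poly (B r k) (of_nat t) = (0 :: 'a::field_char_0)"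
proof (induction k rule: less_induct)
  case (less k)
  have "0 = square_falling r (of_nat (t * Suc k) :: 'a)"
    using less.prems by (intro square_falling_eq_0[symmetric]) simp_all
  also have "\<dots> = square_falling r (of_nat t * of_nat (Suc k))" by (simp only: of_nat_mult)
  also have "\<dots> = (\<Sum>j\<le>r. poly (B r j) (of_nat t) * square_falling j (of_nat (Suc k)))"
    by (rule square_falling_scale)
  also have "\<dots> = (\<Sum>j\<in>{k}. poly (B r j) (of_nat t) * square_falling j (of_nat (Suc k)))"
  proof (rule sum.mono_neutral_right)
    show "\<forall>j\<in>{..r} - {k}. poly (B r j) (of_nat t) * square_falling j (of_nat (Suc k)) = (0 :: 'a)"
    proof
      fix j assume j: "j \<in> {..r} - {k}"
      show "poly (B r j) (of_nat t) * square_falling j (of_nat (Suc k)) = (0 :: 'a)"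
      proof (cases "j < k")
        case True
        then have "t * Suc j \<le> r" using less.prems by (meson Suc_mono less_imp_le_nat mult_le_mono2 order.trans)
        then show ?thesis using less.IH[OF True] j less.prems by simp
      next
        case False
        then show ?thesis using j square_falling_eq_0[of "Suc k" j, where 'a = 'a] by simp
      qed
    qed
  qed (use less.prems in auto)
  finally have "poly (B r k) (of_nat t) * square_falling k (of_nat (Suc k)) = (0 :: 'a)" by simp
  moreover have "square_falling k (of_nat (Suc k)) \<noteq> (0 :: 'a)"
  proof -
    have "(of_nat (Suc k))\<^sup>2 - (of_nat i)\<^sup>2 \<noteq> (0 :: 'a)" if "i \<in> {1..k}" for i
    proof -
      have "(Suc k)\<^sup>2 \<noteq> i\<^sup>2" using that by (simp only: power2_eq_iff_nonneg) simp
      then have "of_nat ((Suc k)\<^sup>2) \<noteq> (of_nat (i\<^sup>2) :: 'a)" by (simp only: of_nat_eq_iff not_False_eq_True)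
      then show ?thesis by (simp only: of_nat_power right_minus_eq not_False_eq_True)
    qed
    then show ?thesis unfolding square_falling_def by (simp only: prod_zero_iff finite_atLeastAtMost) blast
  qed
  ultimately show ?case by simp
qed

section \<open>The series of a single runner\<close>

definition comp_size :: "nat \<Rightarrow> nat \<Rightarrow> maya \<Rightarrow> nat" where
  "comp_size k i S = nat (2 * int (2 * k) * energy S + (2 * int i + 1) * charge S)"

definition comp_bg :: "'a::field_char_0 \<Rightarrow> nat \<Rightarrow> maya \<Rightarrow> 'a" where
  "comp_bg b i S = b powi ((- 1) ^ i * charge S)"

definition comp_weight :: "'a::field_char_0 \<Rightarrow> maya \<Rightarrow> 'a" where
  "comp_weight v S = v ^ card (hook_pairs S) * (inv_hook_prod S)\<^sup>2"

definition comp_marks :: "nat \<Rightarrow> nat \<Rightarrow> maya \<Rightarrow> 'a::field_char_0" where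
  "comp_marks r t S = (\<Sum>(m, m')\<in>hook_pairs S. square_falling r (of_nat t * of_int (m - m')))"

lemma comp_size_shift:
  assumes "charge S = 0"
  shows "2 * int (2 * k) * energy (shift c S) + (2 * int i + 1) * charge (shift c S) =
    int (4 * k) * energy S + (int (2 * k) * (c * (c - 1)) + (2 * int i + 1) * c)"
proof -
  have "2 * int (2 * k) * energy (shift c S) = int (2 * k) * (2 * energy S + c * (c - 1))"
    using energy_shift[OF assms, of c] by (metis mult.assoc mult.commute)
  then show ?thesis using assms by (simp add: charge_shift algebra_simps)
qed

text \<open>As 0 < 2 i + 1 < 2 k, the linear term never outweighs the quadratic one, and charge c
  costs at least \<bar>c\<bar>. This shows both that \<open>nat\<close> truncates nothing in
  \<open>comp_size\<close> and that \<open>theta\<close> has finite levels.\<close>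

lemma quadratic_nonneg:
  assumes "i < k"
  shows "\<bar>c\<bar> \<le> int (2 * k) * (c * (c - 1)) + (2 * int i + 1) * c"
proof (cases "0 \<le> c")
  case True
  then have "0 \<le> c * (c - 1)" by (cases "c = 0") auto
  then have "0 \<le> int (2 * k) * (c * (c - 1))" by simp
  moreover have "1 * c \<le> (2 * int i + 1) * c" using True by (intro mult_right_mono) auto
  ultimately show ?thesis using True by linarith
next
  case False
  define e where "e = - c"
  have e: "1 \<le> e" "c = - e" using False by (auto simp: e_def)
  have "int (2 * k) * 2 \<le> int (2 * k) * (e + 1)" using e by (intro mult_left_mono) auto
  moreover have "2 * int i + 2 \<le> int (2 * k)" using assms by simp
  ultimately have "1 \<le> int (2 * k) * (e + 1) - (2 * int i + 1)" by linarith
  then have "e * 1 \<le> e * (int (2 * k) * (e + 1) - (2 * int i + 1))" using e by (intro mult_left_mono) auto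
  moreover have "int (2 * k) * (c * (c - 1)) + (2 * int i + 1) * c = e * (int (2 * k) * (e + 1) - (2 * int i + 1))"
    by (simp add: e(2) algebra_simps)
  ultimately show ?thesis using e by simp
qed

lemma comp_size_nonneg:
  assumes "i < k"
  shows "0 \<le> 2 * int (2 * k) * energy S + (2 * int i + 1) * charge S"
proof -
  define c where "c = charge S"
  define T where "T = shift (- c) S"
  have T: "charge T = 0" "S = shift c T"
    by (simp_all add: T_def c_def charge_shift maya_eqI ptcls_shift)
  show ?thesis unfolding T(2) comp_size_shift[OF T(1)]
    using quadratic_nonneg[OF assms, of c] energy_nonneg[of T] by (simp add: order.trans[OF abs_ge_zero])
qed

text \<open>The series of the runners of index i without boxes, one for each charge: a Jacobi theta
  series.\<close>

definition theta :: "'a::field_char_0 \<Rightarrow> nat \<Rightarrow> nat \<Rightarrow> 'a fps" where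
  "theta b k i = wgf UNIV (\<lambda>c. nat (int (2 * k) * (c * (c - 1)) + (2 * int i + 1) * c)) (\<lambda>c. b powi ((- 1) ^ i * c))"

lemma finite_levels_theta:
  assumes "i < k"
  shows "finite_levels UNIV (\<lambda>c. nat (int (2 * k) * (c * (c - 1)) + (2 * int i + 1) * c))"
  unfolding finite_levels_def
proof
  fix n
  show "finite {c \<in> UNIV. nat (int (2 * k) * (c * (c - 1)) + (2 * int i + 1) * c) = n}"
  proof (rule finite_subset)
    show "{c \<in> UNIV. nat (int (2 * k) * (c * (c - 1)) + (2 * int i + 1) * c) = n} \<subseteq> {- int n..int n}"
    proof
      fix c assume "c \<in> {c \<in> UNIV. nat (int (2 * k) * (c * (c - 1)) + (2 * int i + 1) * c) = n}"
      then show "c \<in> {- int n..int n}" using quadratic_nonneg[OF assms, of c] by auto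
    qed
  qed simp
qed

lemma wgf_level:
  assumes m: "0 < m"
  shows "wgf {S. charge S = 0} (\<lambda>S. m * nat (energy S)) f = Abs_fps (\<lambda>n. \<Sum>S\<in>level n. f S) oo fps_X ^ m"
    and "finite_levels {S. charge S = 0} (\<lambda>S. m * nat (energy S))"
proof -
  have eq: "{S \<in> {S. charge S = 0}. m * nat (energy S) = n} = (if m dvd n then level (n div m) else {})" for n
    using m energy_nonneg by (auto simp: level_def)
  show "finite_levels {S. charge S = 0} (\<lambda>S. m * nat (energy S))"
    unfolding finite_levels_def eq by (simp add: finite_level)
  show "wgf {S. charge S = 0} (\<lambda>S. m * nat (energy S)) f = Abs_fps (\<lambda>n. \<Sum>S\<in>level n. f S) oo fps_X ^ m"
    unfolding wgf_def eq by (rule fps_ext) (simp add: compose_X_power_nth[OF m])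
qed

text \<open>A diagram is a charge and a partition. Sizes add, \<open>comp_bg\<close> sees only the
  charge and f only the partition, so the series factors. A box costs 4 k because its mirror image
  on runner 2 k - 1 - i is counted with it, each with 2 k.\<close>

lemma wgf_comp:
  fixes f :: "maya \<Rightarrow> 'a::field_char_0"
  assumes i: "i < k" and f: "\<And>c S. f (shift c S) = f S"
  shows "wgf UNIV (comp_size k i) (\<lambda>S. comp_bg b i S * f S) =
      theta b k i * (Abs_fps (\<lambda>n. \<Sum>S\<in>level n. f S) oo fps_X ^ (4 * k))"
    and "finite_levels UNIV (comp_size k i)"
proof -
  let ?D = "\<lambda>c. nat (int (2 * k) * (c * (c - 1)) + (2 * int i + 1) * c)"
  let ?A = "UNIV \<times> {S. charge S = 0}"
  have k: "0 < 4 * k" using i by simp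
  have size: "comp_size k i (shift c S) = ?D c + 4 * k * nat (energy S)" if "charge S = 0" for c S
  proof -
    have "0 \<le> int (2 * k) * (c * (c - 1)) + (2 * int i + 1) * c"
      using quadratic_nonneg[OF i, of c] by (rule order.trans[OF abs_ge_zero])
    then show ?thesis
      unfolding comp_size_def comp_size_shift[OF that] using energy_nonneg[of S]
      by (simp add: nat_add_distrib nat_mult_distrib)
  qed
  note times = wgf_times[OF finite_levels_theta[OF i] wgf_level(2)[OF k]]
  have size': "comp_size k i (case p of (c, S) \<Rightarrow> shift c S) = (case p of (c, S) \<Rightarrow> ?D c + 4 * k * nat (energy S))"
    if "p \<in> ?A" for p using that size by auto
  show "finite_levels UNIV (comp_size k i)"
  proof -
    have "{p \<in> ?A. comp_size k i (case p of (c, S) \<Rightarrow> shift c S) = n} =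
        {p \<in> ?A. (case p of (c, S) \<Rightarrow> ?D c + 4 * k * nat (energy S)) = n}" for n
      using size' by auto
    then show ?thesis
      using times(2) unfolding finite_levels_reindex[OF bij_betw_shift, symmetric] by (simp add: finite_levels_def)
  qed
  have "wgf UNIV (comp_size k i) (\<lambda>S. comp_bg b i S * f S) =
      wgf ?A (\<lambda>p. comp_size k i (case p of (c, S) \<Rightarrow> shift c S))
        (\<lambda>p. comp_bg b i (case p of (c, S) \<Rightarrow> shift c S) * f (case p of (c, S) \<Rightarrow> shift c S))"
    by (rule wgf_reindex[OF bij_betw_shift, symmetric])
  also have "\<dots> = wgf ?A (\<lambda>(c, S). ?D c + 4 * k * nat (energy S)) (\<lambda>(c, S). b powi ((- 1) ^ i * c) * f S)"
    by (rule wgf_cong) (auto simp: size comp_bg_def charge_shift f)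
  also have "\<dots> = theta b k i * (Abs_fps (\<lambda>n. \<Sum>S\<in>level n. f S) oo fps_X ^ (4 * k))"
    unfolding theta_def times(1)[symmetric] wgf_level(1)[OF k] ..
  finally show "wgf UNIV (comp_size k i) (\<lambda>S. comp_bg b i S * f S) =
      theta b k i * (Abs_fps (\<lambda>n. \<Sum>S\<in>level n. f S) oo fps_X ^ (4 * k))" .
qed

lemma inv_hook_prod_shift: "inv_hook_prod (shift c S) = inv_hook_prod S"
  unfolding inv_hook_prod_def prod.reindex_bij_betw[OF hook_pairs_shift, symmetric]
  by (simp add: case_prod_unfold)

lemma comp_weight_shift: "comp_weight v (shift c S) = comp_weight v S"
  unfolding comp_weight_def inv_hook_prod_shift bij_betw_same_card[OF hook_pairs_shift, symmetric] ..

lemma comp_marks_shift: "comp_marks r t (shift c S) = comp_marks r t S"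
  unfolding comp_marks_def sum.reindex_bij_betw[OF hook_pairs_shift, symmetric]
  by (simp add: case_prod_unfold)

lemma card_hook_pairs_level: "S \<in> level n \<Longrightarrow> card (hook_pairs S) = n"
  using card_hook_pairs[of S] by (simp add: level_def)

lemma sum_comp_weight: "Abs_fps (\<lambda>n. \<Sum>S\<in>level n. comp_weight v S) = fps_exp v"
proof (rule fps_ext)
  fix n
  have "(\<Sum>S\<in>level n. comp_weight v S) = v ^ n * (\<Sum>S\<in>level n. (inv_hook_prod S)\<^sup>2)"
    unfolding sum_distrib_left by (intro sum.cong refl) (simp add: comp_weight_def card_hook_pairs_level)
  then show "Abs_fps (\<lambda>n. \<Sum>S\<in>level n. comp_weight v S) $ n = fps_exp v $ n"
    by (simp add: sum_inv_hook_prod)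
qed

text \<open>\<open>square_falling_scale\<close> reduces the hook sums to the moments of
  \<open>hook_moment_eq\<close>. The factor 1 / (n - k - 1)! there is the exponential series shifted
  by k + 1, which accounts for the power k + 1.\<close>

lemma sum_comp_weight_marks:
  fixes v :: "'a::field_char_0"
  shows "Abs_fps (\<lambda>n. \<Sum>S\<in>level n. comp_weight v S * comp_marks r t S) =
    fps_exp v * (\<Sum>k\<le>r. fps_const (poly (B r k) (of_nat t) * C k) * (fps_const v * fps_X) ^ (k + 1))"
proof (rule fps_ext)
  fix n
  have "(\<Sum>S\<in>level n. comp_weight v S * comp_marks r t S) =
      (\<Sum>S\<in>level n. v ^ n * ((inv_hook_prod S)\<^sup>2 * (\<Sum>(m, m')\<in>hook_pairs S. \<Sum>k\<le>r. poly (B r k) (of_nat t) * square_falling k (of_int (m - m')))))"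
    by (intro sum.cong refl) (simp add: comp_weight_def comp_marks_def card_hook_pairs_level square_falling_scale)
  also have "\<dots> = v ^ n * (\<Sum>k\<le>r. poly (B r k) (of_nat t) * hook_moment k n)"
  proof -
    have "(\<Sum>(m, m')\<in>hook_pairs S. \<Sum>k\<le>r. poly (B r k) (of_nat t) * square_falling k (of_int (m - m'))) =
        (\<Sum>k\<le>r. poly (B r k) (of_nat t) * (\<Sum>(m, m')\<in>hook_pairs S. square_falling k (of_int (m - m') :: 'a)))" for S
      unfolding case_prod_unfold by (subst sum.swap) (simp only: sum_distrib_left)
    then have "(\<Sum>S\<in>level n. v ^ n * ((inv_hook_prod S)\<^sup>2 * (\<Sum>(m, m')\<in>hook_pairs S. \<Sum>k\<le>r. poly (B r k) (of_nat t) * square_falling k (of_int (m - m'))))) =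
      v ^ n * (\<Sum>S\<in>level n. \<Sum>k\<le>r. poly (B r k) (of_nat t) * ((inv_hook_prod S)\<^sup>2 * (\<Sum>(m, m')\<in>hook_pairs S. square_falling k (of_int (m - m') :: 'a))))"
      by (simp only: sum_distrib_left[where A = "{..r}"] sum_distrib_left[where A = "level n"] mult.left_commute)
    also have "\<dots> = v ^ n * (\<Sum>k\<le>r. poly (B r k) (of_nat t) * hook_moment k n)"
      unfolding hook_moment_def by (subst sum.swap) (simp only: sum_distrib_left[where A = "level n"])
    finally show ?thesis .
  qed
  also have "\<dots> = (\<Sum>k\<le>r. poly (B r k) (of_nat t) * C k * (if k < n then v ^ n / fact (n - k - 1) else 0))"
    unfolding sum_distrib_left by (intro sum.cong refl) (simp add: hook_moment_eq)
  also have "\<dots> = (\<Sum>k\<le>r. (fps_exp v * (fps_const (poly (B r k) (of_nat t) * C k) * (fps_const v * fps_X) ^ (k + 1))) $ n)"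
  proof (intro sum.cong refl)
    fix k
    define c where "c = poly (B r k) (of_nat t) * (C k :: 'a)"
    have "(fps_const v * fps_X) ^ (k + 1) = fps_const (v ^ (k + 1)) * fps_X ^ (k + 1)"
      by (simp only: power_mult_distrib fps_const_power)
    then have "fps_exp v * (fps_const c * (fps_const v * fps_X) ^ (k + 1)) =
        fps_const c * (fps_const (v ^ (k + 1)) * (fps_X ^ (k + 1) * fps_exp v))"
      by (simp only: mult_ac)
    then have nth: "(fps_exp v * (fps_const c * (fps_const v * fps_X) ^ (k + 1))) $ n =
        c * (v ^ (k + 1) * (if n < k + 1 then 0 else v ^ (n - (k + 1)) / fact (n - (k + 1))))"
      by (simp only: fps_mult_left_const_nth fps_X_power_mult_nth fps_exp_nth of_nat_fact)
    have "v ^ (k + 1) * v ^ (n - (k + 1)) = v ^ n" if "k < n"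
      using that by (simp only: power_add[symmetric]) simp
    then show "c * (if k < n then v ^ n / fact (n - k - 1) else 0) =
        (fps_exp v * (fps_const c * (fps_const v * fps_X) ^ (k + 1))) $ n"
      unfolding nth by (auto simp del: power_Suc)
  qed
  finally show "Abs_fps (\<lambda>n. \<Sum>S\<in>level n. comp_weight v S * comp_marks r t S) $ n =
      (fps_exp v * (\<Sum>k\<le>r. fps_const (poly (B r k) (of_nat t) * C k) * (fps_const v * fps_X) ^ (k + 1))) $ n"
    by (simp only: fps_nth_Abs_fps sum_distrib_left fps_sum_nth)
qed

section \<open>From the hooks of a partition to its runners\<close>

lemma hooks_sum_prod:
  fixes g :: "nat \<Rightarrow> 'a::field_char_0" and t :: nat
  assumes l: "l \<in> self_conjugate"
  defines "P \<equiv> {(s, s') \<in> hook_pairs (maya_of l). int t dvd s - s'}"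
  shows "size (hooks t l) = card P"
    and "(\<Sum>h\<in>#hooks t l. g h) = (\<Sum>(s, s')\<in>P. g (nat (s - s')))"
    and "(\<Prod>h\<in>#hooks t l. g h) = (\<Prod>(s, s')\<in>P. g (nat (s - s')))"
  unfolding hooks_maya_of[OF l] P_def sum_unfold_sum_mset prod_unfold_prod_mset
  by (simp_all add: multiset.map_comp comp_def case_prod_unfold)

context
  fixes l :: "nat list" and k :: nat
  assumes l: "l \<in> self_conjugate" and k: "0 < k"
begin

lemma self_dual_maya_of: "maya_of l \<in> self_dual"
  using bij_betw_self_dual l by (auto simp: bij_betw_def)

lemma partition_self_conjugate: "l \<in> partitions"
  using l by (simp add: self_conjugate_def)

lemma sum_list_comp: "sum_list l = (\<Sum>i<k. comp_size k i (quot_comp (2 * k) i (maya_of l)))"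
proof -
  have "int (sum_list l) = (\<Sum>i<k. int (comp_size k i (quot_comp (2 * k) i (maya_of l))))"
    unfolding energy_maya_of[OF partition_self_conjugate, symmetric] energy_self_dual[OF self_dual_maya_of k]
    by (intro sum.cong refl) (simp add: comp_size_def comp_size_nonneg[of _ k] del: of_nat_mult)
  then show ?thesis by (simp only: of_nat_sum[symmetric] of_nat_eq_iff)
qed

lemma BG_rank_comp: "b \<noteq> 0 \<Longrightarrow> b powi BG_rank l = (\<Prod>i<k. comp_bg b i (quot_comp (2 * k) i (maya_of l)))"
proof -
  assume b: "b \<noteq> 0"
  have "BG_rank l = (\<Sum>i<k. (- 1) ^ i * charge (quot_comp (2 * k) i (maya_of l)))"
    using BG_rank_maya_of[OF partition_self_conjugate] parity_self_dual[OF self_dual_maya_of k] by simp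
  then show ?thesis by (simp add: comp_bg_def power_int_sum[OF b])
qed

text \<open>A hook h on a runner i < k stands for two hooks of length 2 k h and contributes the
  square of x / (2 k h); this is the origin of the weight x^2 / (2 k)^2 per box.\<close>

lemma weight_comp:
  fixes x :: "'a::field_char_0"
  shows "x ^ size (hooks (2 * k) l) * (\<Prod>h\<in>#hooks (2 * k) l. 1 / of_nat h) =
    (\<Prod>i<k. comp_weight (x\<^sup>2 / (of_nat (2 * k))\<^sup>2) (quot_comp (2 * k) i (maya_of l)))"
proof -
  define F where "F d = x * (1 / of_int d)" for d
  have "x ^ size (hooks (2 * k) l) * (\<Prod>h\<in>#hooks (2 * k) l. 1 / of_nat h) =
    (\<Prod>(s, s')\<in>{(s, s') \<in> hook_pairs (maya_of l). int (2 * k) dvd s - s'}. x * (1 / of_nat (nat (s - s'))))"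
    unfolding hooks_sum_prod[OF l] case_prod_unfold prod.distrib by simp
  also have "\<dots> = (\<Prod>(s, s')\<in>{(s, s') \<in> hook_pairs (maya_of l). int (2 * k) dvd s - s'}. F (s - s'))"
    by (intro prod.cong refl) (auto simp: F_def hook_pairs_def)
  also have "\<dots> = (\<Prod>i<k. (\<Prod>(m, m')\<in>hook_pairs (quot_comp (2 * k) i (maya_of l)). F (int (2 * k) * (m - m')))\<^sup>2)"
    by (rule prod_hooks_self_dual[OF self_dual_maya_of k])
  also have "\<dots> = (\<Prod>i<k. comp_weight (x\<^sup>2 / (of_nat (2 * k))\<^sup>2) (quot_comp (2 * k) i (maya_of l)))"
  proof (intro prod.cong refl)
    fix i
    let ?S = "quot_comp (2 * k) i (maya_of l)"
    have "F (int (2 * k) * d) = (x / of_nat (2 * k)) * (1 / of_int d)" for d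
      by (simp add: F_def)
    then have "(\<Prod>(m, m')\<in>hook_pairs ?S. F (int (2 * k) * (m - m'))) = (x / of_nat (2 * k)) ^ card (hook_pairs ?S) * inv_hook_prod ?S"
      by (simp only: inv_hook_prod_def case_prod_unfold prod.distrib prod_constant)
    then show "(\<Prod>(m, m')\<in>hook_pairs ?S. F (int (2 * k) * (m - m')))\<^sup>2 = comp_weight (x\<^sup>2 / (of_nat (2 * k))\<^sup>2) ?S"
      by (simp only: comp_weight_def power_mult_distrib power_divide[symmetric] power_mult[symmetric] mult.commute)
  qed
  finally show ?thesis .
qed

lemma marks_comp:
  "(\<Sum>h\<in>#hooks (2 * k) l. \<Prod>i=1..r. (of_nat h ^ 2 - of_nat i ^ 2 :: 'a::field_char_0)) =
    2 * (\<Sum>j<k. comp_marks r (2 * k) (quot_comp (2 * k) j (maya_of l)))"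
proof -
  have "(\<Sum>h\<in>#hooks (2 * k) l. \<Prod>i=1..r. (of_nat h ^ 2 - of_nat i ^ 2 :: 'a)) =
    (\<Sum>(s, s')\<in>{(s, s') \<in> hook_pairs (maya_of l). int (2 * k) dvd s - s'}. square_falling r (of_nat (nat (s - s'))))"
    unfolding hooks_sum_prod[OF l] square_falling_def ..
  also have "\<dots> = (\<Sum>(s, s')\<in>{(s, s') \<in> hook_pairs (maya_of l). int (2 * k) dvd s - s'}. square_falling r (of_int (s - s')))"
    by (intro sum.cong refl) (auto simp: hook_pairs_def)
  also have "\<dots> = 2 * (\<Sum>j<k. comp_marks r (2 * k) (quot_comp (2 * k) j (maya_of l)))"
    unfolding sum_hooks_self_dual[OF self_dual_maya_of k, of "\<lambda>d. square_falling r (of_int d)"] comp_marks_def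
    by (simp only: of_int_mult of_int_of_nat_eq)
  finally show ?thesis .
qed

end

section \<open>Assembling the identity\<close>

lemma bij_betw_quotient:
  assumes "0 < k"
  shows "bij_betw (\<lambda>l. restrict (\<lambda>i. quot_comp (2 * k) i (maya_of l)) {..<k}) self_conjugate (PiE {..<k} (\<lambda>_. UNIV))"
  using bij_betw_trans[OF bij_betw_self_dual bij_betw_quot_comp[OF assms]] by (simp add: comp_def)

text \<open>Self-dual diagrams are counted twice: by runners, giving the theta product times k
  partition series, and by principal hooks as in \<open>wgf_self_dual\<close>. Multiplying by the
  k-th power of Euler's product removes the partition series.\<close>

lemma prod_theta:
  fixes b :: "'a::field_char_0"
  assumes k: "0 < k" and b: "b \<noteq> 0"
  shows "(\<Prod>i<k. theta b k i) = qpochhammer_inf (fps_X ^ (4 * k)) (fps_X ^ (4 * k)) ^ k *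
    qpochhammer_inf (- (fps_const b * fps_X)) (fps_X ^ 4) * qpochhammer_inf (- (fps_const (1 / b) * fps_X ^ 3)) (fps_X ^ 4)"
proof -
  let ?q = "qpochhammer_inf (fps_X ^ (4 * k)) (fps_X ^ (4 * k)) :: 'a fps"
  let ?p = "Abs_fps (\<lambda>n. of_nat (card (level n))) oo fps_X ^ (4 * k) :: 'a fps"
  have pq: "?p * ?q = 1" using k by (intro euler) simp
  have one: "wgf UNIV (comp_size k i) (comp_bg b i) = theta b k i * ?p" if "i < k" for i
    using wgf_comp(1)[OF that, of "\<lambda>_. 1 :: 'a" b] by simp
  let ?f = "\<lambda>S. restrict (\<lambda>i. quot_comp (2 * k) i S) {..<k}"
  have "(\<Prod>i<k. theta b k i * ?p) = (\<Prod>i<k. wgf UNIV (comp_size k i) (comp_bg b i))"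
    by (intro prod.cong refl) (simp add: one)
  also have "\<dots> = wgf (PiE {..<k} (\<lambda>_. UNIV)) (\<lambda>h. \<Sum>i<k. comp_size k i (h i)) (\<lambda>h. \<Prod>i<k. comp_bg b i (h i))"
    by (rule wgf_prod) (auto intro: wgf_comp(2))
  also have "\<dots> = wgf self_dual (\<lambda>S. \<Sum>i<k. comp_size k i (?f S i)) (\<lambda>S. \<Prod>i<k. comp_bg b i (?f S i))"
    by (rule wgf_reindex[OF bij_betw_quot_comp[OF k], symmetric])
  also have "\<dots> = wgf self_dual (\<lambda>S. nat (energy S)) (bg_weight b)"
  proof (rule wgf_cong)
    fix S assume S: "S \<in> self_dual"
    have "int (\<Sum>i<k. comp_size k i (?f S i)) = energy S"
      unfolding energy_self_dual[OF S k] of_nat_sum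
      by (intro sum.cong refl) (simp add: comp_size_def comp_size_nonneg[of _ k] del: of_nat_mult)
    then show "(\<Sum>i<k. comp_size k i (?f S i)) = nat (energy S)" by linarith
    show "(\<Prod>i<k. comp_bg b i (?f S i)) = bg_weight b S"
      using parity_self_dual[OF S k] parity_particles[OF S]
      by (simp add: bg_weight_def comp_bg_def power_int_sum[OF b, symmetric])
  qed
  also have "\<dots> = qpochhammer_inf (- (fps_const b * fps_X)) (fps_X ^ 4) *
      qpochhammer_inf (- (fps_const (1 / b) * fps_X ^ 3)) (fps_X ^ 4)"
    by (rule wgf_self_dual[OF b])
  finally have "(\<Prod>i<k. theta b k i) * ?p ^ k = qpochhammer_inf (- (fps_const b * fps_X)) (fps_X ^ 4) *
      qpochhammer_inf (- (fps_const (1 / b) * fps_X ^ 3)) (fps_X ^ 4)"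
    by (simp add: prod.distrib)
  moreover have "(\<Prod>i<k. theta b k i) * (?p * ?q) ^ k = ?q ^ k * ((\<Prod>i<k. theta b k i) * ?p ^ k)"
    by (simp only: power_mult_distrib mult_ac)
  ultimately have "(\<Prod>i<k. theta b k i) * (?p * ?q) ^ k = ?q ^ k * (qpochhammer_inf (- (fps_const b * fps_X)) (fps_X ^ 4) *
      qpochhammer_inf (- (fps_const (1 / b) * fps_X ^ 3)) (fps_X ^ 4))"
    by (simp only:)
  then show ?thesis unfolding pq by (simp only: power_one mult_1_right mult.assoc)
qed

lemma compose_scaled_X_power:
  fixes f :: "'a::field_char_0 fps"
  assumes "0 < m"
  shows "f oo (fps_const w * fps_X ^ m) = (f oo (fps_const w * fps_X)) oo fps_X ^ m"
proof -
  have "(fps_const w * fps_X) oo fps_X ^ m = fps_const w * fps_X ^ m"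
    using assms by (simp add: fps_compose_mult_distrib)
  moreover have "f oo ((fps_const w * fps_X) oo fps_X ^ m) = (f oo (fps_const w * fps_X)) oo fps_X ^ m"
    using assms by (intro fps_compose_assoc) simp_all
  ultimately show ?thesis by simp
qed

theorem corollary4p5:
  fixes r t :: nat and x b :: "'a::field_char_0"
  assumes "0 < r" and "0 < t" and "even t" and "b \<noteq> 0"
  shows "((\<lambda>l. fps_X ^ sum_list l
              * fps_const (x ^ size (hooks t l) * b powi BG_rank l
                  * (\<Prod>h\<in>#hooks t l. 1 / of_nat h)
                  * (\<Sum>h\<in>#hooks t l. \<Prod>i=1..r. (of_nat h ^ 2 - of_nat i ^ 2))))
          has_sum
          (of_nat t
            * qpochhammer_inf (fps_X ^ (2 * t)) (fps_X ^ (2 * t)) ^ (t div 2)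
            * qpochhammer_inf (- (fps_const b * fps_X)) (fps_X ^ 4)
            * qpochhammer_inf (- (fps_const (1 / b) * fps_X ^ 3)) (fps_X ^ 4)
            * (fps_exp 1 oo (fps_const (x ^ 2 / (2 * of_nat t)) * fps_X ^ (2 * t)))
            * (\<Sum>k = nat \<lceil>(real r - real t + 1) / real t\<rceil>..r.
                 fps_const (poly (B r k) (of_nat t) * C k)
                   * (fps_const (x ^ 2 / of_nat t ^ 2) * fps_X ^ (2 * t)) ^ (k + 1))))
         self_conjugate"
proof -
  define k where "k = t div 2"
  have t: "t = 2 * k" and k: "0 < k" using assms by (auto simp: k_def)
  define m where "m = 2 * t"
  have m: "m = 4 * k" "0 < m" using k by (auto simp: m_def t)
  define v where "v = x\<^sup>2 / (of_nat t)\<^sup>2"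
  define c where "c l = x ^ size (hooks t l) * b powi BG_rank l * (\<Prod>h\<in>#hooks t l. 1 / of_nat h)
      * (\<Sum>h\<in>#hooks t l. \<Prod>i=1..r. (of_nat h ^ 2 - of_nat i ^ 2))" for l
  let ?f = "\<lambda>l. restrict (\<lambda>i. quot_comp (2 * k) i (maya_of l)) {..<k}"
  let ?PiE = "PiE {..<k} (\<lambda>_. UNIV) :: (nat \<Rightarrow> maya) set"
  define d where "d h = (\<Sum>i<k. comp_size k i (h i))" for h
  \<comment> \<open>The weight of runner i when the distinguished hook of the sum lies on runner
    j.\<close>
  define y where "y j i S = comp_bg b i S * (comp_weight v S * (if i = j then comp_marks r t S else 1))" for i j :: nat and S
  define Sr where "Sr = (\<Sum>k\<le>r. fps_const (poly (B r k) (of_nat t) * (C k :: 'a)) * (fps_const v * fps_X) ^ (k + 1))"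
  define E where "E = fps_exp v oo fps_X ^ m"
  have d: "sum_list l = d (?f l)" if "l \<in> self_conjugate" for l
    unfolding d_def sum_list_comp[OF that k] by (intro sum.cong refl) simp
  \<comment> \<open>The sum over hooks is distributed over the runner j that carries the hook; the 2
    accounts for its mirror image.\<close>
  have c: "c l = 2 * (\<Sum>j<k. \<Prod>i<k. y j i (?f l i))" if l: "l \<in> self_conjugate" for l
  proof -
    define h where "h i = quot_comp (2 * k) i (maya_of l)" for i
    have "c l = (\<Prod>i<k. comp_weight v (h i)) * (\<Prod>i<k. comp_bg b i (h i)) * (2 * (\<Sum>j<k. comp_marks r t (h j)))"
      unfolding c_def v_def h_def BG_rank_comp[OF l k assms(4), symmetric] t
        weight_comp[OF l k, symmetric] marks_comp[OF l k, symmetric] by (simp only: mult_ac)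
    also have "\<dots> = 2 * (\<Sum>j<k. \<Prod>i<k. y j i (h i))"
    proof -
      have "(\<Prod>i<k. y j i (h i)) = (\<Prod>i<k. comp_weight v (h i)) * (\<Prod>i<k. comp_bg b i (h i)) * comp_marks r t (h j)"
        if "j < k" for j
        using that by (simp add: y_def prod.distrib mult_ac)
      then have "(\<Sum>j<k. \<Prod>i<k. y j i (h i)) =
          (\<Sum>j<k. (\<Prod>i<k. comp_weight v (h i)) * (\<Prod>i<k. comp_bg b i (h i)) * comp_marks r t (h j))"
        by (intro sum.cong refl) simp
      then show ?thesis by (simp add: sum_distrib_left mult_ac)
    qed
    finally show ?thesis by (simp add: h_def)
  qed
  have fin: "finite_levels ?PiE d"
    unfolding d_def by (rule wgf_prod(2)) (auto intro: wgf_comp(2))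
  have "finite_levels self_conjugate sum_list"
    using fin unfolding finite_levels_reindex[OF bij_betw_quotient[OF k], symmetric]
    by (simp add: finite_levels_def d cong: conj_cong)
  then have has_sum: "((\<lambda>l. fps_X ^ sum_list l * fps_const (c l)) has_sum wgf self_conjugate sum_list c) self_conjugate"
    by (rule has_sum_wgf)
  have comp: "wgf UNIV (comp_size k i) (y j i) = theta b k i * (E * (if i = j then Sr oo fps_X ^ m else 1))"
    if i: "i < k" for i j
  proof -
    have "wgf UNIV (comp_size k i) (y j i) = theta b k i *
        (Abs_fps (\<lambda>n. \<Sum>S\<in>level n. comp_weight v S * (if i = j then comp_marks r t S else 1)) oo fps_X ^ (4 * k))"
      unfolding y_def by (rule wgf_comp(1)[OF i]) (simp add: comp_weight_shift comp_marks_shift)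
    also have "Abs_fps (\<lambda>n. \<Sum>S\<in>level n. comp_weight v S * (if i = j then comp_marks r t S else 1)) =
        fps_exp v * (if i = j then Sr else 1)"
      using sum_comp_weight[of v] sum_comp_weight_marks[of v r t] by (simp add: Sr_def)
    finally show ?thesis using k by (simp add: E_def m(1) fps_compose_mult_distrib)
  qed
  have "wgf self_conjugate sum_list c =
      wgf self_conjugate (\<lambda>l. d (?f l)) (\<lambda>l. 2 * (\<Sum>j<k. \<Prod>i<k. y j i (?f l i)))"
    by (rule wgf_cong) (simp_all only: d c)
  also have "\<dots> = wgf ?PiE d (\<lambda>h. 2 * (\<Sum>j<k. \<Prod>i<k. y j i (h i)))"
    by (rule wgf_reindex[OF bij_betw_quotient[OF k]])
  also have "\<dots> = fps_const 2 * (\<Sum>j<k. wgf ?PiE d (\<lambda>h. \<Prod>i<k. y j i (h i)))"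
    by (simp only: wgf_const_mult wgf_sum)
  also have "\<dots> = fps_const 2 * (\<Sum>j<k. \<Prod>i<k. wgf UNIV (comp_size k i) (y j i))"
    unfolding d_def
    by (intro arg_cong[of _ _ "(*) _"] sum.cong refl wgf_prod(1)[symmetric]) (auto intro: wgf_comp(2))
  also have "\<dots> = fps_const 2 * (\<Sum>j<k. (\<Prod>i<k. theta b k i) * (E ^ k * (Sr oo fps_X ^ m)))"
  proof (intro arg_cong[of _ _ "(*) _"] sum.cong refl)
    fix j assume j: "j \<in> {..<k}"
    have "(\<Prod>i<k. wgf UNIV (comp_size k i) (y j i)) = (\<Prod>i<k. theta b k i * (E * (if i = j then Sr oo fps_X ^ m else 1)))"
      by (intro prod.cong refl) (simp add: comp)
    then show "(\<Prod>i<k. wgf UNIV (comp_size k i) (y j i)) = (\<Prod>i<k. theta b k i) * (E ^ k * (Sr oo fps_X ^ m))"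
      using j by (simp add: prod.distrib)
  qed
  \<comment> \<open>The k summands are equal, and with the factor 2 they give t = 2 k.\<close>
  also have "\<dots> = of_nat t * ((\<Prod>i<k. theta b k i) * (E ^ k * (Sr oo fps_X ^ m)))"
    by (simp add: t flip: fps_of_nat fps_const_mult)
  also have "E ^ k = fps_exp 1 oo (fps_const (x ^ 2 / (2 * of_nat t)) * fps_X ^ m)"
  proof -
    \<comment> \<open>The exponents of the k exponential factors add up.\<close>
    have "of_nat k * v = x ^ 2 / (2 * of_nat t)" using k by (simp add: v_def t power2_eq_square)
    then show ?thesis
      using m(2) by (simp add: E_def compose_scaled_X_power fps_compose_power fps_exp_power_mult)
  qed
  also have "Sr oo fps_X ^ m = (\<Sum>k = nat \<lceil>(real r - real t + 1) / real t\<rceil>..r.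
      fps_const (poly (B r k) (of_nat t) * C k) * (fps_const v * fps_X ^ m) ^ (k + 1))"
  proof -
    have "Sr oo fps_X ^ m = (\<Sum>k\<le>r. fps_const (poly (B r k) (of_nat t) * C k) * (fps_const v * fps_X ^ m) ^ (k + 1))"
      unfolding Sr_def fps_compose_sum_distrib using m(2)
      by (simp add: fps_compose_mult_distrib fps_compose_power[symmetric] del: power_Suc)
    also have "\<dots> = (\<Sum>k = nat \<lceil>(real r - real t + 1) / real t\<rceil>..r.
      fps_const (poly (B r k) (of_nat t) * C k) * (fps_const v * fps_X ^ m) ^ (k + 1))"
    \<comment> \<open>An index j below the lower limit satisfies t (j + 1) \<le> r, where the
      coefficient vanishes by \<open>poly_B_eq_0\<close>. A negative limit becomes 0 under
      \<open>nat\<close>, and then no index is dropped.\<close>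
    proof (rule sum.mono_neutral_right)
      show "\<forall>j\<in>{..r} - {nat \<lceil>(real r - real t + 1) / real t\<rceil>..r}.
        fps_const (poly (B r j) (of_nat t) * (C j :: 'a)) * (fps_const v * fps_X ^ m) ^ (j + 1) = 0"
      proof
        fix j assume j: "j \<in> {..r} - {nat \<lceil>(real r - real t + 1) / real t\<rceil>..r}"
        then have "j < nat \<lceil>(real r - real t + 1) / real t\<rceil>"
          by (simp only: Diff_iff atLeastAtMost_iff atMost_iff not_le[symmetric]) blast
        then have "int j < \<lceil>(real r - real t + 1) / real t\<rceil>" by (simp only: zless_nat_eq_int_zless)
        then have "real j < (real r - real t + 1) / real t" by (simp add: less_ceiling_iff)
        then have "real t * real j < real r - real t + 1" using assms(2) by (simp add: field_simps)
        then have "real (t * Suc j) < real (r + 1)" by (simp add: algebra_simps)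
        then have "t * Suc j \<le> r" by (simp only: of_nat_less_iff)
        then have "poly (B r j) (of_nat t) = (0 :: 'a)" using j assms(2) by (intro poly_B_eq_0) auto
        then show "fps_const (poly (B r j) (of_nat t) * (C j :: 'a)) * (fps_const v * fps_X ^ m) ^ (j + 1) = 0" by simp
      qed
    qed auto
    finally show ?thesis .
  qed
  finally show ?thesis
    using has_sum unfolding prod_theta[OF k assms(4)]
    unfolding m(1)[symmetric] c_def v_def unfolding m_def k_def
    by (simp only: mult.assoc)
qed

end
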